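(* Let $p>0$, and for real $l$ let $\mathbf{E}_l(z):=E(z-l)$, where $E$ is Stallard's entire function with parameter $p$ (defined in the context). Then $$\lim_{l\to+\infty}\mathrm{HypDim}(\mathbf{E}_l)=1 ,$$ where $l$ tends to $+\infty$ through real numbers.
   Context: Fix $p>0$. Let $$G=\left\{x+iy\in\mathbb{C}:\ x>3,\ |y|<\frac{\pi x}{(1+p)(\log x)^p}\right\}$$ and let $L=\partial G$, oriented in the clockwise direction. Let $f(z)=\exp\big(e^{(\log z)^{1+p}}\big)$, where the branch of $(\log z)^{1+p}$ is the one taking real values for real $z>e$ (principal branches). The entire function $E:\mathbb{C}\to\mathbb{C}$ is defined by $$E(z)=\frac{1}{2\pi i}\int_L\frac{f(\xi)}{\xi-z}\,d\xi\quad\text{for } z\in\mathbb{C}\setminus\overline{G},$$ and by analytic continuation for $z\in\overline{G}$ (it is known that this continuation exists and is entire). A set $X\subset\mathbb{C}$ is a hyperbolic set for an entire function $g$ if it is compact, forward-invariant under $g$ (i.e. $g(X)\subset X$), and there exist $c>0$ and $\kappa>1$ such that $|(g^n)'(z)|\ge c\kappa^n$ for every $z\in X$ and all $n\ge1$. The hyperbolic dimension $\mathrm{HypDim}(g)$ is the supremum of the Hausdorff dimensions of all hyperbolic sets of $g$. *)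

theory Defs
  imports "HOL-Complex_Analysis.Complex_Analysis"
begin

subsection \<open>Hausdorff measure and Hausdorff dimension\<close>

text \<open>
  The contribution \<open>diam(U)^s\<close> of a covering set, with the conventions
  \<open>diam(U)^0 = 1\<close> for nonempty \<open>U\<close> and contribution \<open>0\<close> for the empty set
  (note that \<open>0 powr 0 = 0\<close> in HOL).
\<close>
definition diam_pow :: "real \<Rightarrow> 'a::metric_space set \<Rightarrow> ennreal" where
  "diam_pow s U =
     (if U = {} then 0 else if s = 0 then 1 else ennreal (diameter U powr s))"

text \<open>
  Boundedness of the covering sets is required explicitly, because \<open>diameter\<close> is
  unspecified on unbounded sets.
\<close>
definition hausdorff_premeasure :: "real \<Rightarrow> real \<Rightarrow> 'a::metric_space set \<Rightarrow> ennreal" where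
  "hausdorff_premeasure s \<delta> A =
     (INF U \<in> {U :: nat \<Rightarrow> 'a set. A \<subseteq> (\<Union>i. U i) \<and>
                (\<forall>i. bounded (U i) \<and> diameter (U i) \<le> \<delta>)}.
        \<Sum>i. diam_pow s (U i))"

definition hausdorff_measure :: "real \<Rightarrow> 'a::metric_space set \<Rightarrow> ennreal" where
  "hausdorff_measure s A = (SUP \<delta> \<in> {0<..}. hausdorff_premeasure s \<delta> A)"

definition hausdorff_dim :: "'a::metric_space set \<Rightarrow> ennreal" where
  "hausdorff_dim A = (INF s \<in> {s. 0 \<le> s \<and> hausdorff_measure s A = 0}. ennreal s)"


subsection \<open>Hyperbolic sets and hyperbolic dimension\<close>

definition hyperbolic_set :: "(complex \<Rightarrow> complex) \<Rightarrow> complex set \<Rightarrow> bool" where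
  "hyperbolic_set g X \<longleftrightarrow>
     compact X \<and> g ` X \<subseteq> X \<and>
     (\<exists>c \<kappa>. c > 0 \<and> \<kappa> > (1::real) \<and>
        (\<forall>z\<in>X. \<forall>n\<ge>1. norm (deriv (g ^^ n) z) \<ge> c * \<kappa> ^ n))"

definition HypDim :: "(complex \<Rightarrow> complex) \<Rightarrow> ennreal" where
  "HypDim g = (SUP X \<in> {X. hyperbolic_set g X}. hausdorff_dim X)"


subsection \<open>Stallard's entire function\<close>

definition stallard_height :: "real \<Rightarrow> real \<Rightarrow> real" where
  "stallard_height p x = pi * x / ((1 + p) * (ln x) powr p)"

definition stallard_G :: "real \<Rightarrow> complex set" where
  "stallard_G p = {z. Re z > 3 \<and> \<bar>Im z\<bar> < stallard_height p (Re z)}"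

text \<open>
  A parametrisation of the boundary of \<open>G\<close> by the real line, clockwise (\<open>G\<close> lies to
  the right): for \<open>t \<le> -1\<close> it comes in from infinity along the lower boundary curve,
  for \<open>-1 \<le> t \<le> 1\<close> it runs up the vertical segment on \<open>Re z = 3\<close>, and for \<open>t \<ge> 1\<close> it
  goes out to infinity along the upper boundary curve.
\<close>
definition stallard_L :: "real \<Rightarrow> real \<Rightarrow> complex" where
  "stallard_L p t =
     (let x = 2 + max 1 \<bar>t\<bar> in Complex x (max (-1) (min 1 t) * stallard_height p x))"

definition stallard_f :: "real \<Rightarrow> complex \<Rightarrow> complex" where
  "stallard_f p z = exp (exp (Ln z powr of_real (1 + p)))"

text \<open>
  The Cauchy integral along the unbounded contour. The two corners of the contour
  form a null set, so the value of \<open>vector_derivative\<close> there is irrelevant.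
\<close>
definition stallard_cauchy :: "real \<Rightarrow> complex \<Rightarrow> complex" where
  "stallard_cauchy p z =
     1 / (2 * of_real pi * \<i>) *
     (LINT t|lborel. stallard_f p (stallard_L p t) / (stallard_L p t - z) *
                     vector_derivative (stallard_L p) (at t))"

definition stallard_E :: "real \<Rightarrow> complex \<Rightarrow> complex" where
  "stallard_E p =
     (THE E. E holomorphic_on UNIV \<and>
             (\<forall>z. z \<notin> closure (stallard_G p) \<longrightarrow> E z = stallard_cauchy p z))"


subsection \<open>The parametrised contour is the boundary of the domain\<close>

lemma stallard_height_pos: "p > 0 \<Longrightarrow> x \<ge> 3 \<Longrightarrow> stallard_height p x > 0"
  by (auto simp: stallard_height_def intro!: divide_pos_pos mult_pos_pos)

lemma continuous_on_stallard_height: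
  "p > 0 \<Longrightarrow> continuous_on {3..} (stallard_height p)"
  unfolding stallard_height_def by (intro continuous_intros) auto

lemma continuous_stallard_height_max:
  assumes "p > 0"
  shows "continuous_on UNIV (\<lambda>x. stallard_height p (max 3 x))"
  by (rule continuous_on_compose2[OF continuous_on_stallard_height[OF assms]])
     (auto intro!: continuous_intros)

lemma open_stallard_G:
  assumes "p > 0"
  shows "open (stallard_G p)"
proof -
  have "stallard_G p = {z. 3 < Re z} \<inter> {z. \<bar>Im z\<bar> < stallard_height p (max 3 (Re z))}"
    by (auto simp: stallard_G_def max_def)
  moreover have "continuous_on UNIV (\<lambda>z. stallard_height p (max 3 (Re z)))"
    by (rule continuous_on_compose2[OF continuous_stallard_height_max[OF assms]])
       (auto intro!: continuous_intros)
  ultimately show ?thesis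
    by (auto intro!: open_Int open_Collect_less continuous_intros)
qed

lemma closure_stallard_G:
  assumes "p > 0"
  shows "closure (stallard_G p) = {z. Re z \<ge> 3 \<and> \<bar>Im z\<bar> \<le> stallard_height p (Re z)}"
    (is "_ = ?C")
proof
  have "?C = {z. 3 \<le> Re z} \<inter> {z. \<bar>Im z\<bar> \<le> stallard_height p (max 3 (Re z))}"
    by (auto simp: max_def)
  moreover have "continuous_on UNIV (\<lambda>z. stallard_height p (max 3 (Re z)))"
    by (rule continuous_on_compose2[OF continuous_stallard_height_max[OF assms]])
       (auto intro!: continuous_intros)
  ultimately have "closed ?C"
    by (auto intro!: closed_Int closed_Collect_le continuous_intros)
  then show "closure (stallard_G p) \<subseteq> ?C"
    by (intro closure_minimal) (auto simp: stallard_G_def)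
next
  show "?C \<subseteq> closure (stallard_G p)"
  proof
    fix z assume z: "z \<in> ?C"
    let ?h = "\<lambda>x. stallard_height p (max 3 x)"
    define r where "r = Im z / ?h (Re z)"
    define w where "w s = Complex (Re z + s) (r * (1 - s) * ?h (Re z + s))" for s
    have hz: "?h (Re z) > 0" using stallard_height_pos[OF assms] by simp
    have r1: "\<bar>r\<bar> \<le> 1" using z hz by (auto simp: r_def max_def)
    have w0: "w 0 = z" using hz by (simp add: w_def r_def complex_eq_iff)
    have ch: "continuous_on UNIV (\<lambda>s. ?h (Re z + s))"
      by (rule continuous_on_compose2[OF continuous_stallard_height_max[OF assms]])
         (auto intro!: continuous_intros)
    have "continuous_on UNIV w" unfolding w_def Complex_eq
      by (intro continuous_intros ch)
    then have "(w \<longlongrightarrow> z) (at_right 0)"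
      using w0 by (simp add: continuous_on_def) (metis filterlim_at_split)
    moreover have "eventually (\<lambda>s. w s \<in> stallard_G p) (at_right 0)"
      unfolding eventually_at_right_field
    proof (intro exI[of _ 1] conjI allI impI)
      fix s :: real assume s: "s > 0" "s < 1"
      have p: "?h (Re z + s) > 0" using stallard_height_pos[OF assms] by simp
      have "\<bar>r\<bar> * (1 - s) \<le> 1 * (1 - s)"
        using r1 s by (intro mult_right_mono) auto
      also have "\<dots> < 1" using s by simp
      finally have "\<bar>r\<bar> * (1 - s) < 1" .
      then have "\<bar>r\<bar> * (1 - s) * ?h (Re z + s) < 1 * ?h (Re z + s)"
        using p by (rule mult_strict_right_mono)
      then show "w s \<in> stallard_G p"
        using z s p by (auto simp: w_def stallard_G_def abs_mult max_def split: if_splits)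
    qed auto
    then have "eventually (\<lambda>s. w s \<in> closure (stallard_G p)) (at_right 0)"
      by (rule eventually_mono) (use closure_subset in blast)
    ultimately show "z \<in> closure (stallard_G p)"
      by (intro Lim_in_closed_set[of _ w "at_right 0"]) auto
  qed
qed

lemma range_stallard_L:
  assumes "p > 0"
  shows "range (stallard_L p) = frontier (stallard_G p)"
proof -
  have fr: "frontier (stallard_G p) =
      {z. Re z \<ge> 3 \<and> \<bar>Im z\<bar> \<le> stallard_height p (Re z) \<and>
          (Re z = 3 \<or> \<bar>Im z\<bar> = stallard_height p (Re z))}"
    unfolding frontier_def interior_open[OF open_stallard_G[OF assms]]
      closure_stallard_G[OF assms]
    by (auto simp: stallard_G_def)
  show ?thesis
  proof (intro equalityI subsetI)
    fix z assume "z \<in> range (stallard_L p)"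
    then obtain t where t: "z = stallard_L p t" by auto
    define x where "x = 2 + max 1 \<bar>t\<bar>"
    have h: "stallard_height p x > 0"
      using stallard_height_pos[OF assms] by (simp add: x_def)
    have "\<bar>max (-1) (min 1 t)\<bar> \<le> 1" by auto
    then have "\<bar>max (-1) (min 1 t)\<bar> * stallard_height p x \<le> 1 * stallard_height p x"
      using h by (intro mult_right_mono) auto
    moreover have "x = 3 \<or> \<bar>max (-1) (min 1 t)\<bar> = 1" by (auto simp: x_def)
    moreover have "z = Complex x (max (-1) (min 1 t) * stallard_height p x)"
      unfolding t stallard_L_def Let_def x_def ..
    ultimately show "z \<in> frontier (stallard_G p)"
      using h unfolding fr by (auto simp: abs_mult x_def)
  next
    fix z assume "z \<in> frontier (stallard_G p)"
    then have z: "Re z \<ge> 3" "\<bar>Im z\<bar> \<le> stallard_height p (Re z)"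
        "Re z = 3 \<or> \<bar>Im z\<bar> = stallard_height p (Re z)"
      unfolding fr by auto
    have h: "stallard_height p (Re z) > 0"
      using stallard_height_pos[OF assms] z by simp
    consider "Re z = 3" | "Im z = stallard_height p (Re z)" | "Im z = - stallard_height p (Re z)"
      using z(3) by linarith
    then show "z \<in> range (stallard_L p)"
    proof cases
      case 1
      define t where "t = Im z / stallard_height p 3"
      have "\<bar>t\<bar> \<le> 1" using z(2) h 1 by (simp add: t_def)
      then have "stallard_L p t = Complex 3 (t * stallard_height p 3)"
        by (auto simp: stallard_L_def Let_def max_def min_def)
      also have "\<dots> = z" using h 1 by (simp add: t_def complex_eq_iff)
      finally show ?thesis by blast
    next
      case 2
      then have "stallard_L p (Re z - 2) = z"
        using z(1) by (simp add: stallard_L_def Let_def complex_eq_iff)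
      then show ?thesis by (metis rangeI)
    next
      case 3
      then have "stallard_L p (2 - Re z) = z"
        using z(1) by (simp add: stallard_L_def Let_def complex_eq_iff)
      then show ?thesis by (metis rangeI)
    qed
  qed
qed

end

theory Submission
  imports Defs "HOL-Real_Asymp.Real_Asymp" "HOL-Probability.Sinc_Integral"
begin

text \<open>
  Moving the contour, with Cauchy's theorem on half planes and on half planes slit along a
  vertical ray, shows that \<open>E\<close> is entire, that \<open>E = f + C\<close> with \<open>C\<close> bounded and Lipschitz in the
  narrower tract \<open>|Im z| < 7h(Re z)/8\<close>, where \<open>h\<close> is \<open>stallard_height p\<close>, and that \<open>E\<close> is bounded
  elsewhere. Write \<open>f = exp \<circ> \<Phi>\<close> and let \<open>\<Psi>(v) = exp((log v)\<^sup>q)\<close>, \<open>q = 1/(1+p)\<close>, be the inverse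
  of \<open>\<Phi>\<close>; then \<open>|\<Psi>'(v)|\<close> is at most \<open>|v|\<close> to the power \<open>\<epsilon> - 1\<close> for large \<open>|v|\<close>.

  Upper bound: for large \<open>l\<close> the disc around 0 of radius \<open>sup |E|\<close> off the tract is mapped into
  itself without expansion, so a hyperbolic set (translated by \<open>-l\<close>) lies in the tract. On the
  part where \<open>Im \<Phi>\<close> is close to \<open>2\<pi>k\<close>, the map expands at least by a constant times
  \<open>l (|k|+1)\<^sup>r\<close>, \<open>r = 1 - \<epsilon>\<close>, and the resulting series of contraction constants to the
  power \<open>s > 1\<close> tends to 0 as \<open>l\<close> grows.

  Lower bound: put \<open>Q = \<Psi>(N)\<close>. The branches with \<open>N \<le> k < 2N\<close> map a disc of radius \<open>Q/2\<close> around
  \<open>Q\<close> into itself, and each contracts at most by a factor \<open>N\<close> to the power \<open>-1/t\<close>, \<open>t < 1\<close>, when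
  \<open>N\<close> is large, since \<open>Q\<close> grows more slowly than any power of \<open>N\<close>.
\<close>

section \<open>Dimension of expanding sets\<close>

text \<open>The two bounds use \<open>l\<close> differently. The lower bound holds for every
  \<open>l \<ge> 0\<close>: \<open>l\<close> stays fixed, and as \<open>N\<close> grows there are
  \<open>N\<close> branches whose expansion is \<open>N\<close> up to powers of \<open>Q\<close>, so
  the dimension 1 is approached whatever \<open>l\<close> is. The upper bound needs large
  \<open>l\<close>: a hyperbolic set lies to the right of \<open>l\<close>, so \<open>exp v\<close>
  has real part at least \<open>l / 2\<close> there and every branch of \<open>Ln\<close>
  contributes a factor \<open>2 / l\<close>. The exponent 1 is the threshold because
  \<open>(|k| + 1) powr (- r * s)\<close> is summable over all branches only if
  \<open>r * s > 1\<close>, and \<open>r < 1\<close> can be taken close to 1. The obstacle is that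
  \<open>E\<close> has no explicit inverse branches, as it differs from
  \<open>exp \<circ> \<Phi>\<close> by the bounded part \<open>C\<close> (\<open>J 1 3\<close> in
  the code). In the upper bound its Lipschitz term is absorbed by the factor \<open>1 / l\<close>;
  in the lower bound the branches are found as fixed points of a contraction. The tract is cut at
  7/8 of the height because the contours at heights 3/4 and 1 then both stay at distance at least 1
  from the points they are used for, one for points outside the tract and one for points
  inside.\<close>

lemma diam_pow_pos: "s > 0 \<Longrightarrow> diam_pow s U = ennreal (diameter U powr s)"
  by (simp add: diam_pow_def)

lemma hausdorff_premeasure_antimono:
  assumes "\<delta> \<le> \<delta>'"
  shows "hausdorff_premeasure s \<delta>' A \<le> hausdorff_premeasure s \<delta> A"
  unfolding hausdorff_premeasure_def
  by (rule INF_superset_mono) (auto intro: order.trans[OF _ assms])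

text \<open>Pull a cover back by \<open>g\<close> and cut it along the pieces: the part over
  \<open>U i\<close> in \<open>Y k\<close> shrinks by \<open>c k\<close>. The power sum is
  multiplied by at most 1/2, and \<open>c k \<le> 1/2\<close> halves the mesh.\<close>

lemma hausdorff_premeasure_contract:
  fixes X :: "'a::real_normed_vector set" and Y :: "nat \<Rightarrow> 'a set" and c :: "nat \<Rightarrow> real"
  assumes X: "bounded X" and s: "s > 0" and gX: "g ` X \<subseteq> X" and cov: "X \<subseteq> (\<Union>k. Y k)"
    and lip: "\<And>k x y. x \<in> X \<inter> Y k \<Longrightarrow> y \<in> X \<inter> Y k \<Longrightarrow> norm (x - y) \<le> c k * norm (g x - g y)"
    and c: "\<And>k. 0 \<le> c k" "\<And>k. c k \<le> 1/2"
    and sm: "summable (\<lambda>k. c k powr s)" "(\<Sum>k. c k powr s) \<le> 1/2" and \<delta>: "\<delta> > 0"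
  shows "2 * hausdorff_premeasure s (\<delta> / 2) X \<le> hausdorff_premeasure s \<delta> X"
  unfolding hausdorff_premeasure_def[of s \<delta>]
proof (rule INF_greatest)
  fix U :: "nat \<Rightarrow> 'a set"
  assume "U \<in> {U. X \<subseteq> (\<Union>i. U i) \<and> (\<forall>i. bounded (U i) \<and> diameter (U i) \<le> \<delta>)}"
  then have U: "X \<subseteq> (\<Union>i. U i)" "\<And>i. bounded (U i)" "\<And>i. diameter (U i) \<le> \<delta>" by auto
  define W where "W = (\<lambda>(k,i). X \<inter> Y k \<inter> g -` U i)"
  have dW: "diameter (W (k,i)) \<le> c k * diameter (U i)" for k i
  proof (rule diameter_le)
    show "W (k,i) \<noteq> {} \<or> 0 \<le> c k * diameter (U i)"
      using c(1) diameter_ge_0[OF U(2)] by simp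
  next
    fix x y assume xy: "x \<in> W (k,i)" "y \<in> W (k,i)"
    then have "norm (x - y) \<le> c k * norm (g x - g y)" using lip by (auto simp: W_def)
    also have "norm (g x - g y) \<le> diameter (U i)"
      using xy diameter_bounded_bound[OF U(2), of "g x" i "g y"] by (auto simp: W_def dist_norm)
    finally show "norm (x - y) \<le> c k * diameter (U i)" using c(1) by (simp add: mult_left_mono)
  qed
  have half: "c k * diameter (U i) \<le> \<delta> / 2" for k i
    using mult_mono[OF c(2)[of k] U(3)[of i]] c \<delta> diameter_ge_0[OF U(2)] by simp
  have bW: "bounded (W x)" for x using X by (auto simp: W_def split: prod.splits intro: bounded_subset)
  have "hausdorff_premeasure s (\<delta>/2) X \<le> (\<Sum>i. diam_pow s (W (prod_decode i)))"
    unfolding hausdorff_premeasure_def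
  proof (rule INF_lower, safe)
    fix x assume x: "x \<in> X"
    then obtain k where k: "x \<in> Y k" using cov by auto
    obtain i where i: "g x \<in> U i" using gX x U(1) by blast
    have "x \<in> W (prod_decode (prod_encode (k,i)))" using x k i by (simp add: W_def)
    then show "x \<in> (\<Union>i. W (prod_decode i))" by blast
  next
    fix i show "bounded (W (prod_decode i))" by (rule bW)
    show "diameter (W (prod_decode i)) \<le> \<delta>/2"
      using dW[of "fst (prod_decode i)" "snd (prod_decode i)"]
        half[of "fst (prod_decode i)" "snd (prod_decode i)"] by (simp add: W_def)
  qed
  also have "\<dots> = (\<Sum>k. \<Sum>i. diam_pow s (W (k,i)))"
    by (rule suminf_ennreal_2dimen) simp
  also have "\<dots> \<le> (\<Sum>k. \<Sum>i. ennreal (c k powr s) * diam_pow s (U i))"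
  proof (intro suminf_le allI)
    fix k i
    have "diameter (W (k,i)) powr s \<le> (c k * diameter (U i)) powr s"
      using s by (intro powr_mono2 dW diameter_ge_0 bW) auto
    also have "\<dots> = c k powr s * diameter (U i) powr s"
      using c diameter_ge_0[OF U(2)] by (simp add: powr_mult)
    finally show "diam_pow s (W (k,i)) \<le> ennreal (c k powr s) * diam_pow s (U i)"
      using s by (simp add: diam_pow_pos ennreal_leI flip: ennreal_mult)
  qed auto
  also have "\<dots> = (\<Sum>k. ennreal (c k powr s)) * (\<Sum>i. diam_pow s (U i))"
    by (simp add: ennreal_suminf_cmult ennreal_suminf_multc)
  also have "(\<Sum>k. ennreal (c k powr s)) = ennreal (\<Sum>k. c k powr s)"
    using sm by (intro suminf_ennreal2) auto
  also have "\<dots> \<le> ennreal (1/2)" using sm by (intro ennreal_leI)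
  finally have "hausdorff_premeasure s (\<delta>/2) X \<le> ennreal (1/2) * (\<Sum>i. diam_pow s (U i))"
    by (simp add: mult_right_mono)
  then have "2 * hausdorff_premeasure s (\<delta>/2) X \<le> 2 * (ennreal (1/2) * (\<Sum>i. diam_pow s (U i)))"
    by (rule mult_left_mono) simp
  also have "\<dots> = (2 * ennreal (1/2)) * (\<Sum>i. diam_pow s (U i))" by (simp only: mult.assoc)
  also have "2 * ennreal (1/2) = ennreal (2 * (1/2))" by (subst ennreal_mult) auto
  finally show "2 * hausdorff_premeasure s (\<delta>/2) X \<le> (\<Sum>i. diam_pow s (U i))" by simp
qed

text \<open>Iterating the halving bounds \<open>2 ^ n\<close> times the premeasure at mesh
  \<open>D / 2 ^ n\<close> by a finite constant. Premeasures grow as the mesh shrinks, so at a fixed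
  mesh the value is below constant / \<open>2 ^ n\<close> for all large \<open>n\<close>, hence
  0.\<close>

lemma hausdorff_dim_le_contracting:
  fixes X :: "'a::real_normed_vector set" and Y :: "nat \<Rightarrow> 'a set" and c :: "nat \<Rightarrow> real"
  assumes X: "bounded X" and s: "s > 0" and gX: "g ` X \<subseteq> X" and cov: "X \<subseteq> (\<Union>k. Y k)"
    and lip: "\<And>k x y. x \<in> X \<inter> Y k \<Longrightarrow> y \<in> X \<inter> Y k \<Longrightarrow> norm (x - y) \<le> c k * norm (g x - g y)"
    and c: "\<And>k. 0 \<le> c k" "\<And>k. c k \<le> 1/2"
    and sm: "summable (\<lambda>k. c k powr s)" "(\<Sum>k. c k powr s) \<le> 1/2"
  shows "hausdorff_dim X \<le> ennreal s"
proof -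
  \<comment> \<open>The added 1 keeps the mesh positive when \<open>X\<close> has diameter
    0.\<close>
  define D where "D = diameter X + 1"
  have D: "D > 0" using diameter_ge_0[OF X] by (simp add: D_def)
  let ?P = "\<lambda>\<delta>. hausdorff_premeasure s \<delta> X"
  have fin: "?P D \<le> ennreal (diameter X powr s)"
  proof -
    have "?P D \<le> (\<Sum>i::nat. diam_pow s (if i = 0 then X else {}))"
      unfolding hausdorff_premeasure_def using X D by (intro INF_lower) (auto simp: D_def)
    also have "\<dots> = (\<Sum>i::nat. if i = 0 then ennreal (diameter X powr s) else 0)"
      using s by (intro suminf_cong) (auto simp: diam_pow_pos)
    also have "\<dots> = ennreal (diameter X powr s)"
      by (subst suminf_finite[of "{0}"]) auto
    finally show ?thesis .
  qed
  have iter: "2 ^ n * ?P (D / 2 ^ n) \<le> ?P D" for n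
  proof (induction n)
    case (Suc n)
    have "2 ^ Suc n * ?P (D / 2 ^ Suc n) = 2 ^ n * (2 * ?P (D / 2 ^ n / 2))"
      by (simp add: mult.assoc mult.commute mult.left_commute)
    also have "\<dots> \<le> 2 ^ n * ?P (D / 2 ^ n)"
      by (intro mult_left_mono hausdorff_premeasure_contract[OF X s gX cov lip c sm])
         (use D in auto)
    also note Suc
    finally show ?case .
  qed simp
  have "?P \<delta> = 0" if \<delta>: "\<delta> > 0" for \<delta>
  proof (rule ccontr)
    assume "?P \<delta> \<noteq> 0"
    obtain n0 where n0: "D / \<delta> < 2 ^ n0" using real_arch_pow[of 2 "D/\<delta>"] by auto
    have low: "2 ^ n * ?P \<delta> \<le> ennreal (diameter X powr s)" if "n \<ge> n0" for n
    proof -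
      have "(2::real) ^ n0 \<le> 2 ^ n" using that by simp
      then have "D / \<delta> \<le> 2 ^ n" using n0 by linarith
      then have "D / 2 ^ n \<le> \<delta>" using \<delta> by (simp add: field_simps)
      then have "2 ^ n * ?P \<delta> \<le> 2 ^ n * ?P (D / 2 ^ n)"
        by (intro mult_left_mono hausdorff_premeasure_antimono) auto
      then show ?thesis using iter[of n] fin by order
    qed
    have ne: "?P \<delta> < top"
    proof (rule ccontr)
      assume "\<not> ?P \<delta> < top"
      then have "?P \<delta> = top" using less_top by blast
      then show False using low[of n0] by (simp add: ennreal_mult_top top_unique)
    qed
    then obtain r where r: "?P \<delta> = ennreal r" "r \<ge> 0" by (cases "?P \<delta>") auto
    with \<open>?P \<delta> \<noteq> 0\<close> have r0: "r > 0" by (cases "r = 0") auto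
    obtain n1 where n1: "diameter X powr s / r < 2 ^ n1"
      using real_arch_pow[of 2 "diameter X powr s / r"] by auto
    define n where "n = max n0 n1"
    have "2 ^ n * ?P \<delta> = ennreal (2 ^ n * r)"
      using r by (simp add: ennreal_mult flip: ennreal_power)
    then have "2 ^ n * r \<le> diameter X powr s" using low[of n] by (simp add: n_def ennreal_le_iff)
    moreover have "(2::real) ^ n1 \<le> 2 ^ n" by (intro power_increasing) (auto simp: n_def)
    then have "diameter X powr s / r < 2 ^ n" using n1 by linarith
    ultimately show False using r0 by (simp add: field_simps)
  qed
  then have "hausdorff_measure s X = 0" by (simp add: hausdorff_measure_def)
  then show ?thesis unfolding hausdorff_dim_def using s by (intro INF_lower) auto
qed

text \<open>Of the sub-covers of the pieces \<open>X k\<close>, the one with the smallest sum is mapped by \<open>g\<close> to a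
  cover of the whole set with fewer members and no larger sum; iterate until some member has
  diameter at least \<open>d\<close>.\<close>

lemma finite_cover_sum_ge:
  fixes X :: "'i \<Rightarrow> 'a::real_normed_vector set"
  assumes I: "finite I" "card I \<ge> 2" and s: "s > 0" and d: "d > 0"
    and ne: "\<And>k. k \<in> I \<Longrightarrow> X k \<noteq> {}"
    and gap: "\<And>j k x y. j \<in> I \<Longrightarrow> k \<in> I \<Longrightarrow> j \<noteq> k \<Longrightarrow> x \<in> X j \<Longrightarrow> y \<in> X k \<Longrightarrow> dist x y \<ge> d"
    and gX: "\<And>k. k \<in> I \<Longrightarrow> g ` X k = (\<Union>j\<in>I. X j)" and bX: "bounded (\<Union>j\<in>I. X j)"
    and B: "B \<ge> 0" "B powr s \<le> card I"
    and lip: "\<And>k x y. k \<in> I \<Longrightarrow> x \<in> X k \<Longrightarrow> y \<in> X k \<Longrightarrow> norm (g x - g y) \<le> B * norm (x - y)"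
  shows "finite \<U> \<Longrightarrow> (\<forall>U\<in>\<U>. bounded U) \<Longrightarrow> (\<Union>j\<in>I. X j) \<subseteq> \<Union>\<U> \<Longrightarrow>
     d powr s \<le> (\<Sum>U\<in>\<U>. diameter U powr s)"
proof (induction "card \<U>" arbitrary: \<U> rule: less_induct)
  case less
  note fU = less.prems(1) and bU = less.prems(2) and cU = less.prems(3)
  show ?case
  proof (cases "\<exists>U\<in>\<U>. diameter U \<ge> d")
    case True
    then obtain U where U: "U \<in> \<U>" "diameter U \<ge> d" by blast
    have "d powr s \<le> diameter U powr s" using U d s by (intro powr_mono2) auto
    also have "\<dots> \<le> (\<Sum>U\<in>\<U>. diameter U powr s)" using U fU by (intro member_le_sum) auto
    finally show ?thesis .
  next
    case False
    define \<V> where "\<V> k = {U\<in>\<U>. U \<inter> X k \<noteq> {}}" for k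
    \<comment> \<open>All members have diameter below \<open>d\<close> now, so none of them meets
      two pieces.\<close>
    have disj: "\<V> j \<inter> \<V> k = {}" if "j \<in> I" "k \<in> I" "j \<noteq> k" for j k
    proof (rule ccontr)
      assume "\<V> j \<inter> \<V> k \<noteq> {}"
      then obtain U x y where U: "U \<in> \<U>" "x \<in> U" "x \<in> X j" "y \<in> U" "y \<in> X k"
        by (auto simp: \<V>_def)
      have "d \<le> dist x y" using gap that U by blast
      also have "\<dots> \<le> diameter U" using U bU by (intro diameter_bounded_bound) auto
      finally show False using False U by blast
    qed
    have fV: "finite (\<V> k)" for k using fU by (simp add: \<V>_def)
    define S where "S k = (\<Sum>U\<in>\<V> k. diameter U powr s)" for k
    have "(\<Sum>k\<in>I. S k) = (\<Sum>U\<in>(\<Union>k\<in>I. \<V> k). diameter U powr s)"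
      unfolding S_def using I disj fV by (intro sum.UNION_disjoint[symmetric]) auto
    also have "\<dots> \<le> (\<Sum>U\<in>\<U>. diameter U powr s)"
      using fU by (intro sum_mono2) (auto simp: \<V>_def)
    finally have tot: "(\<Sum>k\<in>I. S k) \<le> (\<Sum>U\<in>\<U>. diameter U powr s)" .
    have "\<exists>k\<in>I. card I * S k \<le> (\<Sum>U\<in>\<U>. diameter U powr s)"
    proof (rule ccontr)
      assume "\<not> ?thesis"
      then have "(\<Sum>k\<in>I. card I * S k) > (\<Sum>k\<in>I. (\<Sum>U\<in>\<U>. diameter U powr s))"
        using I by (intro sum_strict_mono) auto
      then have "card I * (\<Sum>k\<in>I. S k) > card I * (\<Sum>U\<in>\<U>. diameter U powr s)"
        by (simp add: sum_distrib_left)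
      then show False using tot by (simp add: mult_less_cancel_left)
    qed
    then obtain k where k: "k \<in> I" "card I * S k \<le> (\<Sum>U\<in>\<U>. diameter U powr s)" by blast
    define \<W> where "\<W> = (\<lambda>U. g ` (U \<inter> X k)) ` \<V> k"
    \<comment> \<open>A second piece has to be covered as well, by members outside
      \<open>\<V> k\<close>. So \<open>\<V> k\<close> misses at least one member and the induction
      on the cardinality applies.\<close>
    have "\<not> I \<subseteq> {k}" using I card_mono[of "{k}" I] by auto
    then obtain j where j: "j \<in> I" "j \<noteq> k" by auto
    obtain x where x: "x \<in> X j" using ne j by blast
    then obtain U where U: "U \<in> \<U>" "x \<in> U" using cU j by blast
    then have "U \<in> \<V> j" using x by (auto simp: \<V>_def)
    then have "U \<notin> \<V> k" using disj j k by blast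
    then have "\<V> k \<subset> \<U>" using U by (auto simp: \<V>_def)
    then have "card (\<V> k) < card \<U>" using fU psubset_card_mono by blast
    moreover have "card \<W> \<le> card (\<V> k)" unfolding \<W>_def using fV by (rule card_image_le)
    ultimately have cW: "card \<W> < card \<U>" by simp
    have bW: "bounded (g ` (U \<inter> X k))" for U
      by (rule bounded_subset[OF bX]) (use gX[OF k(1)] in blast)
    have "d powr s \<le> (\<Sum>W\<in>\<W>. diameter W powr s)"
    proof (rule less.hyps[OF cW])
      show "finite \<W>" using fV by (simp add: \<W>_def)
      show "\<forall>U\<in>\<W>. bounded U" using bW by (auto simp: \<W>_def)
      show "(\<Union>j\<in>I. X j) \<subseteq> \<Union>\<W>"
      proof
        fix x assume "x \<in> (\<Union>j\<in>I. X j)"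
        then obtain y where y: "y \<in> X k" "x = g y" using gX[OF k(1)] by blast
        then obtain U where "U \<in> \<U>" "y \<in> U" using cU k by blast
        then show "x \<in> \<Union>\<W>" using y by (auto simp: \<W>_def \<V>_def)
      qed
    qed
    also have "\<dots> \<le> (\<Sum>U\<in>\<V> k. diameter (g ` (U \<inter> X k)) powr s)"
      unfolding \<W>_def using sum_image_le[OF fV, where g = "\<lambda>W. diameter W powr s" and f = "\<lambda>U. g ` (U \<inter> X k)"]
      by (simp add: o_def)
    also have "\<dots> \<le> (\<Sum>U\<in>\<V> k. B powr s * diameter U powr s)"
    proof (rule sum_mono)
      fix U assume "U \<in> \<V> k"
      then have U: "bounded U" using bU by (auto simp: \<V>_def)
      have "diameter (g ` (U \<inter> X k)) \<le> B * diameter U"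
      proof (rule diameter_le)
        show "g ` (U \<inter> X k) \<noteq> {} \<or> 0 \<le> B * diameter U" using B diameter_ge_0[OF U] by simp
        fix x y assume "x \<in> g ` (U \<inter> X k)" "y \<in> g ` (U \<inter> X k)"
        then obtain x' y' where xy: "x' \<in> U" "x' \<in> X k" "y' \<in> U" "y' \<in> X k" "x = g x'" "y = g y'"
          by blast
        have "norm (x - y) \<le> B * norm (x' - y')" using lip k xy by blast
        also have "\<dots> \<le> B * diameter U"
          using B diameter_bounded_bound[OF U xy(1,3)] by (simp add: dist_norm mult_left_mono)
        finally show "norm (x - y) \<le> B * diameter U" .
      qed
      then have "diameter (g ` (U \<inter> X k)) powr s \<le> (B * diameter U) powr s"
        using s bW by (intro powr_mono2 diameter_ge_0) auto
      then show "diameter (g ` (U \<inter> X k)) powr s \<le> B powr s * diameter U powr s"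
        using B diameter_ge_0[OF U] by (simp add: powr_mult)
    qed
    also have "\<dots> = B powr s * S k" by (simp add: S_def sum_distrib_left)
    also have "\<dots> \<le> card I * S k" using B by (intro mult_right_mono) (auto simp: S_def sum_nonneg)
    also note k(2)
    finally show ?thesis .
  qed
qed

text \<open>Covers must be open before compactness can be used. Widening \<open>U\<close> by
  \<open>\<eta>\<close> raises the diameter by at most \<open>2 * \<eta>\<close>, and
  \<open>powr s\<close> is right-continuous even at diameter 0 because \<open>s > 0\<close>.\<close>

lemma open_enlargement:
  fixes U :: "'a::real_normed_vector set"
  assumes "bounded U" "s > 0" "e > 0"
  obtains V where "open V" "bounded V" "U \<subseteq> V" "diameter V powr s \<le> diameter U powr s + e"
proof (cases "U = {}")
  case True
  then show ?thesis using assms by (intro that[of "{}"]) auto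
next
  case False
  have "((\<lambda>x. (diameter U + 2 * x) powr s) \<longlongrightarrow> (diameter U + 2 * 0) powr s) (at_right 0)"
  proof (rule tendsto_powr'[OF _ tendsto_const])
    show "((\<lambda>x. diameter U + 2 * x) \<longlongrightarrow> diameter U + 2 * 0) (at_right 0)" by (intro tendsto_intros)
    have "eventually (\<lambda>x::real. 0 \<le> diameter U + 2 * x) (at_right 0)"
      using eventually_at_right_less[of "0::real"]
      by eventually_elim (use diameter_ge_0[OF assms(1)] in auto)
    then show "diameter U + 2 * 0 \<noteq> 0 \<or> 0 < s \<and> (\<forall>\<^sub>F x in at_right 0. 0 \<le> diameter U + 2 * x)"
      using assms by blast
  qed
  then have "eventually (\<lambda>x. (diameter U + 2 * x) powr s < diameter U powr s + e) (at_right 0)"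
    using assms(3) by (intro order_tendstoD) auto
  then obtain b where b: "b > 0" "\<And>x. 0 < x \<Longrightarrow> x < b \<Longrightarrow> (diameter U + 2 * x) powr s < diameter U powr s + e"
    unfolding eventually_at_right_field by blast
  define \<eta> where "\<eta> = b / 2"
  have \<eta>: "\<eta> > 0" "(diameter U + 2 * \<eta>) powr s < diameter U powr s + e"
    using b(1) b(2)[of "b/2"] by (auto simp: \<eta>_def)
  define V where "V = (\<Union>x\<in>U. ball x \<eta>)"
  have dV: "norm (x - y) \<le> diameter U + 2 * \<eta>" if xy: "x \<in> V" "y \<in> V" for x y
  proof -
    obtain x' y' where "x' \<in> U" "y' \<in> U" "dist x' x < \<eta>" "dist y' y < \<eta>"
      using xy by (auto simp: V_def)
    moreover have "dist x' y' \<le> diameter U"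
      using calculation assms by (intro diameter_bounded_bound) auto
    moreover have "dist x y \<le> dist x' x + dist x' y' + dist y' y"
      using dist_triangle[of x y x'] dist_triangle[of x' y y'] by (simp add: dist_commute)
    ultimately show ?thesis by (simp add: dist_norm)
  qed
  have bV: "bounded V"
  proof -
    obtain x0 where "x0 \<in> U" using False by blast
    then have "x0 \<in> V" using \<eta> unfolding V_def by (intro UN_I[of x0]) auto
    then show ?thesis unfolding bounded_def using dV by (metis dist_norm)
  qed
  have "diameter V \<le> diameter U + 2 * \<eta>"
    using dV \<eta> diameter_ge_0[OF assms(1)] by (intro diameter_le) auto
  then have "diameter V powr s \<le> (diameter U + 2 * \<eta>) powr s"
    using assms diameter_ge_0[OF bV] by (intro powr_mono2) auto
  then show ?thesis using \<eta> bV by (intro that[of V]) (auto simp: V_def)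
qed

text \<open>A countable cover, opened up at a total cost of \<open>e\<close>, has a finite subcover
  by compactness, so a bound for finite covers carries over.\<close>

lemma hausdorff_premeasure_ge:
  fixes X :: "'a::real_normed_vector set"
  assumes X: "compact X" and s: "s > 0"
    and fin: "\<And>\<U>. finite \<U> \<Longrightarrow> (\<forall>U\<in>\<U>. bounded U) \<Longrightarrow> X \<subseteq> \<Union>\<U> \<Longrightarrow> r \<le> (\<Sum>U\<in>\<U>. diameter U powr s)"
  shows "ennreal r \<le> hausdorff_premeasure s \<delta> X"
  unfolding hausdorff_premeasure_def
proof (rule INF_greatest)
  fix U :: "nat \<Rightarrow> 'a set"
  assume "U \<in> {U. X \<subseteq> (\<Union>i. U i) \<and> (\<forall>i. bounded (U i) \<and> diameter (U i) \<le> \<delta>)}"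
  then have U: "X \<subseteq> (\<Union>i. U i)" "\<And>i. bounded (U i)" by auto
  show "ennreal r \<le> (\<Sum>i. diam_pow s (U i))"
  proof (rule ennreal_le_epsilon)
    fix e :: real assume e: "e > 0"
    define Q where "Q i V \<longleftrightarrow> open V \<and> bounded V \<and> U i \<subseteq> V \<and>
      diameter V powr s \<le> diameter (U i) powr s + e * (1/2) ^ Suc i" for i V
    have "\<forall>i. \<exists>V. Q i V"
    proof
      fix i
      have "0 < e * (1/2) ^ Suc i" using e by simp
      then obtain V where "open V" "bounded V" "U i \<subseteq> V"
        "diameter V powr s \<le> diameter (U i) powr s + e * (1/2) ^ Suc i"
        by (rule open_enlargement[OF U(2)[of i] s])
      then show "\<exists>V. Q i V" unfolding Q_def by (intro exI conjI)
    qed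
    then obtain V where "\<forall>i. Q i (V i)" by (rule choice[THEN exE])
    then have V: "\<And>i. open (V i)" "\<And>i. bounded (V i)" "\<And>i. U i \<subseteq> V i"
      "\<And>i. diameter (V i) powr s \<le> diameter (U i) powr s + e * (1/2) ^ Suc i"
      by (simp_all add: Q_def)
    have "X \<subseteq> (\<Union>i\<in>UNIV. V i)" using U V(3) by blast
    then obtain F where F: "finite F" "X \<subseteq> (\<Union>i\<in>F. V i)"
      using compactE_image[OF X, of UNIV V] V(1) by metis
    have "r \<le> (\<Sum>W\<in>V ` F. diameter W powr s)" using F V(2) by (intro fin) auto
    also have "\<dots> \<le> (\<Sum>i\<in>F. diameter (V i) powr s)" using sum_image_le[OF F(1), where g = "\<lambda>W. diameter W powr s" and f = V]
      by (simp add: o_def)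
    also have "\<dots> \<le> (\<Sum>i\<in>F. diameter (U i) powr s + e * (1/2) ^ Suc i)" by (intro sum_mono V)
    finally have "ennreal r \<le> ennreal (\<Sum>i\<in>F. diameter (U i) powr s + e * (1/2) ^ Suc i)"
      by (rule ennreal_leI)
    also have "\<dots> = (\<Sum>i\<in>F. ennreal (diameter (U i) powr s + e * (1/2) ^ Suc i))"
      using e by (subst sum_ennreal) auto
    also have "\<dots> \<le> (\<Sum>i. ennreal (diameter (U i) powr s + e * (1/2) ^ Suc i))"
      using F by (intro sum_le_suminf) auto
    also have "\<dots> = (\<Sum>i. diam_pow s (U i) + ennreal (e * (1/2) ^ Suc i))"
      using e s by (intro suminf_cong) (simp add: diam_pow_pos)
    also have "\<dots> = (\<Sum>i. diam_pow s (U i)) + (\<Sum>i. ennreal (e * (1/2) ^ Suc i))"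
      by (intro suminf_add[symmetric]) auto
    also have "(\<Sum>i. ennreal (e * (1/2) ^ Suc i)) = ennreal e"
      using sums_mult[OF power_half_series, of e] e
      by (subst suminf_ennreal2) (auto simp: sums_iff)
    finally show "ennreal r \<le> (\<Sum>i. diam_pow s (U i)) + ennreal e" .
  qed
qed

text \<open>The invariant set consists of the points whose whole orbit stays in the pieces. As each
  \<open>Y k\<close> covers \<open>K\<close> under \<open>g\<close>, its part of the invariant set
  is mapped onto all of it, which is the situation of \<open>finite_cover_sum_ge\<close>.\<close>

lemma expanding_full_shift_dim:
  fixes K :: "'a::euclidean_space set"
  assumes g: "continuous_on UNIV g" and I: "finite I" "card I \<ge> 2" and t: "t > 0"
    and cK: "\<And>k. k \<in> I \<Longrightarrow> compact (Y k)" and YK: "\<And>k. k \<in> I \<Longrightarrow> Y k \<subseteq> K" and K: "K \<noteq> {}"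
    and disj: "\<And>j k. j \<in> I \<Longrightarrow> k \<in> I \<Longrightarrow> j \<noteq> k \<Longrightarrow> Y j \<inter> Y k = {}"
    and onto: "\<And>k. k \<in> I \<Longrightarrow> K \<subseteq> g ` Y k"
    and B: "B \<ge> 1" "B powr t \<le> card I"
    and lip: "\<And>k x y. k \<in> I \<Longrightarrow> x \<in> Y k \<Longrightarrow> y \<in> Y k \<Longrightarrow> norm (g x - g y) \<le> B * norm (x - y)"
  shows "\<exists>X. compact X \<and> X \<subseteq> (\<Union>k\<in>I. Y k) \<and> g ` X \<subseteq> X \<and> ennreal t \<le> hausdorff_dim X"
proof -
  define Z where "Z = (\<Union>k\<in>I. Y k)"
  have Z: "compact Z" using I cK by (auto simp: Z_def)
  have ZK: "Z \<subseteq> K" using YK by (auto simp: Z_def)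
  have cg: "continuous_on UNIV (g ^^ n)" for n
  proof (induction n)
    case (Suc n)
    then show ?case unfolding funpow.simps o_def by (intro continuous_on_compose2[OF g Suc]) auto
  qed (simp add: id_def)
  \<comment> \<open>The points whose iterates up to the \<open>n\<close>-th stay in
    \<open>Z\<close>: decreasing compact sets. Nonemptiness passes from \<open>n\<close> to
    \<open>Suc n\<close> by pulling a point back into one of the pieces.\<close>
  define A where "A n = (\<Inter>j\<in>{..n}. Z \<inter> (g ^^ j) -` Z)" for n
  have clA: "closed ((g ^^ j) -` Z)" for j
    using cg Z by (intro closed_vimage compact_imp_closed) auto
  have cA: "compact (A n)" for n
    unfolding A_def
    by (intro compact_Inter) (auto intro!: compact_Int_closed Z clA)
  have neA: "A n \<noteq> {}" for n
  proof (induction n)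
    case 0
    obtain k where "k \<in> I" using I by fastforce
    then show ?case using K onto by (auto simp: A_def Z_def)
  next
    case (Suc n)
    then obtain x where x: "x \<in> A n" by blast
    obtain k where k: "k \<in> I" using I by fastforce
    have "x \<in> K" using x ZK by (auto simp: A_def)
    then obtain y where y: "y \<in> Y k" "x = g y" using onto k by blast
    then have yZ: "y \<in> Z" using k by (auto simp: Z_def)
    have "(g ^^ j) y \<in> Z" if "j \<le> Suc n" for j
    proof (cases j)
      case (Suc i)
      then have "(g ^^ j) y = (g ^^ i) x" using y by (simp add: funpow_swap1)
      then show ?thesis using x Suc that by (auto simp: A_def)
    qed (use yZ in auto)
    then show ?case using yZ by (auto simp: A_def)
  qed
  define X where "X = (\<Inter>n. A n)"
  have Xeq: "x \<in> X \<longleftrightarrow> (\<forall>n. (g ^^ n) x \<in> Z)" for x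
  proof
    assume "\<forall>n. (g ^^ n) x \<in> Z"
    moreover from this have "x \<in> Z" by (metis funpow_0)
    ultimately show "x \<in> X" by (auto simp: X_def A_def)
  qed (auto simp: X_def A_def)
  have neX: "X \<noteq> {}" unfolding X_def
  proof (rule compact_nest[OF cA neA])
    show "A n \<subseteq> A m" if "m \<le> n" for m n using that by (auto simp: A_def)
  qed
  have cX: "compact X" unfolding X_def using cA by (intro compact_Inter) auto
  have XZ: "X \<subseteq> Z"
  proof
    fix x assume "x \<in> X"
    then have "(g ^^ 0) x \<in> Z" using Xeq by blast
    then show "x \<in> Z" by simp
  qed
  have gX: "g x \<in> X" if "x \<in> X" for x
    unfolding Xeq
  proof
    fix n show "(g ^^ n) (g x) \<in> Z" using that Xeq[of x] by (metis funpow_Suc_right comp_apply)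
  qed
  define X' where "X' k = X \<inter> Y k" for k
  have XX: "(\<Union>k\<in>I. X' k) = X" using XZ by (auto simp: X'_def Z_def)
  have onX: "g ` X' k = X" if k: "k \<in> I" for k
  proof
    show "g ` X' k \<subseteq> X" using gX by (auto simp: X'_def)
    show "X \<subseteq> g ` X' k"
    proof
      fix x assume x: "x \<in> X"
      then obtain y where y: "y \<in> Y k" "x = g y" using XZ ZK onto k by blast
      have "(g ^^ n) y \<in> Z" for n
      proof (cases n)
        case (Suc i)
        then show ?thesis using x Xeq[of x] y by (simp add: funpow_swap1)
      qed (use y k in \<open>auto simp: Z_def\<close>)
      then show "x \<in> g ` X' k" using y Xeq by (auto simp: X'_def)
    qed
  qed
  have "\<exists>d>0. \<forall>j\<in>I. \<forall>k\<in>I. j \<noteq> k \<longrightarrow> (\<forall>x\<in>Y j. \<forall>y\<in>Y k. d \<le> dist x y)"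
  proof -
    have "\<exists>d>0. j \<noteq> k \<longrightarrow> (\<forall>x\<in>Y j. \<forall>y\<in>Y k. d \<le> dist x y)" if "j \<in> I" "k \<in> I" for j k
      using separate_compact_closed[OF cK[OF that(1)] compact_imp_closed[OF cK[OF that(2)]]] disj[OF that]
      by (metis zero_less_one)
    then obtain D where D: "\<And>j k. j \<in> I \<Longrightarrow> k \<in> I \<Longrightarrow> D j k > 0 \<and> (j \<noteq> k \<longrightarrow> (\<forall>x\<in>Y j. \<forall>y\<in>Y k. D j k \<le> dist x y))"
      by metis
    define d where "d = Min ((\<lambda>(j,k). D j k) ` (I \<times> I))"
    have ne: "I \<noteq> {}" using I by auto
    have "d > 0" unfolding d_def using I D ne by (subst Min_gr_iff) auto
    moreover have "d \<le> D j k" if "j \<in> I" "k \<in> I" for j k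
      unfolding d_def using I that by (intro Min_le) force+
    ultimately show ?thesis using D by (meson order_trans)
  qed
  then obtain d where d: "d > 0" "\<And>j k x y. j \<in> I \<Longrightarrow> k \<in> I \<Longrightarrow> j \<noteq> k \<Longrightarrow> x \<in> Y j \<Longrightarrow> y \<in> Y k \<Longrightarrow> d \<le> dist x y"
    by blast
  have "ennreal t \<le> hausdorff_dim X"
    unfolding hausdorff_dim_def
  proof (rule INF_greatest, rule ccontr)
    fix s assume s: "s \<in> {s. 0 \<le> s \<and> hausdorff_measure s X = 0}" and "\<not> ennreal t \<le> ennreal s"
    then have st: "s < t" by (meson ennreal_leI not_le)
    have "\<exists>r>0. ennreal r \<le> hausdorff_premeasure s 1 X"
    proof (cases "s = 0")
      case True
      have "ennreal 1 \<le> hausdorff_premeasure s 1 X"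
        unfolding hausdorff_premeasure_def
      proof (rule INF_greatest)
        fix U :: "nat \<Rightarrow> 'a set"
        assume U: "U \<in> {U. X \<subseteq> (\<Union>i. U i) \<and> (\<forall>i. bounded (U i) \<and> diameter (U i) \<le> 1)}"
        then obtain i where "U i \<noteq> {}" using neX by blast
        then have "ennreal 1 = (\<Sum>i\<in>{i}. diam_pow s (U i))" using True by (simp add: diam_pow_def)
        also have "\<dots> \<le> (\<Sum>i. diam_pow s (U i))" by (intro sum_le_suminf) auto
        finally show "ennreal 1 \<le> (\<Sum>i. diam_pow s (U i))" .
      qed
      then show ?thesis using zero_less_one by blast
    next
      case False
      then have s0: "s > 0" using s by simp
      have Bs: "B powr s \<le> card I" using B st powr_mono[of s t B] by simp
      have "ennreal (d powr s) \<le> hausdorff_premeasure s 1 X"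
      proof (rule hausdorff_premeasure_ge[OF cX s0])
        fix \<U> :: "'a set set" assume "finite \<U>" "\<forall>U\<in>\<U>. bounded U" "X \<subseteq> \<Union>\<U>"
        then show "d powr s \<le> (\<Sum>U\<in>\<U>. diameter U powr s)"
        proof (intro finite_cover_sum_ge[OF I s0 d(1), where X = X' and g = g and B = B])
          show "X' k \<noteq> {}" if "k \<in> I" for k using onX[OF that] neX by auto
          show "bounded (\<Union>j\<in>I. X' j)" using cX XX compact_imp_bounded by metis
          show "g ` X' k = (\<Union>j\<in>I. X' j)" if "k \<in> I" for k using onX[OF that] XX by simp
          show "(\<Union>j\<in>I. X' j) \<subseteq> \<Union> \<U>" using XX \<open>X \<subseteq> \<Union>\<U>\<close> by metis
        qed (use d lip B Bs in \<open>auto simp: X'_def\<close>)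
      qed
      then show ?thesis using d by (intro exI[of _ "d powr s"]) simp
    qed
    then obtain r where r: "r > 0" "ennreal r \<le> hausdorff_premeasure s 1 X" by blast
    have "hausdorff_premeasure s 1 X \<le> hausdorff_measure s X"
      unfolding hausdorff_measure_def by (intro SUP_upper) auto
    then have "ennreal r \<le> hausdorff_measure s X" using r(2) by (rule order_trans[rotated])
    then have "ennreal r = 0" using s by simp
    then show False using r(1) by (simp add: ennreal_eq_0_iff)
  qed
  then show ?thesis using cX XZ gX by (auto simp: Z_def)
qed

section \<open>The functions \<open>\<Phi>\<close> and \<open>\<Psi>\<close>\<close>

locale stallard =
  fixes p :: real
  assumes p_pos: "0 < p"
begin

abbreviation h :: "real \<Rightarrow> real" where "h \<equiv> stallard_height p"
abbreviation f :: "complex \<Rightarrow> complex" where "f \<equiv> stallard_f p"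

definition logpow :: "complex \<Rightarrow> complex" where "logpow z = Ln z powr of_real (1 + p)"
definition \<Phi> :: "complex \<Rightarrow> complex" where "\<Phi> z = exp (logpow z)"
definition q :: real where "q = 1 / (1 + p)"
definition \<Psi> :: "complex \<Rightarrow> complex" where "\<Psi> v = exp (Ln v powr of_real q)"
definition dh :: "real \<Rightarrow> real" where
  "dh x = pi / (1 + p) * (ln x powr (-p) - p * ln x powr (-p - 1))"

lemma q: "0 < q" "q < 1" "q * (1 + p) = 1" "(1 + p) * q = 1"
  using p_pos by (auto simp: q_def)

lemma f_eq: "f z = exp (\<Phi> z)"
  by (simp add: stallard_f_def \<Phi>_def logpow_def)

lemma Re_Ln_gt_0: "norm z > 1 \<Longrightarrow> Re (Ln z) > 0"
  by (cases "z = 0") auto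

lemma nonpos_Reals_Re_pos: "Re z > 0 \<Longrightarrow> z \<notin> \<real>\<^sub>\<le>\<^sub>0"
  by (auto simp: complex_nonpos_Reals_iff)

text \<open>Two logarithms are nested. \<open>Re z > 1\<close> keeps \<open>z\<close> off the cut of
  the inner one and, through \<open>norm z > 1\<close>, puts \<open>Ln z\<close> into the right half
  plane, off the cut of the outer power.\<close>

lemma has_field_derivative_logpow:
  assumes "Re z > 1"
  shows "(logpow has_field_derivative of_real (1 + p) * Ln z powr of_real p / z) (at z)"
proof -
  have z: "z \<notin> \<real>\<^sub>\<le>\<^sub>0" using assms by (intro nonpos_Reals_Re_pos) auto
  have "norm z > 1" using assms complex_Re_le_cmod[of z] by linarith
  then have L: "Ln z \<notin> \<real>\<^sub>\<le>\<^sub>0" by (intro nonpos_Reals_Re_pos Re_Ln_gt_0)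
  have "((\<lambda>z. Ln z powr of_real (1 + p)) has_field_derivative
      (of_real (1 + p) * Ln z powr (of_real (1 + p) - 1)) * inverse z) (at z)"
    by (rule DERIV_chain2[OF has_field_derivative_powr[OF L] has_field_derivative_Ln[OF z]])
  then show ?thesis unfolding logpow_def by (simp add: field_simps)
qed

lemma has_field_derivative_\<Phi>:
  assumes "Re z > 1"
  shows "(\<Phi> has_field_derivative \<Phi> z * (of_real (1 + p) * Ln z powr of_real p / z)) (at z)"
  unfolding \<Phi>_def by (rule DERIV_fun_exp[OF has_field_derivative_logpow[OF assms]])

lemma has_field_derivative_f:
  assumes "Re z > 1"
  shows "(f has_field_derivative f z * (\<Phi> z * (of_real (1 + p) * Ln z powr of_real p / z))) (at z)"
proof -
  have "((\<lambda>z. exp (\<Phi> z)) has_field_derivative exp (\<Phi> z) * (\<Phi> z * (of_real (1 + p) * Ln z powr of_real p / z))) (at z)"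
    by (rule DERIV_fun_exp[OF has_field_derivative_\<Phi>[OF assms]])
  then show ?thesis by (simp add: f_eq[abs_def])
qed

lemma f_holomorphic: "f holomorphic_on {z. Re z > 1}"
  using has_field_derivative_f by (auto simp: holomorphic_on_def field_differentiable_def intro: has_field_derivative_at_within)

lemma ln_ge_1: "x \<ge> 3 \<Longrightarrow> ln x \<ge> (1::real)"
  using exp_le by (subst ln_ge_iff) auto

lemma has_real_derivative_h:
  assumes "x > 1"
  shows "(h has_real_derivative dh x) (at x)"
proof -
  have l: "ln x > 0" using assms by simp
  have "((\<lambda>x. pi / (1 + p) * (x * ln x powr (-p))) has_real_derivative
      pi / (1 + p) * (1 * ln x powr (-p) + x * (-p * ln x powr (-p - 1) * inverse x))) (at x)"
    using assms l p_pos
    by (auto intro!: derivative_eq_intros simp: powr_diff divide_simps powr_minus) (simp add: algebra_simps)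
  then have "((\<lambda>x. pi / (1 + p) * (x * ln x powr (-p))) has_real_derivative dh x) (at x)"
    using assms by (simp add: dh_def field_simps)
  moreover have "h = (\<lambda>x. pi / (1 + p) * (x * ln x powr (-p)))"
    by (auto simp: stallard_height_def fun_eq_iff powr_minus divide_simps)
  ultimately show ?thesis by simp
qed

text \<open>For \<open>x \<ge> 3\<close> both powers of \<open>ln x\<close> are at most 1, so the
  bracket in \<open>dh\<close> is at most \<open>1 + p\<close> in absolute value, which cancels the
  denominator of the prefactor.\<close>

lemma abs_dh_le: "x \<ge> 3 \<Longrightarrow> \<bar>dh x\<bar> \<le> pi"
proof -
  assume x: "x \<ge> 3"
  have "ln x powr (-p) \<le> ln x powr 0" "ln x powr (-p - 1) \<le> ln x powr 0"
    using ln_ge_1[OF x] p_pos by (intro powr_mono; simp)+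
  then have b: "ln x powr (-p) \<le> 1" "ln x powr (-p-1) \<le> 1"
    using ln_ge_1[OF x] by auto
  have "\<bar>ln x powr (-p) - p * ln x powr (-p - 1)\<bar> \<le> 1 + p * 1"
    using b p_pos mult_left_mono[OF b(2), of p] powr_ge_zero[of "ln x" "-p"]
      mult_nonneg_nonneg[of p "ln x powr (-p-1)"] by (smt (verit) powr_ge_zero)
  then have "pi / (1 + p) * \<bar>ln x powr (-p) - p * ln x powr (-p - 1)\<bar> \<le> pi / (1 + p) * (1 + p)"
    using p_pos by (intro mult_left_mono) auto
  then show ?thesis using p_pos by (simp add: dh_def abs_mult)
qed

lemma h_lipschitz:
  assumes "x \<ge> 3" "y \<ge> 3"
  shows "\<bar>h x - h y\<bar> \<le> pi * \<bar>x - y\<bar>"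
proof -
  have "norm (h x - h y) \<le> pi * norm (x - y)"
    by (rule field_differentiable_bound[where S = "{3..}" and f' = dh])
       (use assms abs_dh_le in \<open>auto intro!: has_field_derivative_at_within[OF has_real_derivative_h]\<close>)
  then show ?thesis by simp
qed

lemma h_at_top: "filterlim h at_top at_top"
proof -
  have "filterlim (\<lambda>x. pi / (1 + p) * (x / ln x powr p)) at_top at_top"
    using p_pos by real_asymp
  then show ?thesis by (simp add: stallard_height_def[abs_def])
qed

text \<open>\<open>dh t\<close> has the sign of \<open>ln t - p\<close>, whence the threshold
  \<open>exp p\<close>.\<close>

lemma h_mono:
  assumes "exp p \<le> x" "3 \<le> x" "x \<le> y"
  shows "h x \<le> h y"
proof (rule DERIV_nonneg_imp_nondecreasing[OF assms(3)])
  fix t assume t: "x \<le> t" "t \<le> y"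
  have "exp p \<le> t" using assms t by linarith
  then have l: "p \<le> ln t" using assms t by (subst ln_ge_iff) auto
  have "p * ln t powr (-p - 1) \<le> ln t * ln t powr (-p - 1)"
    using l by (intro mult_right_mono) auto
  also have "\<dots> = ln t powr (-p)"
    using l p_pos by (simp add: powr_diff)
  finally have "dh t \<ge> 0" using p_pos by (simp add: dh_def)
  then show "\<exists>y. (h has_real_derivative y) (at t) \<and> 0 \<le> y"
    using has_real_derivative_h[of t] assms t by auto
qed

text \<open>Two tolerances for \<open>logpow_asymp\<close>: 1/20 becomes 1/5 after multiplication by
  \<open>pi < 4\<close>, and the bound on \<open>Ln (1 + \<zeta>)\<close> stays below
  \<open>pi\<close> after multiplication by \<open>1 + p\<close>.\<close>

lemma powr_ratio_near_1:
  "\<exists>d>0. \<forall>\<eta> \<zeta>. norm \<eta> < d \<longrightarrow> norm \<zeta> < d \<longrightarrow>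
     1 + \<eta> \<noteq> 0 \<and> 1 + \<zeta> \<noteq> 0 \<and> 1 + \<zeta> \<notin> \<real>\<^sub>\<le>\<^sub>0 \<and> 1 + \<eta> \<notin> \<real>\<^sub>\<le>\<^sub>0 \<and>
     norm ((1 + \<zeta>) powr of_real p / (1 + \<eta>) - 1 :: complex) < 1/20 \<and> norm (Ln (1 + \<zeta>)) < pi / (1 + p)"
proof -
  have "((\<lambda>z::complex \<times> complex. (1 + snd z) powr of_real p / (1 + fst z)) \<longlongrightarrow> (1 + 0) powr of_real p / (1 + 0)) (at (0,0))"
    by (intro tendsto_divide tendsto_powr_complex tendsto_add tendsto_const)
       (auto intro!: tendsto_eq_intros)
  from this[unfolded LIM_def, rule_format, of "1/20"]
  obtain d1 where d1: "d1 > 0" "\<And>z::complex \<times> complex. z \<noteq> (0,0) \<Longrightarrow> dist z (0,0) < d1 \<Longrightarrow>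
      dist ((1 + snd z) powr of_real p / (1 + fst z)) 1 < 1/20"
    by (simp del: split_paired_All) blast
  have "isCont (\<lambda>z::complex. Ln (1 + z)) 0" by (intro continuous_intros) auto
  then have "((\<lambda>z::complex. Ln (1 + z)) \<longlongrightarrow> 0) (at 0)" by (simp add: isCont_def)
  moreover have "pi / (1 + p) > 0" using p_pos by simp
  ultimately obtain d2 where d2: "d2 > 0" "\<And>z::complex. z \<noteq> 0 \<Longrightarrow> dist z 0 < d2 \<Longrightarrow> dist (Ln (1 + z)) 0 < pi / (1 + p)"
    unfolding LIM_def by blast
  define d where "d = min (1/2) (min (d1/2) d2)"
  have d: "d > 0" "d \<le> 1/2" "d \<le> d1/2" "d \<le> d2" using d1 d2 by (auto simp: d_def)
  have "1 + \<eta> \<noteq> 0 \<and> 1 + \<zeta> \<noteq> 0 \<and> 1 + \<zeta> \<notin> \<real>\<^sub>\<le>\<^sub>0 \<and> 1 + \<eta> \<notin> \<real>\<^sub>\<le>\<^sub>0 \<and>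
     norm ((1 + \<zeta>) powr of_real p / (1 + \<eta>) - 1 :: complex) < 1/20 \<and> norm (Ln (1 + \<zeta>)) < pi / (1 + p)"
    if *: "norm \<eta> < d" "norm \<zeta> < d" for \<eta> \<zeta> :: complex
  proof -
    have "Re (1 + \<eta>) > 0" "Re (1 + \<zeta>) > 0"
      using * d(2) abs_Re_le_cmod[of \<eta>] abs_Re_le_cmod[of \<zeta>] by auto
    moreover from this have "1 + \<eta> \<noteq> 0" "1 + \<zeta> \<noteq> 0" by (metis zero_complex.simps(1) less_irrefl)+
    moreover have "norm ((1 + \<zeta>) powr of_real p / (1 + \<eta>) - 1) < 1/20"
    proof (cases "(\<eta>,\<zeta>) = (0,0)")
      case False
      have "norm (\<eta>,\<zeta>) \<le> norm \<eta> + norm \<zeta>" by (rule norm_Pair_le)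
      also have "\<dots> < d1" using * d by linarith
      finally show ?thesis using d1(2)[of "(\<eta>,\<zeta>)"] False by (simp add: dist_norm zero_prod_def[symmetric])
    qed simp
    moreover have "norm (Ln (1 + \<zeta>)) < pi / (1 + p)"
      using d2(2)[of \<zeta>] * d p_pos by (cases "\<zeta> = 0") (auto simp: dist_norm)
    ultimately show ?thesis using nonpos_Reals_Re_pos by blast
  qed
  then show ?thesis using d(1) by blast
qed

text \<open>With \<open>z = x + i\<theta>h(x)\<close>, the derivative of \<open>logpow z\<close> in \<open>\<theta>\<close> is \<open>i\<pi>\<close> times a factor close to 1.\<close>

lemma logpow_asymp:
  "\<exists>X\<ge>3. \<forall>x\<ge>X. \<forall>\<theta>. \<bar>\<theta>\<bar> \<le> 1 \<longrightarrow>
     norm (logpow (Complex x (\<theta> * h x)) - of_real (ln x powr (1 + p)) - \<i> * of_real (pi * \<theta>)) \<le> 1/5 \<and>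
     (1 + p) * \<bar>Im (Ln (Ln (Complex x (\<theta> * h x))))\<bar> < pi"
proof -
  obtain d where d: "d > 0" and d': "\<And>\<eta> \<zeta>::complex. norm \<eta> < d \<Longrightarrow> norm \<zeta> < d \<Longrightarrow>
     1 + \<eta> \<noteq> 0 \<and> 1 + \<zeta> \<noteq> 0 \<and> 1 + \<zeta> \<notin> \<real>\<^sub>\<le>\<^sub>0 \<and> 1 + \<eta> \<notin> \<real>\<^sub>\<le>\<^sub>0 \<and>
     norm ((1 + \<zeta>) powr of_real p / (1 + \<eta>) - 1 :: complex) < 1/20 \<and> norm (Ln (1 + \<zeta>)) < pi / (1 + p)"
    using powr_ratio_near_1 by blast
  have "isCont (\<lambda>z::complex. Ln (1 + z)) 0" by (intro continuous_intros) auto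
  then have "((\<lambda>z::complex. Ln (1 + z)) \<longlongrightarrow> 0) (at 0)" by (simp add: isCont_def)
  then obtain e where e: "e > 0" "\<And>z::complex. z \<noteq> 0 \<Longrightarrow> dist z 0 < e \<Longrightarrow> dist (Ln (1 + z)) 0 < d"
    unfolding LIM_def using d by blast
  \<comment> \<open>This is \<open>h x / x\<close>, so that the point
    \<open>Complex x (\<theta> * h x)\<close> is \<open>x\<close> times a small perturbation of
    1.\<close>
  define \<delta> where "\<delta> x = pi / ((1 + p) * ln x powr p)" for x :: real
  have "(\<delta> \<longlongrightarrow> 0) at_top" unfolding \<delta>_def using p_pos by real_asymp
  then have "eventually (\<lambda>x. \<delta> x < min d e) at_top" using d e by (intro order_tendstoD) auto
  then obtain X0 where X0: "\<And>x. x \<ge> X0 \<Longrightarrow> \<delta> x < min d e"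
    by (auto simp: eventually_at_top_linorder)
  show ?thesis
  proof (intro exI[of _ "max 3 X0"] conjI allI impI)
    fix x \<theta> :: real assume x: "x \<ge> max 3 X0" and \<theta>: "\<bar>\<theta>\<bar> \<le> 1"
    have l: "ln x \<ge> 1" using ln_ge_1 x by auto
    have \<delta>0: "\<delta> x > 0" using l p_pos by (simp add: \<delta>_def)
    have hx: "h x = x * \<delta> x" by (simp add: stallard_height_def \<delta>_def)
    define w where "w s = of_real x * (1 + \<i> * s * of_real (\<delta> x))" for s
    define \<eta> where "\<eta> s = \<i> * s * of_real (\<delta> x)" for s
    define \<zeta> where "\<zeta> s = Ln (1 + \<eta> s) / of_real (ln x)" for s
    \<comment> \<open>The real parameter \<open>\<theta>\<close> is embedded in a complex segment,
      so that the mean value bound for complex derivatives applies.\<close>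
    define S where "S = closed_segment 0 (of_real \<theta> :: complex)"
    have S1: "norm s \<le> 1" "Im s = 0" if "s \<in> S" for s
      using that \<theta> by (auto simp: S_def closed_segment_def norm_mult mult_le_one)
    have props: "norm (\<eta> s) < d" "norm (\<zeta> s) < d" if "s \<in> S" for s
    proof -
      have n: "norm (\<eta> s) \<le> \<delta> x" using S1(1)[OF that] \<delta>0 by (simp add: \<eta>_def norm_mult mult_left_le_one_le)
      then show "norm (\<eta> s) < d" using X0[of x] x by simp
      have "norm (Ln (1 + \<eta> s)) < d"
        using e(2)[of "\<eta> s"] n X0[of x] x d by (cases "\<eta> s = 0") auto
      moreover have "norm (\<zeta> s) \<le> norm (Ln (1 + \<eta> s))"
        using l divide_left_mono[of 1 "ln x" "norm (Ln (1 + \<eta> s))"] by (simp add: \<zeta>_def norm_divide)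
      ultimately show "norm (\<zeta> s) < d" by simp
    qed
    note pr = d'[OF props]
    have Lw: "Ln (w s) = of_real (ln x) * (1 + \<zeta> s)" if "s \<in> S" for s
    proof -
      have "Ln (w s) = of_real (ln x) + Ln (1 + \<eta> s)"
        unfolding w_def \<eta>_def[symmetric] using x pr[OF that that] by (subst Ln_times_of_real) (auto simp: Ln_of_real)
      then show ?thesis using l by (simp add: \<zeta>_def field_simps)
    qed
    have LLw: "Ln (Ln (w s)) = of_real (ln (ln x)) + Ln (1 + \<zeta> s)" if "s \<in> S" for s
      unfolding Lw[OF that] using l pr[OF that that] by (subst Ln_times_of_real) (auto simp: Ln_of_real)
    have Rw: "Re (w s) > 1" if "s \<in> S" for s
      using S1(2)[OF that] x by (simp add: w_def)
    have wC: "w (of_real \<theta>) = Complex x (\<theta> * h x)"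
      by (simp add: w_def hx complex_eq_iff)
    have \<theta>S: "of_real \<theta> \<in> S" "0 \<in> S" by (auto simp: S_def)
    have der: "((\<lambda>s. logpow (w s) - \<i> * of_real pi * s) has_field_derivative
        \<i> * of_real pi * ((1 + \<zeta> s) powr of_real p / (1 + \<eta> s) - 1)) (at s within S)" if s: "s \<in> S" for s
    proof -
      have "((\<lambda>s. logpow (w s)) has_field_derivative
          (of_real (1 + p) * Ln (w s) powr of_real p / w s) * (of_real x * (\<i> * of_real (\<delta> x)))) (at s)"
        by (rule DERIV_chain2[where g = w, OF has_field_derivative_logpow[OF Rw[OF s]]])
           (auto simp: w_def[abs_def] intro!: derivative_eq_intros)
      then have D: "((\<lambda>s. logpow (w s) - \<i> * of_real pi * s) has_field_derivative
          (of_real (1 + p) * Ln (w s) powr of_real p / w s) * (of_real x * (\<i> * of_real (\<delta> x))) - \<i> * of_real pi) (at s)"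
        by (auto intro!: derivative_eq_intros)
      have P: "Ln (w s) powr of_real p = of_real (ln x powr p) * (1 + \<zeta> s) powr of_real p"
      proof -
        have "Ln (w s) powr of_real p = exp (of_real p * Ln (Ln (w s)))"
          using Lw[OF s] l pr[OF s s] by (simp add: powr_def)
        also have "\<dots> = exp (of_real (p * ln (ln x))) * exp (of_real p * Ln (1 + \<zeta> s))"
          unfolding LLw[OF s] by (simp add: exp_add ring_distribs)
        also have "\<dots> = of_real (ln x powr p) * (1 + \<zeta> s) powr of_real p"
          using l pr[OF s s] by (simp add: powr_def flip: exp_of_real)
        finally show ?thesis .
      qed
      \<comment> \<open>The height \<open>h\<close> is made for this identity: it turns the
        derivative in the parameter into exactly \<open>\<i> * pi\<close> times the ratio near
        1.\<close>
      have \<delta>p: "(1 + p) * ln x powr p * \<delta> x = pi" using l p_pos by (simp add: \<delta>_def)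
      have ne: "of_real x \<noteq> (0::complex)" "1 + \<eta> s \<noteq> 0" using x pr[OF s s] by auto
      have ws: "w s = of_real x * (1 + \<eta> s)" by (simp add: w_def \<eta>_def)
      have "(of_real (1 + p) * Ln (w s) powr of_real p / w s) * (of_real x * (\<i> * of_real (\<delta> x)))
          = \<i> * of_real ((1 + p) * ln x powr p * \<delta> x) * ((1 + \<zeta> s) powr of_real p / (1 + \<eta> s))"
      proof -
        have alg: "(a * (A * C) / (Y * Z)) * (Y * (\<i> * D)) = \<i> * (a * A * D) * (C / Z)"
          if "Y \<noteq> 0" "Z \<noteq> 0" for a A C Y Z D :: complex
          using that by (simp add: field_simps)
        show ?thesis unfolding P by (subst ws, subst alg) (use ne in simp_all)
      qed
      also have "\<dots> - \<i> * of_real pi = \<i> * of_real pi * ((1 + \<zeta> s) powr of_real p / (1 + \<eta> s) - 1)"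
        unfolding \<delta>p by (simp add: algebra_simps)
      finally show ?thesis using D by (auto intro: has_field_derivative_at_within)
    qed
    have "norm ((logpow (w (of_real \<theta>)) - \<i> * of_real pi * of_real \<theta>) - (logpow (w 0) - \<i> * of_real pi * 0))
        \<le> (1/5) * norm (of_real \<theta> - 0 :: complex)"
    proof (rule field_differentiable_bound[OF _ der _ \<theta>S])
      show "convex S" by (simp add: S_def)
      fix s assume s: "s \<in> S"
      have "norm (\<i> * of_real pi * ((1 + \<zeta> s) powr of_real p / (1 + \<eta> s) - 1)) \<le> 4 * (1/20)"
        unfolding norm_mult using pr[OF s s] pi_less_4 by (intro mult_mono) auto
      then show "norm (\<i> * of_real pi * ((1 + \<zeta> s) powr of_real p / (1 + \<eta> s) - 1)) \<le> 1/5" by simp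
    qed
    also have "\<dots> \<le> 1/5" using \<theta> by simp
    finally have 1: "norm ((logpow (w (of_real \<theta>)) - \<i> * of_real pi * of_real \<theta>) - (logpow (w 0) - \<i> * of_real pi * 0)) \<le> 1/5" .
    have w0: "logpow (w 0) = of_real (ln x powr (1 + p))"
    proof -
      have "Ln (w 0) = of_real (ln x)" using x by (simp add: w_def Ln_of_real)
      then show ?thesis using l powr_of_real[of "ln x" "1 + p"] by (simp only: logpow_def)
    qed
    show "norm (logpow (Complex x (\<theta> * h x)) - of_real (ln x powr (1 + p)) - \<i> * of_real (pi * \<theta>)) \<le> 1/5"
      using 1 unfolding w0 wC by (simp add: algebra_simps)
    have "\<bar>Im (Ln (Ln (w (of_real \<theta>))))\<bar> \<le> norm (Ln (1 + \<zeta> (of_real \<theta>)))"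
      unfolding LLw[OF \<theta>S(1)] using abs_Im_le_cmod by simp
    also have "\<dots> < pi / (1 + p)" using pr[OF \<theta>S(1) \<theta>S(1)] by blast
    finally show "(1 + p) * \<bar>Im (Ln (Ln (Complex x (\<theta> * h x))))\<bar> < pi"
      unfolding wC using p_pos by (simp add: field_simps)
  qed auto
qed

section \<open>The inverse map on the right half plane\<close>

text \<open>As \<open>q < 1\<close>, the derivative of the power is largest where the modulus is
  smallest. Later, bounded changes of \<open>Ln v\<close> thus become small changes of its power
  \<open>q\<close> when \<open>norm v\<close> is large.\<close>

lemma powr_q_diff_le:
  assumes s: "s \<ge> 1" and z: "Re z \<ge> s" "Re w \<ge> s"
  shows "norm (z powr of_real q - w powr of_real q) \<le> q * s powr (q - 1) * norm (z - w)"
proof (rule field_differentiable_bound[where S = "{z. Re z \<ge> s}"])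
  show "convex {z. Re z \<ge> s}" by (rule convex_halfspace_Re_ge)
  fix u assume "u \<in> {z. Re z \<ge> s}"
  then have u: "Re u \<ge> s" by simp
  then have u0: "u \<notin> \<real>\<^sub>\<le>\<^sub>0" using s nonpos_Reals_Re_pos[of u] by simp
  show "((\<lambda>z. z powr of_real q) has_field_derivative of_real q * u powr (of_real q - 1)) (at u within {z. Re z \<ge> s})"
    by (rule has_field_derivative_at_within[OF has_field_derivative_powr[OF u0]])
  have "norm (u powr (of_real (q - 1))) = norm u powr (q - 1)"
    by (subst norm_powr_real_powr') auto
  also have "\<dots> \<le> s powr (q - 1)"
    using u s q complex_Re_le_cmod[of u] by (intro powr_mono2') auto
  finally show "norm (of_real q * u powr (of_real q - 1)) \<le> q * s powr (q - 1)"
    using q by (simp add: norm_mult)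
qed (use z in auto)

text \<open>Comparison with the real point \<open>Re z\<close> shows that the power has imaginary
  part at most 2 in modulus, inside the strip where \<open>Ln\<close> undoes
  \<open>exp\<close>.\<close>

lemma Ln_exp_powr_q:
  assumes "Re z \<ge> 1" "\<bar>Im z\<bar> \<le> 2"
  shows "Ln (exp (z powr of_real q)) = z powr of_real q"
proof -
  have "norm (z powr of_real q - of_real (Re z) powr of_real q) \<le> q * 1 powr (q - 1) * norm (z - of_real (Re z))"
    using assms by (intro powr_q_diff_le) auto
  also have "\<dots> \<le> 1 * 2"
    using q assms by (intro mult_mono) (auto simp: cmod_def)
  finally have "norm (z powr of_real q - of_real (Re z) powr of_real q) \<le> 2" by simp
  moreover have "Im (of_real (Re z) powr of_real q) = 0"
    using assms by (simp add: powr_of_real)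
  ultimately have "\<bar>Im (z powr of_real q)\<bar> \<le> 2"
    using abs_Im_le_cmod[of "z powr of_real q - of_real (Re z) powr of_real q"] by simp
  then show ?thesis using pi_gt3 by (intro Ln_exp) auto
qed

lemma logpow_exp_powr_q:
  assumes "Re z \<ge> 1" "\<bar>Im z\<bar> \<le> 2"
  shows "logpow (exp (z powr of_real q)) = z"
proof -
  have z: "z \<noteq> 0" using assms by auto
  have "\<bar>Im (Ln z)\<bar> < pi / 2" using assms z by (subst Re_Ln_pos_lt) auto
  then have "\<bar>q * Im (Ln z)\<bar> < pi" using q mult_mono[of "\<bar>q\<bar>" 1 "\<bar>Im (Ln z)\<bar>" "pi/2"] by (simp add: abs_mult)
  then have L: "Ln (exp (of_real q * Ln z)) = of_real q * Ln z" by (intro Ln_exp) auto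
  have "logpow (exp (z powr of_real q)) = (z powr of_real q) powr of_real (1 + p)"
    by (simp add: logpow_def Ln_exp_powr_q[OF assms])
  also have "\<dots> = exp (of_real (1 + p) * (of_real q * Ln z))"
    using z L by (simp add: powr_def)
  also have "of_real (1 + p) * (of_real q * Ln z) = of_real ((1 + p) * q) * Ln z" by simp
  also have "exp \<dots> = z" unfolding q using z by simp
  finally show ?thesis .
qed

lemma Ln_strip:
  assumes "Re v > 0" "norm v \<ge> 3"
  shows "Re (Ln v) \<ge> 1" "\<bar>Im (Ln v)\<bar> \<le> 2" "\<bar>Im (Ln v)\<bar> < pi / 2"
proof -
  have v: "v \<noteq> 0" using assms by auto
  then show "Re (Ln v) \<ge> 1" using ln_ge_1[OF assms(2)] by simp
  show "\<bar>Im (Ln v)\<bar> < pi / 2" using assms v by (subst Re_Ln_pos_lt) auto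
  then show "\<bar>Im (Ln v)\<bar> \<le> 2" using pi_less_4 by linarith
qed

lemma \<Phi>_\<Psi>:
  assumes "Re v > 0" "norm v \<ge> 3"
  shows "\<Phi> (\<Psi> v) = v"
proof -
  have "v \<noteq> 0" using assms by auto
  then show ?thesis
    unfolding \<Phi>_def \<Psi>_def using logpow_exp_powr_q[OF Ln_strip(1,2)[OF assms]] by simp
qed

text \<open>Besides \<open>Re w > 1\<close> these are the two branch conditions: one lets
  \<open>Ln\<close> undo the outer \<open>exp\<close>, the other lets the exponents
  \<open>1 + p\<close> and \<open>q\<close> cancel.\<close>

lemma \<Psi>_\<Phi>:
  assumes w: "Re w > 1" and i: "\<bar>Im (logpow w)\<bar> < pi" and l: "(1 + p) * \<bar>Im (Ln (Ln w))\<bar> < pi"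
  shows "\<Psi> (\<Phi> w) = w"
proof -
  have w0: "w \<noteq> 0" "norm w > 1" using w complex_Re_le_cmod[of w] by auto
  then have "Re (Ln w) > 0" by (intro Re_Ln_gt_0)
  then have L0: "Ln w \<noteq> 0" by (metis zero_complex.simps(1) less_irrefl)
  have 1: "Ln (\<Phi> w) = logpow w" unfolding \<Phi>_def using i by (intro Ln_exp) auto
  have "\<bar>(1 + p) * Im (Ln (Ln w))\<bar> < pi" using l p_pos by (simp add: abs_mult)
  then have 2: "Ln (exp (of_real (1 + p) * Ln (Ln w))) = of_real (1 + p) * Ln (Ln w)"
    by (intro Ln_exp) (auto simp: algebra_simps abs_less_iff)
  have "logpow w powr of_real q = exp (of_real q * (of_real (1 + p) * Ln (Ln w)))"
    using L0 2 by (simp add: logpow_def powr_def)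
  also have "of_real q * (of_real (1 + p) * Ln (Ln w)) = of_real (q * (1 + p)) * Ln (Ln w)" by simp
  also have "exp \<dots> = Ln w" unfolding q using L0 by simp
  finally show ?thesis using 1 w0 by (simp add: \<Psi>_def)
qed

lemma has_field_derivative_\<Psi>:
  assumes "Re v > 0" "norm v \<ge> 3"
  shows "(\<Psi> has_field_derivative \<Psi> v * (of_real q * Ln v powr of_real (q - 1) / v)) (at v)"
proof -
  have L: "Ln v \<notin> \<real>\<^sub>\<le>\<^sub>0" using Ln_strip(1)[OF assms] by (intro nonpos_Reals_Re_pos) auto
  have "((\<lambda>v. Ln v powr of_real q) has_field_derivative
      (of_real q * Ln v powr (of_real q - 1)) * inverse v) (at v)"
    using assms by (intro DERIV_chain2[OF has_field_derivative_powr[OF L] has_field_derivative_Ln] nonpos_Reals_Re_pos)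
  from DERIV_fun_exp[OF this] show ?thesis
    unfolding \<Psi>_def by (simp add: field_simps)
qed

text \<open>\<open>norm (\<Psi> v)\<close> is at most the exponential of
  \<open>(ln (norm v) + 2) powr q\<close>, which for large \<open>norm v\<close> is below
  \<open>\<epsilon> * ln (norm v)\<close> since \<open>q < 1\<close>. The logarithmic derivative of
  \<open>\<Psi>\<close> is at most \<open>1 / norm v\<close>.\<close>

lemma norm_deriv_\<Psi>_le:
  assumes e: "\<epsilon> > 0"
  shows "\<exists>V\<ge>3. \<forall>v. Re v > 0 \<longrightarrow> norm v \<ge> V \<longrightarrow>
    norm (\<Psi> v * (of_real q * Ln v powr of_real (q - 1) / v)) \<le> norm v powr (\<epsilon> - 1) \<and> norm (\<Psi> v) \<le> norm v powr \<epsilon>"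
proof -
  have "eventually (\<lambda>x::real. (ln x + 2) powr q \<le> \<epsilon> * ln x) at_top"
  proof -
    have "eventually (\<lambda>y::real. (y + 2) powr q \<le> \<epsilon> * y) at_top" using q e by real_asymp
    then show ?thesis using ln_at_top by (rule eventually_compose_filterlim)
  qed
  then obtain V0 where V0: "\<And>x. x \<ge> V0 \<Longrightarrow> (ln x + 2) powr q \<le> \<epsilon> * ln x"
    by (auto simp: eventually_at_top_linorder)
  show ?thesis
  proof (intro exI[of _ "max 3 V0"] conjI[OF max.cobounded1] allI impI)
    fix v :: complex assume v: "Re v > 0" "norm v \<ge> max 3 V0"
    have v0: "v \<noteq> 0" using v by auto
    have s: "Re (Ln v) \<ge> 1" "\<bar>Im (Ln v)\<bar> \<le> 2" using Ln_strip[of v] v by auto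
    have n: "norm (Ln v) \<le> ln (norm v) + 2" "norm (Ln v) \<ge> 1"
      using cmod_le[of "Ln v"] s v0 complex_Re_le_cmod[of "Ln v"] by auto
    have "norm (\<Psi> v) \<le> exp (norm (Ln v powr of_real q))" unfolding \<Psi>_def by (rule norm_exp)
    also have "norm (Ln v powr of_real q) = norm (Ln v) powr q"
      by (subst norm_powr_real_powr') auto
    also have "\<dots> \<le> (ln (norm v) + 2) powr q" using n q by (intro powr_mono2) auto
    also have "\<dots> \<le> \<epsilon> * ln (norm v)" using V0 v by auto
    also have "exp (\<epsilon> * ln (norm v)) = norm v powr \<epsilon>" using v0 by (simp add: powr_def)
    finally have 1: "norm (\<Psi> v) \<le> norm v powr \<epsilon>" by simp
    have "norm (Ln v powr of_real (q - 1)) = norm (Ln v) powr (q - 1)"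
      by (subst norm_powr_real_powr') auto
    also have "\<dots> \<le> 1 powr (q - 1)" using n q by (intro powr_mono2') auto
    finally have 2: "norm (Ln v powr of_real (q - 1)) \<le> 1" by simp
    have "norm (of_real q * Ln v powr of_real (q - 1) / v) \<le> 1 / norm v"
      using q 2 v0 by (simp add: norm_mult norm_divide divide_right_mono mult_le_one del: of_real_diff)
    then have "norm (\<Psi> v * (of_real q * Ln v powr of_real (q - 1) / v)) \<le> norm v powr \<epsilon> * (1 / norm v)"
      unfolding norm_mult[of "\<Psi> v"] using 1 by (intro mult_mono) auto
    also have "\<dots> = norm v powr (\<epsilon> - 1)" using v0 by (simp add: powr_diff)
    finally show "norm (\<Psi> v * (of_real q * Ln v powr of_real (q - 1) / v)) \<le> norm v powr (\<epsilon> - 1) \<and> norm (\<Psi> v) \<le> norm v powr \<epsilon>"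
      using 1 by blast
  qed
qed

text \<open>One threshold for all later uses: beyond it the asymptotics of \<open>logpow\<close>
  hold and, by \<open>exp p \<le> X0\<close>, the height does not decrease.\<close>

definition X0 :: real where
  "X0 = (SOME X. X \<ge> 3 \<and> exp p \<le> X \<and> (\<forall>x\<ge>X. \<forall>\<theta>. \<bar>\<theta>\<bar> \<le> 1 \<longrightarrow>
     norm (logpow (Complex x (\<theta> * h x)) - of_real (ln x powr (1 + p)) - \<i> * of_real (pi * \<theta>)) \<le> 1/5 \<and>
     (1 + p) * \<bar>Im (Ln (Ln (Complex x (\<theta> * h x))))\<bar> < pi))"

lemma X0: "X0 \<ge> 3" "exp p \<le> X0"
  "\<And>x \<theta>. x \<ge> X0 \<Longrightarrow> \<bar>\<theta>\<bar> \<le> 1 \<Longrightarrow>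
     norm (logpow (Complex x (\<theta> * h x)) - of_real (ln x powr (1 + p)) - \<i> * of_real (pi * \<theta>)) \<le> 1/5"
  "\<And>x \<theta>. x \<ge> X0 \<Longrightarrow> \<bar>\<theta>\<bar> \<le> 1 \<Longrightarrow> (1 + p) * \<bar>Im (Ln (Ln (Complex x (\<theta> * h x))))\<bar> < pi"
proof -
  let ?P = "\<lambda>X. X \<ge> 3 \<and> exp p \<le> X \<and> (\<forall>x\<ge>X. \<forall>\<theta>. \<bar>\<theta>\<bar> \<le> 1 \<longrightarrow>
     norm (logpow (Complex x (\<theta> * h x)) - of_real (ln x powr (1 + p)) - \<i> * of_real (pi * \<theta>)) \<le> 1/5 \<and>
     (1 + p) * \<bar>Im (Ln (Ln (Complex x (\<theta> * h x))))\<bar> < pi)"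
  obtain X where "X \<ge> 3" "\<forall>x\<ge>X. \<forall>\<theta>. \<bar>\<theta>\<bar> \<le> 1 \<longrightarrow>
     norm (logpow (Complex x (\<theta> * h x)) - of_real (ln x powr (1 + p)) - \<i> * of_real (pi * \<theta>)) \<le> 1/5 \<and>
     (1 + p) * \<bar>Im (Ln (Ln (Complex x (\<theta> * h x))))\<bar> < pi"
    using logpow_asymp by blast
  then have "?P (max X (exp p))" by simp
  then have "?P (SOME X. ?P X)" by (rule someI[where P = ?P])
  then have P: "?P X0" by (fold X0_def)
  show "X0 \<ge> 3" "exp p \<le> X0" using P[THEN conjunct1] P[THEN conjunct2, THEN conjunct1] by simp_all
  show "norm (logpow (Complex x (\<theta> * h x)) - of_real (ln x powr (1 + p)) - \<i> * of_real (pi * \<theta>)) \<le> 1/5"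
    "(1 + p) * \<bar>Im (Ln (Ln (Complex x (\<theta> * h x))))\<bar> < pi" if "x \<ge> X0" "\<bar>\<theta>\<bar> \<le> 1" for x \<theta>
    using P[THEN conjunct2, THEN conjunct2, rule_format, OF that] by simp_all
qed

lemma logpow_bounds:
  assumes "x \<ge> X0" "\<bar>\<theta>\<bar> \<le> 1"
  shows "\<bar>Im (logpow (Complex x (\<theta> * h x))) - pi * \<theta>\<bar> \<le> 1/5"
    "Re (logpow (Complex x (\<theta> * h x))) \<ge> ln x powr (1 + p) - 1/5"
proof -
  let ?u = "logpow (Complex x (\<theta> * h x)) - of_real (ln x powr (1 + p)) - \<i> * of_real (pi * \<theta>)"
  have "\<bar>Im ?u\<bar> \<le> 1/5" "\<bar>Re ?u\<bar> \<le> 1/5"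
    using X0(3)[OF assms] abs_Im_le_cmod[of ?u] abs_Re_le_cmod[of ?u] by linarith+
  then have "\<bar>Im (logpow (Complex x (\<theta> * h x))) - pi * \<theta>\<bar> \<le> 1/5"
    "\<bar>Re (logpow (Complex x (\<theta> * h x))) - ln x powr (1 + p)\<bar> \<le> 1/5" by simp_all
  then show "\<bar>Im (logpow (Complex x (\<theta> * h x))) - pi * \<theta>\<bar> \<le> 1/5"
    "Re (logpow (Complex x (\<theta> * h x))) \<ge> ln x powr (1 + p) - 1/5" by linarith+
qed

lemma h_pos: "x \<ge> 3 \<Longrightarrow> h x > 0"
  using stallard_height_pos p_pos by blast

lemma powr_q_real: "s \<ge> 1 \<Longrightarrow> of_real s powr (of_real q :: complex) = of_real (s powr q)"
  by (simp add: powr_of_real)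

text \<open>Along the path from \<open>|v|\<close> to \<open>v\<close> on which \<open>Im (Ln v)\<close> grows, \<open>\<Psi>\<close> cannot cross the
  curve \<open>y = 3h(x)/4\<close>, because there \<open>Im (logpow z)\<close> is close to \<open>3\<pi>/4 > \<pi>/2\<close>.\<close>

lemma \<Psi>_region:
  "\<exists>V\<ge>3. \<forall>v. Re v > 0 \<longrightarrow> norm v \<ge> V \<longrightarrow> Re (\<Psi> v) \<ge> R \<and> \<bar>Im (\<Psi> v)\<bar> < 3/4 * h (Re (\<Psi> v))"
proof -
  define R' where "R' = max R X0"
  \<comment> \<open>The 2 bounds the length of the vertical path from \<open>ln (norm v)\<close> to
    \<open>Ln v\<close>. The power \<open>q\<close> then moves by at most 1, and
    \<open>1 < pi / 3\<close> keeps the cosine of its imaginary part at least 1/2: hence the halved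
    exponential in the next condition.\<close>
  have "eventually (\<lambda>s::real. q * s powr (q - 1) * 2 \<le> 1) at_top"
    using q by real_asymp
  moreover have "eventually (\<lambda>s::real. exp (s powr q - 1) / 2 \<ge> R') at_top"
    using q by real_asymp
  ultimately have "eventually (\<lambda>s::real. q * s powr (q - 1) * 2 \<le> 1 \<and> exp (s powr q - 1) / 2 \<ge> R') at_top"
    by eventually_elim auto
  then have "eventually (\<lambda>x::real. q * ln x powr (q - 1) * 2 \<le> 1 \<and> exp (ln x powr q - 1) / 2 \<ge> R') at_top"
    using ln_at_top by (rule eventually_compose_filterlim)
  then obtain V0 where V0: "\<And>x::real. x \<ge> V0 \<Longrightarrow> q * ln x powr (q - 1) * 2 \<le> 1 \<and> exp (ln x powr q - 1) / 2 \<ge> R'"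
    by (auto simp: eventually_at_top_linorder)
  show ?thesis
  proof (intro exI[of _ "max 3 V0"] conjI allI impI)
    fix v :: complex assume v: "Re v > 0" "norm v \<ge> max 3 V0"
    define s where "s = Re (Ln v)"
    define \<tau> where "\<tau> = Im (Ln v)"
    have v0: "v \<noteq> 0" using v by auto
    have s: "s \<ge> 1" "\<bar>\<tau>\<bar> \<le> 2" "\<bar>\<tau>\<bar> < pi/2" "s = ln (norm v)"
      using Ln_strip[of v] v v0 by (auto simp: s_def \<tau>_def)
    have s': "q * s powr (q - 1) * 2 \<le> 1" "exp (s powr q - 1) / 2 \<ge> R'"
      using V0[of "norm v"] v s by auto
    define \<zeta> where "\<zeta> l = Complex s (l * \<tau>)" for l
    define \<omega> where "\<omega> l = exp (\<zeta> l powr of_real q)" for l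
    have \<zeta>b: "\<bar>l * \<tau>\<bar> \<le> \<bar>\<tau>\<bar>" if "l \<in> {0..1}" for l
      using that by (simp add: abs_mult mult_left_le_one_le)
    have Re\<omega>: "Re (\<omega> l) \<ge> R'" if l: "l \<in> {0..1}" for l
    proof -
      have "norm (\<zeta> l powr of_real q - of_real s powr of_real q) \<le> q * s powr (q - 1) * norm (\<zeta> l - of_real s)"
        using s by (intro powr_q_diff_le) (auto simp: \<zeta>_def)
      also have "norm (\<zeta> l - of_real s) \<le> 2" using \<zeta>b[OF l] s by (simp add: \<zeta>_def cmod_def)
      also have "q * s powr (q - 1) * 2 \<le> 1" by (rule s')
      finally have n: "norm (\<zeta> l powr of_real q - of_real (s powr q)) \<le> 1"
        using q powr_q_real[OF s(1)] by (simp add: mult_left_mono)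
      let ?a = "\<zeta> l powr of_real q"
      have A: "Re ?a \<ge> s powr q - 1" "\<bar>Im ?a\<bar> \<le> 1"
        using n abs_Re_le_cmod[of "?a - of_real (s powr q)"] abs_Im_le_cmod[of "?a - of_real (s powr q)"] by auto
      have "cos (pi/3) \<le> cos \<bar>Im ?a\<bar>" using A(2) pi_gt3 by (intro cos_monotone_0_pi_le) auto
      then have "1/2 \<le> cos (Im ?a)" by (simp add: cos_60)
      then have "exp (s powr q - 1) * (1/2) \<le> exp (Re ?a) * cos (Im ?a)"
        using A by (intro mult_mono) auto
      then show ?thesis using s' by (simp add: \<omega>_def Re_exp)
    qed
    have X: "Re (\<omega> l) \<ge> X0" if "l \<in> {0..1}" for l using Re\<omega>[OF that] by (simp add: R'_def)
    have lp: "logpow (\<omega> l) = \<zeta> l" if "l \<in> {0..1}" for l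
      unfolding \<omega>_def using s \<zeta>b[OF that] by (intro logpow_exp_powr_q) (auto simp: \<zeta>_def)
    have \<omega>1: "\<omega> 1 = \<Psi> v" by (simp add: \<omega>_def \<zeta>_def \<Psi>_def s_def \<tau>_def)
    show "Re (\<Psi> v) \<ge> R" using Re\<omega>[of 1] by (simp add: \<omega>1 R'_def)
    define T where "T l = \<bar>Im (\<omega> l)\<bar> / h (Re (\<omega> l))" for l
    have hp: "h (Re (\<omega> l)) > 0" if "l \<in> {0..1}" for l using X[OF that] X0(1) by (intro h_pos) auto
    show "\<bar>Im (\<Psi> v)\<bar> < 3/4 * h (Re (\<Psi> v))"
    proof (rule ccontr)
      assume "\<not> ?thesis"
      then have T1: "T 1 \<ge> 3/4" using hp[of 1] by (simp add: T_def \<omega>1 field_simps)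
      have T0: "T 0 = 0"
      proof -
        have "\<omega> 0 = of_real (exp (s powr q))"
          using powr_q_real[OF s(1)] by (simp add: \<omega>_def \<zeta>_def complex_of_real_def[symmetric] exp_of_real)
        then show ?thesis by (simp add: T_def)
      qed
      have c\<omega>: "continuous_on {0..1} \<omega>"
        unfolding \<omega>_def
      proof (rule continuous_on_exp, rule continuous_on_compose2[where g = "\<lambda>z. z powr of_real q" and f = \<zeta> and t = "{z. Re z \<ge> 1}"])
        show "continuous_on {z. Re z \<ge> 1} (\<lambda>z. z powr of_real q :: complex)"
        proof (rule DERIV_continuous_on)
          fix z assume "z \<in> {z. Re z \<ge> 1}"
          then have "z \<notin> \<real>\<^sub>\<le>\<^sub>0" using nonpos_Reals_Re_pos[of z] by simp
          then show "((\<lambda>z. z powr of_real q) has_field_derivative of_real q * z powr (of_real q - 1)) (at z within {z. Re z \<ge> 1})"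
            by (rule has_field_derivative_at_within[OF has_field_derivative_powr])
        qed
        show "continuous_on {0..1} \<zeta>" unfolding \<zeta>_def Complex_eq by (intro continuous_intros)
        show "\<zeta> ` {0..1} \<subseteq> {z. Re z \<ge> 1}" using s(1) by (simp add: \<zeta>_def image_subset_iff)
      qed
      have nz: "h (Re (\<omega> l)) \<noteq> 0" if "l \<in> {0..1}" for l using hp[OF that] by simp
      have "continuous_on {0..1} (\<lambda>l. h (Re (\<omega> l)))"
        by (rule continuous_on_compose2[OF continuous_on_stallard_height[OF p_pos]])
           (use X X0(1) in \<open>force intro!: continuous_intros c\<omega>\<close>)+
      then have "continuous_on {0..1} T"
        unfolding T_def by (intro continuous_intros c\<omega> ballI nz)
      then obtain l where l: "0 \<le> l" "l \<le> 1" "T l = 3/4"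
        using IVT'[of T 0 "3/4" 1] T0 T1 by auto
      have l1: "l \<in> {0..1}" using l by auto
      define \<theta> where "\<theta> = Im (\<omega> l) / h (Re (\<omega> l))"
      have \<theta>: "\<bar>\<theta>\<bar> = 3/4" using l(3) hp[OF l1] by (simp add: T_def \<theta>_def)
      have "Complex (Re (\<omega> l)) (\<theta> * h (Re (\<omega> l))) = \<omega> l"
        using hp[OF l1] by (simp add: \<theta>_def complex_eq_iff)
      then have "\<bar>l * \<tau> - pi * \<theta>\<bar> \<le> 1/5"
        using logpow_bounds(1)[OF X[OF l1], of \<theta>] \<theta> lp[OF l1] by (simp add: \<zeta>_def)
      moreover have "\<bar>pi * \<theta>\<bar> = 3/4 * pi" using \<theta> by (simp add: abs_mult)
      ultimately have "3/4 * pi - 1/5 \<le> \<bar>l * \<tau>\<bar>" by linarith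
      then show False using \<zeta>b[OF l1] s(3) pi_gt3 by linarith
    qed
  qed auto
qed

end

section \<open>Cauchy integrals along the boundary curves\<close>

lemma integrable_times_bounded:
  fixes \<psi> k :: "real \<Rightarrow> complex"
  assumes "integrable lborel \<psi>" "k \<in> borel_measurable lborel" "\<And>t. norm (k t) \<le> B"
  shows "integrable lborel (\<lambda>t. \<psi> t * k t)"
    and "norm (LINT t|lborel. \<psi> t * k t) \<le> B * (LINT t|lborel. norm (\<psi> t))"
proof -
  have le: "norm (\<psi> t * k t) \<le> B * norm (\<psi> t)" for t
    using mult_right_mono[OF assms(3)[of t], of "norm (\<psi> t)"] by (simp add: norm_mult mult.commute)
  show 1: "integrable lborel (\<lambda>t. \<psi> t * k t)"
    by (rule Bochner_Integration.integrable_bound[of _ "\<lambda>t. B * norm (\<psi> t)"])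
       (use assms le in \<open>auto intro!: order.trans[OF le]\<close>)
  have "norm (LINT t|lborel. \<psi> t * k t) \<le> (LINT t|lborel. norm (\<psi> t * k t))"
    by (rule integral_norm_bound)
  also have "\<dots> \<le> (LINT t|lborel. B * norm (\<psi> t))"
    using 1 assms le by (intro integral_mono) auto
  finally show "norm (LINT t|lborel. \<psi> t * k t) \<le> B * (LINT t|lborel. norm (\<psi> t))" by simp
qed

text \<open>\<open>\<psi>\<close> stands for the integrand with the speed of the curve absorbed. The
  estimates use its integrability and a positive distance from the curve to the point.\<close>

locale L1_curve =
  fixes \<psi> \<gamma> :: "real \<Rightarrow> complex"
  assumes \<psi>: "integrable lborel \<psi>" and \<gamma>: "\<gamma> \<in> borel_measurable lborel"
begin

definition transform :: "complex \<Rightarrow> complex" where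
  "transform z = (LINT t|lborel. \<psi> t * (1 / (\<gamma> t - z)))"

definition mass :: real where "mass = (LINT t|lborel. norm (\<psi> t))"

lemma mass_nonneg: "mass \<ge> 0" unfolding mass_def by simp

lemma measurable_kernels:
  "(\<lambda>t. 1 / (\<gamma> t - z)) \<in> borel_measurable lborel"
  "(\<lambda>t. 1 / ((\<gamma> t - z) * (\<gamma> t - w))) \<in> borel_measurable lborel"
  "(\<lambda>t. 1 / ((\<gamma> t - z)^2 * (\<gamma> t - w))) \<in> borel_measurable lborel"
  using \<gamma> by measurable

lemma integrable_transform:
  assumes "d > 0" "\<And>t. d \<le> norm (\<gamma> t - z)"
  shows "integrable lborel (\<lambda>t. \<psi> t * (1 / (\<gamma> t - z)))"
  by (rule integrable_times_bounded(1)[OF \<psi> measurable_kernels(1), of _ "1/d"])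
     (use assms in \<open>simp add: norm_divide frac_le\<close>)

lemma norm_transform_le:
  assumes "d > 0" "\<And>t. d \<le> norm (\<gamma> t - z)"
  shows "norm (transform z) \<le> mass / d"
proof -
  have "norm (transform z) \<le> (1/d) * mass"
    unfolding transform_def mass_def
    by (rule integrable_times_bounded(2)[OF \<psi> measurable_kernels(1)])
     (use assms in \<open>simp add: norm_divide frac_le\<close>)
  then show ?thesis by simp
qed

text \<open>The difference of two Cauchy kernels is \<open>w - z\<close> times their product.
  Integrated, this gives both the Lipschitz bound and, as \<open>w\<close> tends to
  \<open>z\<close>, the derivative.\<close>

lemma transform_diff:
  assumes d: "d > 0" "\<And>t. d \<le> norm (\<gamma> t - z)" and e: "e > 0" "\<And>t. e \<le> norm (\<gamma> t - w)"
  shows "transform w - transform z = (w - z) * (LINT t|lborel. \<psi> t * (1 / ((\<gamma> t - z) * (\<gamma> t - w))))"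
    and "norm (LINT t|lborel. \<psi> t * (1 / ((\<gamma> t - z) * (\<gamma> t - w)))) \<le> mass / (d * e)"
    and "integrable lborel (\<lambda>t. \<psi> t * (1 / ((\<gamma> t - z) * (\<gamma> t - w))))"
proof -
  have k: "norm (1 / ((\<gamma> t - z) * (\<gamma> t - w))) \<le> 1 / (d * e)" for t
    using mult_mono[OF d(2)[of t] e(2)[of t]] d(1) e(1)
    by (simp add: norm_divide norm_mult frac_le)
  have ne: "\<gamma> t - z \<noteq> 0" "\<gamma> t - w \<noteq> 0" for t using d(1) d(2)[of t] e(1) e(2)[of t] by auto
  show "integrable lborel (\<lambda>t. \<psi> t * (1 / ((\<gamma> t - z) * (\<gamma> t - w))))"
    by (rule integrable_times_bounded(1)[OF \<psi> measurable_kernels(2) k])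
  have "norm (LINT t|lborel. \<psi> t * (1 / ((\<gamma> t - z) * (\<gamma> t - w)))) \<le> 1 / (d * e) * mass"
    unfolding mass_def by (rule integrable_times_bounded(2)[OF \<psi> measurable_kernels(2) k])
  then show "norm (LINT t|lborel. \<psi> t * (1 / ((\<gamma> t - z) * (\<gamma> t - w)))) \<le> mass / (d * e)" by simp
  have "transform w - transform z = (LINT t|lborel. \<psi> t * (1 / (\<gamma> t - w)) - \<psi> t * (1 / (\<gamma> t - z)))"
    unfolding transform_def using integrable_transform[OF d] integrable_transform[OF e]
    by (intro Bochner_Integration.integral_diff[symmetric])
  also have "\<dots> = (LINT t|lborel. (w - z) * (\<psi> t * (1 / ((\<gamma> t - z) * (\<gamma> t - w)))))"
  proof (rule Bochner_Integration.integral_cong)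
    fix t
    show "\<psi> t * (1 / (\<gamma> t - w)) - \<psi> t * (1 / (\<gamma> t - z)) = (w - z) * (\<psi> t * (1 / ((\<gamma> t - z) * (\<gamma> t - w))))"
      using ne[of t] by (simp add: divide_simps) (simp add: algebra_simps)
  qed simp
  also have "\<dots> = (w - z) * (LINT t|lborel. \<psi> t * (1 / ((\<gamma> t - z) * (\<gamma> t - w))))"
    by (rule integral_mult_right_zero)
  finally show "transform w - transform z = (w - z) * (LINT t|lborel. \<psi> t * (1 / ((\<gamma> t - z) * (\<gamma> t - w))))" .
qed

lemma transform_lipschitz:
  assumes "d > 0" "\<And>t. d \<le> norm (\<gamma> t - z)" and "e > 0" "\<And>t. e \<le> norm (\<gamma> t - w)"
  shows "norm (transform w - transform z) \<le> mass / (d * e) * norm (w - z)"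
  using mult_left_mono[OF transform_diff(2)[OF assms], of "norm (w - z)"]
  unfolding transform_diff(1)[OF assms] by (simp add: norm_mult mult.commute)

text \<open>The error of the difference quotient is \<open>w - z\<close> times the integral of a
  third-order kernel, which is at most \<open>2 / d^3\<close> for \<open>w\<close> within
  \<open>d / 2\<close> of \<open>z\<close>.\<close>

lemma has_field_derivative_transform:
  assumes d: "d > 0" "\<And>t. d \<le> norm (\<gamma> t - z)"
  shows "(transform has_field_derivative (LINT t|lborel. \<psi> t * (1 / ((\<gamma> t - z) * (\<gamma> t - z))))) (at z)"
    (is "(_ has_field_derivative ?D) _")
proof -
  have far: "d/2 \<le> norm (\<gamma> t - w)" if "norm (w - z) < d/2" for w t
    using d(2)[of t] norm_triangle_ineq[of "\<gamma> t - w" "w - z"] that by simp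
  have ev: "eventually (\<lambda>w. w \<noteq> z \<and> norm (w - z) < d/2) (at z)"
    using d(1) by (auto simp: eventually_at dist_norm intro!: exI[of _ "d/2"])
  have "((\<lambda>w. (transform w - transform z) / (w - z) - ?D) \<longlongrightarrow> 0) (at z)"
  proof (rule Lim_null_comparison)
    show "eventually (\<lambda>w. norm ((transform w - transform z) / (w - z) - ?D) \<le> norm (w - z) * (2 / d^3 * mass)) (at z)"
      using ev
    proof eventually_elim
      case (elim w)
      then have w: "w \<noteq> z" "\<And>t. d/2 \<le> norm (\<gamma> t - w)" using far by auto
      have d2: "d/2 > 0" using d by simp
      have ne: "\<gamma> t - z \<noteq> 0" "\<gamma> t - w \<noteq> 0" for t using d(1) d(2)[of t] w(2)[of t] by auto
      have k: "norm (1 / ((\<gamma> t - z)^2 * (\<gamma> t - w))) \<le> 2 / d^3" for t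
      proof -
        have "d^2 * (d/2) \<le> norm (\<gamma> t - z)^2 * norm (\<gamma> t - w)"
          using d w(2)[of t] by (intro mult_mono power_mono) auto
        then have "1 / (norm (\<gamma> t - z)^2 * norm (\<gamma> t - w)) \<le> 1 / (d^2 * (d/2))"
          using d by (intro divide_left_mono mult_pos_pos) (use ne[of t] in auto)
        also have "1 / (d^2 * (d/2)) = 2 / d^3" by (simp add: power3_eq_cube power2_eq_square)
        finally show ?thesis by (simp add: norm_divide norm_mult norm_power)
      qed
      have "(transform w - transform z) / (w - z) - ?D
          = (LINT t|lborel. \<psi> t * (1 / ((\<gamma> t - z) * (\<gamma> t - w)))) - ?D"
        using w(1) by (simp add: transform_diff(1)[OF d d2 w(2)])
      also have "\<dots> = (LINT t|lborel. \<psi> t * (1 / ((\<gamma> t - z) * (\<gamma> t - w))) - \<psi> t * (1 / ((\<gamma> t - z) * (\<gamma> t - z))))"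
        by (intro Bochner_Integration.integral_diff[symmetric] transform_diff(3)[OF d d2 w(2)] transform_diff(3)[OF d d])
      also have "\<dots> = (LINT t|lborel. (w - z) * (\<psi> t * (1 / ((\<gamma> t - z)^2 * (\<gamma> t - w)))))"
      proof (rule Bochner_Integration.integral_cong)
        fix t
        show "\<psi> t * (1 / ((\<gamma> t - z) * (\<gamma> t - w))) - \<psi> t * (1 / ((\<gamma> t - z) * (\<gamma> t - z))) =
            (w - z) * (\<psi> t * (1 / ((\<gamma> t - z)^2 * (\<gamma> t - w))))"
          using ne[of t] by (simp add: divide_simps power2_eq_square) (simp add: algebra_simps)
      qed simp
      also have "\<dots> = (w - z) * (LINT t|lborel. \<psi> t * (1 / ((\<gamma> t - z)^2 * (\<gamma> t - w))))"
        by (rule integral_mult_right_zero)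
      finally have "norm ((transform w - transform z) / (w - z) - ?D) =
          norm (w - z) * norm (LINT t|lborel. \<psi> t * (1 / ((\<gamma> t - z)^2 * (\<gamma> t - w))))"
        by (simp add: norm_mult)
      also have "\<dots> \<le> norm (w - z) * (2 / d^3 * mass)"
        unfolding mass_def
        by (intro mult_left_mono integrable_times_bounded(2)[OF \<psi> measurable_kernels(3) k]) auto
      finally show ?case .
    qed
    show "((\<lambda>w. norm (w - z) * (2 / d^3 * mass)) \<longlongrightarrow> 0) (at z)"
      by (rule tendsto_eq_intros refl | simp)+
  qed
  then show ?thesis
    unfolding has_field_derivative_iff by (subst (asm) LIM_zero_iff)
qed

end

section \<open>The family of contours and the decay of \<open>f\<close> on them\<close>

context stallard
begin

text \<open>The boundary of the part \<open>Re z > R\<close> of the domain of height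
  \<open>\<theta> * h\<close>. On the ends the abscissa is \<open>2 + |t|\<close> for every
  \<open>\<theta>\<close> and \<open>R\<close>, so two contours at the same large parameter are on
  one vertical line.\<close>

definition \<gamma> :: "real \<Rightarrow> real \<Rightarrow> real \<Rightarrow> complex" where
  "\<gamma> \<theta> R t = Complex (max R (2 + \<bar>t\<bar>)) (\<theta> * max (-1) (min 1 (t / (R - 2))) * h (max R (2 + \<bar>t\<bar>)))"

definition d\<gamma> :: "real \<Rightarrow> real \<Rightarrow> real \<Rightarrow> complex" where
  "d\<gamma> \<theta> R t = (if \<bar>t\<bar> \<le> R - 2 then Complex 0 (\<theta> * h R / (R - 2)) else Complex (sgn t) (\<theta> * dh (2 + \<bar>t\<bar>)))"

definition \<psi> :: "real \<Rightarrow> real \<Rightarrow> real \<Rightarrow> complex" where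
  "\<psi> \<theta> R t = f (\<gamma> \<theta> R t) * d\<gamma> \<theta> R t"

definition J :: "real \<Rightarrow> real \<Rightarrow> complex \<Rightarrow> complex" where
  "J \<theta> R z = 1 / (2 * of_real pi * \<i>) * (LINT t|lborel. \<psi> \<theta> R t * (1 / (\<gamma> \<theta> R t - z)))"

text \<open>The bound \<open>\<theta> \<ge> 3/4\<close> keeps the argument of \<open>\<Phi>\<close> on \<open>\<gamma> \<theta> R\<close> close to \<open>[3\<pi>/4, \<pi>]\<close> in absolute
  value, so that \<open>f = exp \<circ> \<Phi>\<close> decays there; \<open>\<gamma> 1 3\<close> is \<open>stallard_L\<close>.\<close>

definition adm :: "real \<Rightarrow> real \<Rightarrow> bool" where "adm \<theta> R \<longleftrightarrow> 3/4 \<le> \<theta> \<and> \<theta> \<le> 1 \<and> 3 \<le> R"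

lemma adm: assumes "adm \<theta> R" shows "3/4 \<le> \<theta>" "\<theta> \<le> 1" "3 \<le> R" "0 < \<theta>" "0 \<le> \<theta>"
  using assms by (auto simp: adm_def)

lemma continuous_on_\<gamma>:
  assumes "R \<ge> 3" shows "continuous_on UNIV (\<gamma> \<theta> R)"
proof -
  have "continuous_on UNIV (\<lambda>t. h (max R (2 + \<bar>t\<bar>)))"
    by (rule continuous_on_compose2[OF continuous_on_stallard_height[OF p_pos]])
       (use assms in \<open>auto intro!: continuous_intros\<close>)
  then show ?thesis unfolding \<gamma>_def Complex_eq using assms by (intro continuous_intros) auto
qed

lemma Re_\<gamma>: "Re (\<gamma> \<theta> R t) = max R (2 + \<bar>t\<bar>)" by (simp add: \<gamma>_def)

lemma Re_\<gamma>_ge: "Re (\<gamma> \<theta> R t) \<ge> R" by (simp add: \<gamma>_def)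

lemma \<gamma>_tail: 
  assumes "R \<ge> 3" "\<bar>t\<bar> \<ge> R - 2"
  shows "\<gamma> \<theta> R t = Complex (2 + \<bar>t\<bar>) (sgn t * \<theta> * h (2 + \<bar>t\<bar>))"
proof (cases "t > 0")
  case True
  then have "t / (R - 2) \<ge> 1" using assms by simp
  then show ?thesis using assms True by (simp add: \<gamma>_def)
next
  case False
  then have "t / (R - 2) \<le> -1" "t < 0" using assms by (auto simp: field_simps)
  then show ?thesis using assms by (simp add: \<gamma>_def)
qed

lemma \<gamma>_mid: 
  assumes "R \<ge> 3" "\<bar>t\<bar> \<le> R - 2"
  shows "\<gamma> \<theta> R t = Complex R (\<theta> * (t / (R - 2)) * h R)"
proof -
  have "\<bar>t / (R - 2)\<bar> \<le> 1" using assms by simp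
  then have "-1 \<le> t / (R - 2)" "t / (R - 2) \<le> 1" by linarith+
  then show ?thesis using assms by (simp add: \<gamma>_def)
qed

lemma Im_\<gamma>_le:
  assumes "adm \<theta> R"
  shows "\<bar>Im (\<gamma> \<theta> R t)\<bar> \<le> \<theta> * h (Re (\<gamma> \<theta> R t))"
proof -
  have "\<bar>max (-1) (min 1 (t / (R - 2)))\<bar> \<le> 1" by auto
  moreover have "h (max R (2 + \<bar>t\<bar>)) > 0" using adm[OF assms] by (intro h_pos) auto
  ultimately show ?thesis using adm[OF assms]
    by (simp add: \<gamma>_def abs_mult mult_right_mono mult_left_le)
qed

lemma Im_\<gamma>_eq:
  assumes "adm \<theta> R" "Re (\<gamma> \<theta> R t) > R"
  shows "\<bar>Im (\<gamma> \<theta> R t)\<bar> = \<theta> * h (Re (\<gamma> \<theta> R t))"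
proof -
  have t: "\<bar>t\<bar> > R - 2" using assms by (auto simp: Re_\<gamma>)
  have "h (2 + \<bar>t\<bar>) > 0" using adm[OF assms(1)] t by (intro h_pos) auto
  then show ?thesis
    using \<gamma>_tail[of R t \<theta>] t adm[OF assms(1)] by (simp add: abs_mult)
qed

lemma has_vector_derivative_\<gamma>:
  assumes R: "R \<ge> 3" and t: "\<bar>t\<bar> \<noteq> R - 2"
  shows "(\<gamma> \<theta> R has_vector_derivative d\<gamma> \<theta> R t) (at t)"
proof -
  consider "\<bar>t\<bar> < R - 2" | "t > R - 2" | "t < - (R - 2)" using t R by linarith
  then show ?thesis
  proof cases
    case 1
    have "((\<lambda>t. of_real R + \<i> * of_real (\<theta> * (t / (R - 2)) * h R)) has_vector_derivative
      (0 + \<i> * of_real (\<theta> * (1 / (R - 2)) * h R))) (at t)"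
      by (intro derivative_intros has_vector_derivative_of_real has_vector_derivative_mult_right)
         (use R in \<open>auto intro!: derivative_eq_intros\<close>)
    then have D: "((\<lambda>t. Complex R (\<theta> * (t / (R - 2)) * h R)) has_vector_derivative d\<gamma> \<theta> R t) (at t)"
      using 1 by (simp add: d\<gamma>_def Complex_eq mult.commute)
    show ?thesis
    proof (rule has_vector_derivative_transform_within_open[OF D])
      show "open {-(R-2)<..<R-2}" "t \<in> {-(R-2)<..<R-2}" using 1 by auto
    qed (use R in \<open>auto simp: \<gamma>_mid\<close>)
  next
    case 2
    have "((\<lambda>t. of_real (2 + t) + \<i> * of_real (\<theta> * h (2 + t))) has_vector_derivative
      (of_real 1 + \<i> * of_real (\<theta> * dh (2 + t)))) (at t)"
      by (intro derivative_intros has_vector_derivative_of_real has_vector_derivative_mult_right)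
         (use 2 R in \<open>auto intro!: derivative_eq_intros DERIV_chain2[OF has_real_derivative_h]\<close>)
    then have D: "((\<lambda>t. Complex (2 + t) (\<theta> * h (2 + t))) has_vector_derivative d\<gamma> \<theta> R t) (at t)"
      using 2 R by (simp add: d\<gamma>_def Complex_eq)
    show ?thesis
    proof (rule has_vector_derivative_transform_within_open[OF D])
      show "open {R-2<..}" "t \<in> {R-2<..}" using 2 by auto
    qed (use R in \<open>auto simp: \<gamma>_tail\<close>)
  next
    case 3
    have "((\<lambda>t. of_real (2 - t) + \<i> * of_real (- \<theta> * h (2 - t))) has_vector_derivative
      (of_real (-1) + \<i> * of_real (- \<theta> * (dh (2 - t) * (-1))))) (at t)"
      by (intro derivative_intros has_vector_derivative_of_real has_vector_derivative_mult_right DERIV_chain2[OF has_real_derivative_h])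
         (use 3 R in \<open>auto intro!: derivative_eq_intros DERIV_chain2[OF has_real_derivative_h]\<close>)
    then have D: "((\<lambda>t. Complex (2 - t) (- \<theta> * h (2 - t))) has_vector_derivative d\<gamma> \<theta> R t) (at t)"
      using 3 R by (simp add: d\<gamma>_def Complex_eq)
    show ?thesis
    proof (rule has_vector_derivative_transform_within_open[OF D])
      show "open {..<-(R-2)}" "t \<in> {..<-(R-2)}" using 3 by auto
    qed (use R in \<open>auto simp: \<gamma>_tail\<close>)
  qed
qed

text \<open>Here \<open>|Im (logpow z)|\<close> is within \<open>pi / 3\<close> of
  \<open>pi\<close>, as \<open>pi / 4 + 1/5 < pi / 3\<close>. So its cosine is at most -1/2, while
  \<open>exp (Re (logpow z))\<close> is at least \<open>x / 2\<close>.\<close>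

lemma norm_f_decay:
  assumes x: "x \<ge> X0" and \<theta>: "3/4 \<le> \<bar>\<theta>\<bar>" "\<bar>\<theta>\<bar> \<le> 1"
  shows "norm (f (Complex x (\<theta> * h x))) \<le> exp (- x / 4)"
proof -
  let ?a = "logpow (Complex x (\<theta> * h x))"
  have x3: "x \<ge> 3" using X0(1) x by simp
  have I: "\<bar>Im ?a - pi * \<theta>\<bar> \<le> 1/5" by (rule logpow_bounds(1)[OF x \<theta>(2)])
  have pt: "\<bar>pi * \<theta>\<bar> = pi * \<bar>\<theta>\<bar>" by (simp add: abs_mult)
  have "pi * (3/4) \<le> pi * \<bar>\<theta>\<bar>" "pi * \<bar>\<theta>\<bar> \<le> pi * 1" using \<theta> by (intro mult_left_mono; simp)+
  then have b: "\<bar>\<bar>Im ?a\<bar> - pi\<bar> \<le> pi / 3" using I pt pi_gt3 by linarith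
  have "cos (pi/3) \<le> cos \<bar>\<bar>Im ?a\<bar> - pi\<bar>" using b pi_gt3 by (intro cos_monotone_0_pi_le) auto
  then have c: "cos (Im ?a) \<le> -1/2" by (simp add: cos_60 cos_diff)
  have "ln x \<le> ln x powr (1 + p)"
    using powr_mono[of 1 "1 + p" "ln x"] ln_ge_1[OF x3] p_pos by simp
  then have "Re ?a \<ge> ln x + (-1/5)" using logpow_bounds(2)[OF x \<theta>(2)] by simp
  then have "exp (Re ?a) \<ge> exp (ln x + (-1/5))" by simp
  also have "exp (ln x + (-1/5)) = x * exp (-1/5)" using x3 by (simp only: exp_add) simp
  finally have "exp (Re ?a) \<ge> x * exp (-1/5)" .
  moreover have "exp (-1/5::real) \<ge> 1/2" using exp_ge_add_one_self[of "-1/5::real"] by simp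
  moreover have "x * (1/2) \<le> x * exp (-1/5)" using x3 calculation(2) by (intro mult_left_mono) auto
  ultimately have e: "exp (Re ?a) \<ge> x / 2" by simp
  have "Re (\<Phi> (Complex x (\<theta> * h x))) = exp (Re ?a) * cos (Im ?a)"
    by (simp add: \<Phi>_def Re_exp)
  also have "\<dots> \<le> exp (Re ?a) * (-1/2)" using c by (intro mult_left_mono) auto
  also have "\<dots> \<le> - x / 4" using e by simp
  finally show ?thesis by (simp add: f_eq)
qed

lemma continuous_f_\<gamma>: "R \<ge> 3 \<Longrightarrow> continuous_on UNIV (\<lambda>t. f (\<gamma> \<theta> R t))"
  by (rule continuous_on_compose2[OF holomorphic_on_imp_continuous_on[OF f_holomorphic] continuous_on_\<gamma>])
     (auto simp: Re_\<gamma>)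

text \<open>The weight is an integrable majorant: compactness handles the middle part,
  \<open>norm_f_decay\<close> the ends. The 32 comes from
  \<open>(u/4)^2/2 \<le> exp (u/4)\<close>.\<close>

lemma f_\<gamma>_bound:
  assumes a: "adm \<theta> R"
  obtains K where "\<And>t. norm (f (\<gamma> \<theta> R t)) \<le> K * inverse (1 + t^2)"
proof -
  define T where "T = max X0 R"
  have "compact ((\<lambda>t. f (\<gamma> \<theta> R t) * of_real (1 + t^2)) ` {-T..T})"
    using adm[OF a]
    by (intro compact_continuous_image continuous_intros continuous_on_subset[OF continuous_f_\<gamma>]) auto
  then have "bounded ((\<lambda>t. f (\<gamma> \<theta> R t) * of_real (1 + t^2)) ` {-T..T})" by (rule compact_imp_bounded)
  then obtain K0 where K0': "\<forall>y\<in>(\<lambda>t. f (\<gamma> \<theta> R t) * of_real (1 + t^2)) ` {-T..T}. norm y \<le> K0"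
    unfolding bounded_iff by (elim exE)
  have K0: "norm (f (\<gamma> \<theta> R t) * of_real (1 + t^2)) \<le> K0" if "t \<in> {-T..T}" for t
    by (rule bspec[OF K0' imageI[OF that]])
  have "norm (f (\<gamma> \<theta> R t)) * (1 + t^2) \<le> max K0 32" for t
  proof (cases "t \<in> {-T..T}")
    case True
    have "norm (of_real (1 + t^2) :: complex) = 1 + t^2" by (simp only: norm_of_real) simp
    then show ?thesis using K0[OF True] unfolding norm_mult by simp
  next
    case False
    define u where "u = 2 + \<bar>t\<bar>"
    have t: "\<bar>t\<bar> \<ge> R - 2" "u \<ge> X0" "t \<noteq> 0" "u \<ge> 0" using False X0(1) adm[OF a] by (auto simp: T_def u_def)
    have "norm (f (\<gamma> \<theta> R t)) \<le> exp (- u / 4)"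
      using norm_f_decay[of u "sgn t * \<theta>"] t adm[OF a] \<gamma>_tail[of R t \<theta>]
      by (simp add: u_def abs_mult)
    moreover have "1 + t^2 \<le> 32 * exp (u / 4)"
    proof -
      have "1 + u/4 + (u/4)^2/2 \<le> exp (u/4)" using t by (intro exp_lower_Taylor_quadratic) auto
      then have "u^2 \<le> 32 * exp (u/4)" using t by (simp add: power2_eq_square field_simps)
      moreover have "1 + t^2 \<le> u^2" by (simp add: u_def power2_eq_square algebra_simps)
      ultimately show ?thesis by simp
    qed
    ultimately have "norm (f (\<gamma> \<theta> R t)) * (1 + t^2) \<le> exp (- u / 4) * (32 * exp (u / 4))"
      by (intro mult_mono) auto
    also have "\<dots> = 32 * exp (- u / 4 + u / 4)" by (simp only: exp_add)
    finally show ?thesis by simp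
  qed
  then have "norm (f (\<gamma> \<theta> R t)) \<le> max K0 32 * inverse (1 + t^2)" for t
    by (simp add: field_simps add_pos_nonneg)
  then show ?thesis by (rule that)
qed

lemma norm_d\<gamma>_le:
  assumes "adm \<theta> R"
  shows "norm (d\<gamma> \<theta> R t) \<le> 1 + pi + \<bar>\<theta> * h R / (R - 2)\<bar>"
proof (cases "\<bar>t\<bar> \<le> R - 2")
  case True
  then show ?thesis using cmod_le[of "d\<gamma> \<theta> R t"] pi_gt3 by (simp add: d\<gamma>_def)
next
  case False
  have "\<bar>\<theta> * dh (2 + \<bar>t\<bar>)\<bar> \<le> 1 * pi"
    unfolding abs_mult using False adm[OF assms] by (intro mult_mono abs_dh_le) auto
  moreover have "\<bar>sgn t\<bar> \<le> 1" by (simp add: sgn_real_def)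
  moreover have "norm (d\<gamma> \<theta> R t) \<le> \<bar>sgn t\<bar> + \<bar>\<theta> * dh (2 + \<bar>t\<bar>)\<bar>"
    using False cmod_le[of "d\<gamma> \<theta> R t"] by (simp add: d\<gamma>_def)
  ultimately show ?thesis using abs_ge_zero[of "\<theta> * h R / (R - 2)"] by linarith
qed

lemma integrable_inverse_1_plus_sq: "integrable lborel (\<lambda>t::real. inverse (1 + t^2))"
  using integrable_inverse_1_plus_square by (simp add: set_integrable_def)

lemma integrable_\<psi>:
  assumes a: "adm \<theta> R"
  shows "integrable lborel (\<psi> \<theta> R)"
proof -
  obtain K where K: "\<And>t. norm (f (\<gamma> \<theta> R t)) \<le> K * inverse (1 + t^2)" using f_\<gamma>_bound[OF a] by blast
  define B where "B = 1 + pi + \<bar>\<theta> * h R / (R - 2)\<bar>"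
  have "(\<lambda>t. f (\<gamma> \<theta> R t)) \<in> borel_measurable borel"
    using adm[OF a] by (intro borel_measurable_continuous_onI continuous_f_\<gamma>)
  moreover have "d\<gamma> \<theta> R \<in> borel_measurable borel"
    unfolding d\<gamma>_def Complex_eq dh_def by measurable
  ultimately have m: "\<psi> \<theta> R \<in> borel_measurable lborel"
    unfolding \<psi>_def by simp
  have le: "norm (\<psi> \<theta> R t) \<le> B * K * inverse (1 + t^2)" for t
  proof -
    have "norm (\<psi> \<theta> R t) \<le> (K * inverse (1 + t^2)) * B"
      unfolding \<psi>_def norm_mult B_def
      by (intro mult_mono K norm_d\<gamma>_le[OF a]) (auto intro: order_trans[OF norm_ge_zero K])
    then show ?thesis by (simp add: mult.commute mult.left_commute)
  qed
  show ?thesis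
    by (rule Bochner_Integration.integrable_bound[OF _ m, of "\<lambda>t. B * K * inverse (1 + t^2)"])
       (use integrable_inverse_1_plus_sq in \<open>auto intro!: order_trans[OF le]\<close>)
qed

lemma L1_curve: "adm \<theta> R \<Longrightarrow> L1_curve (\<psi> \<theta> R) (\<gamma> \<theta> R)"
  using integrable_\<psi> borel_measurable_continuous_onI[OF continuous_on_\<gamma>[OF adm(3)]]
  by unfold_locales auto

lemma J_transform: "adm \<theta> R \<Longrightarrow> J \<theta> R z = 1 / (2 * of_real pi * \<i>) * L1_curve.transform (\<psi> \<theta> R) (\<gamma> \<theta> R) z"
  by (simp add: J_def L1_curve.transform_def[OF L1_curve])

text \<open>The two parametrisations coincide. Their derivatives are compared away from the corners
  at -1 and 1, a null set.\<close>

lemma stallard_cauchy_eq_J: "stallard_cauchy p z = J 1 3 z"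
proof -
  have eq: "stallard_L p = \<gamma> 1 3"
  proof
    fix t show "stallard_L p t = \<gamma> 1 3 t"
      by (simp add: stallard_L_def \<gamma>_def Let_def max_def)
  qed
  have "(LINT t|lborel. stallard_f p (stallard_L p t) / (stallard_L p t - z) * vector_derivative (stallard_L p) (at t))
      = (LINT t|lborel. \<psi> 1 3 t * (1 / (\<gamma> 1 3 t - z)))"
  proof (rule integral_discrete_difference[of "{-1,1}"])
    fix t :: real assume "t \<notin> {-1,1}"
    then have "vector_derivative (\<gamma> 1 3) (at t) = d\<gamma> 1 3 t"
      by (intro vector_derivative_at has_vector_derivative_\<gamma>) auto
    then show "stallard_f p (stallard_L p t) / (stallard_L p t - z) * vector_derivative (stallard_L p) (at t) =
        \<psi> 1 3 t * (1 / (\<gamma> 1 3 t - z))" by (simp add: eq \<psi>_def)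
  qed auto
  then show ?thesis by (simp add: stallard_cauchy_def J_def)
qed

section \<open>Moving the contour\<close>

text \<open>Given a primitive \<open>P\<close> along the curve, the integral over
  \<open>{-N..N}\<close> is a difference of end values, and dominated convergence lets
  \<open>N\<close> grow. Comparing two contours becomes a question about their ends only.\<close>

lemma J_limit:
  assumes a: "adm \<theta> R" and d: "d > 0" "\<And>t. d \<le> norm (\<gamma> \<theta> R t - z)"
    and P: "\<And>t. (P has_field_derivative f (\<gamma> \<theta> R t) / (\<gamma> \<theta> R t - z)) (at (\<gamma> \<theta> R t))"
  shows "((\<lambda>N. P (\<gamma> \<theta> R N) - P (\<gamma> \<theta> R (-N))) \<longlongrightarrow> 2 * of_real pi * \<i> * J \<theta> R z) at_top"
proof -
  interpret L1_curve "\<psi> \<theta> R" "\<gamma> \<theta> R" by (rule L1_curve[OF a])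
  let ?F = "\<lambda>t. \<psi> \<theta> R t * (1 / (\<gamma> \<theta> R t - z))"
  have int: "integrable lborel ?F" by (rule integrable_transform[OF d])
  have cP: "continuous_on UNIV (\<lambda>t. P (\<gamma> \<theta> R t))"
    unfolding continuous_on_eq_continuous_at[OF open_UNIV]
  proof
    fix t
    have "isCont (\<gamma> \<theta> R) t"
      using continuous_on_\<gamma>[OF adm(3)[OF a], of \<theta>] by (simp add: continuous_on_eq_continuous_at)
    then show "isCont (\<lambda>t. P (\<gamma> \<theta> R t)) t" by (rule isCont_o2[where f = "\<gamma> \<theta> R" and g = P, OF _ DERIV_isCont[OF P]])
  qed
  have sub: "set_integrable lborel {-N..N} ?F" for N
    unfolding set_integrable_def by (rule integrable_mult_indicator[OF _ int]) simp
  have fin: "(LINT t:{-N..N}|lborel. ?F t) = P (\<gamma> \<theta> R N) - P (\<gamma> \<theta> R (-N))" if "N \<ge> 0" for N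
  proof -
    have "(?F has_integral P (\<gamma> \<theta> R N) - P (\<gamma> \<theta> R (-N))) {-N..N}"
    proof (rule fundamental_theorem_of_calculus_strong[of "{R-2,-(R-2)}"])
      fix t assume "t \<in> {-N..N} - {R-2,-(R-2)}"
      then have "\<bar>t\<bar> \<noteq> R - 2" by auto
      from field_vector_diff_chain_at[OF has_vector_derivative_\<gamma>[OF adm(3)[OF a] this] P]
      show "((\<lambda>t. P (\<gamma> \<theta> R t)) has_vector_derivative ?F t) (at t)"
        by (simp add: o_def \<psi>_def mult.commute mult.left_commute)
    qed (use that cP in \<open>auto intro: continuous_on_subset\<close>)
    then show ?thesis using set_borel_integral_eq_integral(2)[OF sub] integral_unique by metis
  qed
  have "((\<lambda>N. LINT t|lborel. indicator {-N..N} t *\<^sub>R ?F t) \<longlongrightarrow> (LINT t|lborel. ?F t)) at_top"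
  proof (rule integral_dominated_convergence_at_top)
    show "integrable lborel (\<lambda>t. norm (?F t))" using int by simp
    show "AE t in lborel. ((\<lambda>N. indicator {-N..N} t *\<^sub>R ?F t) \<longlongrightarrow> ?F t) at_top"
    proof (rule AE_I2)
      fix t
      have "eventually (\<lambda>N. indicator {-N..N} t *\<^sub>R ?F t = ?F t) at_top"
        using eventually_ge_at_top[of "\<bar>t\<bar>"] by eventually_elim (auto simp: indicator_def)
      then show "((\<lambda>N. indicator {-N..N} t *\<^sub>R ?F t) \<longlongrightarrow> ?F t) at_top"
        by (rule tendsto_eventually)
    qed
    show "\<forall>\<^sub>F N in at_top. AE t in lborel. norm (indicator {-N..N} t *\<^sub>R ?F t) \<le> norm (?F t)"
      by (intro always_eventually allI AE_I2) (auto simp: indicator_def)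
    show "?F \<in> borel_measurable lborel" using int by (rule borel_measurable_integrable)
    show "(\<lambda>t. indicator {-N..N} t *\<^sub>R ?F t) \<in> borel_measurable lborel" for N
      using sub[of N] unfolding set_integrable_def by (rule borel_measurable_integrable)
  qed
  then have "((\<lambda>N. LINT t:{-N..N}|lborel. ?F t) \<longlongrightarrow> 2 * of_real pi * \<i> * J \<theta> R z) at_top"
    by (simp add: set_lebesgue_integral_def J_def)
  moreover have "eventually (\<lambda>N. (LINT t:{-N..N}|lborel. ?F t) = P (\<gamma> \<theta> R N) - P (\<gamma> \<theta> R (-N))) at_top"
    using eventually_ge_at_top[of "0::real"] by eventually_elim (rule fin)
  ultimately show ?thesis by (rule Lim_transform_eventually)
qed

lemma h_le: "x \<ge> 3 \<Longrightarrow> h x \<le> pi * x"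
proof -
  assume x: "x \<ge> 3"
  have "1 powr p \<le> ln x powr p" using ln_ge_1[OF x] p_pos by (intro powr_mono2) auto
  then have "1 * 1 \<le> (1 + p) * ln x powr p" using p_pos by (intro mult_mono) auto
  then have "pi * x / ((1 + p) * ln x powr p) \<le> pi * x / 1"
    using x by (intro divide_left_mono) (auto intro!: mult_pos_pos)
  then show ?thesis by (simp add: stallard_height_def)
qed

text \<open>The two primitives may differ: \<open>E_inside\<close> uses two branches of a logarithm,
  and \<open>c\<close> collects their discrepancy at the ends.\<close>

lemma J_diff:
  assumes a: "adm \<theta>1 R1" "adm \<theta>2 R2" and d: "d > 0" "\<And>t. d \<le> norm (\<gamma> \<theta>1 R1 t - z)" "\<And>t. d \<le> norm (\<gamma> \<theta>2 R2 t - z)"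
    and P1: "\<And>t. (P1 has_field_derivative f (\<gamma> \<theta>1 R1 t) / (\<gamma> \<theta>1 R1 t - z)) (at (\<gamma> \<theta>1 R1 t))"
    and P2: "\<And>t. (P2 has_field_derivative f (\<gamma> \<theta>2 R2 t) / (\<gamma> \<theta>2 R2 t - z)) (at (\<gamma> \<theta>2 R2 t))"
    and c: "((\<lambda>N. (P1 (\<gamma> \<theta>1 R1 N) - P1 (\<gamma> \<theta>1 R1 (-N))) - (P2 (\<gamma> \<theta>2 R2 N) - P2 (\<gamma> \<theta>2 R2 (-N)))) \<longlongrightarrow> 2 * of_real pi * \<i> * c) at_top"
  shows "J \<theta>1 R1 z - J \<theta>2 R2 z = c"
proof -
  have "2 * of_real pi * \<i> * J \<theta>1 R1 z - 2 * of_real pi * \<i> * J \<theta>2 R2 z = 2 * of_real pi * \<i> * c"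
    by (rule tendsto_unique[OF trivial_limit_at_top_linorder
          tendsto_diff[OF J_limit[OF a(1) d(1,2) P1] J_limit[OF a(2) d(1,3) P2]] c])
  then have "2 * of_real pi * \<i> * (J \<theta>1 R1 z - J \<theta>2 R2 z - c) = 0" by (simp add: algebra_simps)
  then show ?thesis by simp
qed

text \<open>At parameter \<open>\<sigma> * N\<close> both contours meet the same vertical segment,
  at heights between \<open>3/4 * h x\<close> and \<open>h x\<close> in modulus. There the integrand
  is at most \<open>exp (- x / 4)\<close>, and the points are at most \<open>pi * x\<close> apart.
  The sign \<open>\<sigma>\<close> selects the end.\<close>

lemma primitive_end_diff:
  assumes a: "adm \<theta>1 R1" "adm \<theta>2 R2"
    and S: "{w. Re w > max 1 (Re z)} \<subseteq> S" and P: "\<And>w. w \<in> S \<Longrightarrow> (P has_field_derivative f w / (w - z)) (at w)"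
    and s: "\<sigma> = 1 \<or> \<sigma> = -1"
  shows "((\<lambda>N. P (\<gamma> \<theta>1 R1 (\<sigma> * N)) - P (\<gamma> \<theta>2 R2 (\<sigma> * N))) \<longlongrightarrow> 0) at_top"
proof (rule Lim_null_comparison)
  show "((\<lambda>N. exp (- (2 + N) / 4) * (pi * (2 + N))) \<longlongrightarrow> 0) at_top" by real_asymp
  show "\<forall>\<^sub>F N in at_top. norm (P (\<gamma> \<theta>1 R1 (\<sigma> * N)) - P (\<gamma> \<theta>2 R2 (\<sigma> * N))) \<le> exp (- (2 + N) / 4) * (pi * (2 + N))"
    using eventually_ge_at_top[of "max (max R1 R2) (max X0 (\<bar>Re z\<bar>))"]
  proof eventually_elim
    case (elim N)
    define x where "x = 2 + N"
    have N: "N \<ge> R1" "N \<ge> R2" "x \<ge> X0" "x > Re z + 1" "N > 0" "x \<ge> 3"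
      using elim X0(1) adm[OF a(1)] by (auto simp: x_def)
    have g: "\<gamma> \<theta> R (\<sigma> * N) = Complex x (\<sigma> * \<theta> * h x)" if "adm \<theta> R" "N \<ge> R" for \<theta> R
      using \<gamma>_tail[OF adm(3)[OF that(1)], of "\<sigma> * N" \<theta>] N that s adm[OF that(1)]
      by (auto simp: x_def abs_mult sgn_mult)
    define T where "T = closed_segment (Complex x (\<sigma> * (3/4) * h x)) (Complex x (\<sigma> * h x))"
    have T: "\<exists>u. w = Complex x (\<sigma> * u * h x) \<and> 3/4 \<le> u \<and> u \<le> 1" if wT: "w \<in> T" for w
    proof -
      obtain l where l: "0 \<le> l" "l \<le> 1" "w = (1 - l) *\<^sub>R Complex x (\<sigma> * (3/4) * h x) + l *\<^sub>R Complex x (\<sigma> * h x)"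
        using wT unfolding T_def closed_segment_def by blast
      then have "w = Complex x (\<sigma> * (3/4 + l/4) * h x)" by (simp add: complex_eq_iff algebra_simps)
      then show ?thesis using l by (intro exI[of _ "3/4 + l/4"]) auto
    qed
    have inT: "\<gamma> \<theta> R (\<sigma> * N) \<in> T" if "adm \<theta> R" "N \<ge> R" for \<theta> R
      unfolding g[OF that] T_def closed_segment_def using adm[OF that(1)]
      by (auto intro!: exI[of _ "4 * \<theta> - 3"] simp: complex_eq_iff field_simps)
    have bd: "norm (f w / (w - z)) \<le> exp (- x / 4)" if w: "w \<in> T" for w
    proof -
      obtain u where u: "w = Complex x (\<sigma> * u * h x)" "3/4 \<le> u" "u \<le> 1" using T[OF w] by blast
      have "norm (f w) \<le> exp (- x / 4)" unfolding u(1)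
        using s u N by (intro norm_f_decay) (auto simp: abs_mult)
      moreover have "norm (w - z) \<ge> 1" using abs_Re_le_cmod[of "w - z"] N u by simp
      ultimately have "norm (f w) / norm (w - z) \<le> exp (- x / 4) / 1" by (intro frac_le) auto
      then show ?thesis by (simp add: norm_divide)
    qed
    have inS: "w \<in> S" if "w \<in> T" for w using T[OF that] N S by auto
    have "norm (P (\<gamma> \<theta>1 R1 (\<sigma> * N)) - P (\<gamma> \<theta>2 R2 (\<sigma> * N))) \<le> exp (- x / 4) * norm (\<gamma> \<theta>1 R1 (\<sigma> * N) - \<gamma> \<theta>2 R2 (\<sigma> * N))"
      by (rule field_differentiable_bound[of T, OF _ has_field_derivative_at_within[OF P[OF inS]] bd])
         (use inT[OF a(1) N(1)] inT[OF a(2) N(2)] in \<open>auto simp: T_def\<close>)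
    also have "norm (\<gamma> \<theta>1 R1 (\<sigma> * N) - \<gamma> \<theta>2 R2 (\<sigma> * N)) \<le> pi * x"
    proof -
      have "\<gamma> \<theta>1 R1 (\<sigma> * N) - \<gamma> \<theta>2 R2 (\<sigma> * N) = Complex 0 (\<sigma> * (\<theta>1 - \<theta>2) * h x)"
        unfolding g[OF a(1) N(1)] g[OF a(2) N(2)] by (simp add: complex_eq_iff algebra_simps)
      then have "norm (\<gamma> \<theta>1 R1 (\<sigma> * N) - \<gamma> \<theta>2 R2 (\<sigma> * N)) = \<bar>\<theta>1 - \<theta>2\<bar> * h x"
        using s h_pos[OF N(6)] by (auto simp: cmod_def abs_mult)
      also have "\<dots> \<le> 1 * (pi * x)"
        using adm[OF a(1)] adm[OF a(2)] h_le[OF N(6)] h_pos[OF N(6)] by (intro mult_mono) auto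
      finally show ?thesis by simp
    qed
    finally show ?case by (simp add: x_def mult_left_mono)
  qed
qed

text \<open>\<open>Re (\<gamma> \<theta> R t)\<close> exceeds \<open>|t|\<close>, so the curve is
  proper and its range is closed.\<close>

lemma \<gamma>_dist_bound:
  assumes a: "adm \<theta> R" and z: "\<And>t. \<gamma> \<theta> R t \<noteq> z"
  obtains d where "d > 0" "\<And>t. d \<le> norm (\<gamma> \<theta> R t - z)"
proof -
  have "closed (range (\<gamma> \<theta> R))"
    unfolding closed_sequential_limits
  proof (intro allI impI, elim conjE)
    fix x l assume x: "\<forall>n. x n \<in> range (\<gamma> \<theta> R)" "x \<longlonglongrightarrow> l"
    have "\<forall>n. \<exists>t. x n = \<gamma> \<theta> R t" using x(1) by auto
    then obtain t where t: "\<forall>n. x n = \<gamma> \<theta> R (t n)" by (rule choice[THEN exE])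
    obtain B where B: "\<And>n. norm (x n) \<le> B"
      using convergent_imp_bounded[OF x(2)] by (auto simp: bounded_iff)
    have "\<bar>t n\<bar> \<le> B" for n
      using B[of n] complex_Re_le_cmod[of "x n"] by (simp add: t Re_\<gamma>)
    then have "t n \<in> {-B..B}" for n by (simp add: abs_le_iff minus_le_iff)
    then have xn: "\<forall>n. x n \<in> \<gamma> \<theta> R ` {-B..B}" using t by simp
    have "compact (\<gamma> \<theta> R ` {-B..B})"
      by (intro compact_continuous_image continuous_on_subset[OF continuous_on_\<gamma>[OF adm(3)[OF a]]]) auto
    then have "closed (\<gamma> \<theta> R ` {-B..B})" by (rule compact_imp_closed)
    then have "l \<in> \<gamma> \<theta> R ` {-B..B}" by (rule closed_sequentially[OF _ _ x(2)]) (use xn in blast)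
    then show "l \<in> range (\<gamma> \<theta> R)" by blast
  qed
  then obtain d where "d > 0" "\<forall>w\<in>range (\<gamma> \<theta> R). d \<le> dist z w"
    using separate_point_closed[of "range (\<gamma> \<theta> R)" z] z by blast
  then show ?thesis by (intro that[of d]) (auto simp: dist_norm norm_minus_commute)
qed

text \<open>A starlike region that contains both contours but not \<open>z\<close> supplies one
  primitive of the Cauchy integrand for both, so only the ends matter, and there the differences
  vanish in the limit.\<close>

lemma J_eq_starlike:
  assumes a: "adm \<theta>1 R1" "adm \<theta>2 R2"
    and S: "open S" "starlike S" "S \<subseteq> {w. Re w > 1}" "z \<notin> S" "{w. Re w > max 1 (Re z)} \<subseteq> S"
    and in1: "\<And>t. \<gamma> \<theta>1 R1 t \<in> S" and in2: "\<And>t. \<gamma> \<theta>2 R2 t \<in> S"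
  shows "J \<theta>1 R1 z = J \<theta>2 R2 z"
proof -
  have hol: "(\<lambda>w. f w / (w - z)) holomorphic_on S"
    using S by (intro holomorphic_intros holomorphic_on_subset[OF f_holomorphic]) auto
  obtain P where P: "\<And>w. w \<in> S \<Longrightarrow> (P has_field_derivative f w / (w - z)) (at w)"
    using holomorphic_starlike_primitive[OF holomorphic_on_imp_continuous_on[OF hol] S(2,1), of "{}"]
      holomorphic_on_imp_differentiable_at[OF hol S(1)] by blast
  have ne: "\<gamma> \<theta>1 R1 t \<noteq> z" "\<gamma> \<theta>2 R2 t \<noteq> z" for t using in1[of t] in2[of t] S(4) by auto
  obtain d1 where d1: "d1 > 0" "\<And>t. d1 \<le> norm (\<gamma> \<theta>1 R1 t - z)" using \<gamma>_dist_bound[OF a(1) ne(1)] by blast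
  obtain d2 where d2: "d2 > 0" "\<And>t. d2 \<le> norm (\<gamma> \<theta>2 R2 t - z)" using \<gamma>_dist_bound[OF a(2) ne(2)] by blast
  have "J \<theta>1 R1 z - J \<theta>2 R2 z = 0"
  proof (rule J_diff[OF a, of "min d1 d2" z P P])
    have "((\<lambda>N. (P (\<gamma> \<theta>1 R1 (1 * N)) - P (\<gamma> \<theta>2 R2 (1 * N))) - (P (\<gamma> \<theta>1 R1 (-1 * N)) - P (\<gamma> \<theta>2 R2 (-1 * N)))) \<longlongrightarrow> 0 - 0) at_top"
      by (intro tendsto_diff primitive_end_diff[OF a S(5) P]) auto
    then show "((\<lambda>N. P (\<gamma> \<theta>1 R1 N) - P (\<gamma> \<theta>1 R1 (- N)) - (P (\<gamma> \<theta>2 R2 N) - P (\<gamma> \<theta>2 R2 (- N)))) \<longlongrightarrow>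
        2 * complex_of_real pi * \<i> * 0) at_top"
      by (simp add: algebra_simps)
  qed (use d1 d2 P in1 in2 in \<open>auto intro: min.coboundedI1 min.coboundedI2\<close>)
  then show ?thesis by simp
qed

text \<open>The star centre is one unit from the tip \<open>z\<close>, on the prolongation of the
  slit. A segment from there meets the line \<open>Re w = Re z\<close> only at the centre, unless it
  runs along that line on the unslit side.\<close>

lemma slit_halfplane:
  fixes z :: complex
  assumes z: "Re z > 1" and s: "\<sigma> = 1 \<or> \<sigma> = (-1::real)"
  defines "S \<equiv> {w. Re w > 1} - {w. Re w = Re z \<and> \<sigma> * Im w \<ge> \<sigma> * Im z}"
  shows "open S" "starlike S"
proof -
  have "S = {w. Re w > 1} \<inter> - ({w. Re w = Re z} \<inter> {w. \<sigma> * Im w \<ge> \<sigma> * Im z})" by (auto simp: S_def)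
  moreover have "closed {w. Re w = Re z}" "closed {w. \<sigma> * Im w \<ge> \<sigma> * Im z}"
    by (intro closed_Collect_eq closed_Collect_le continuous_intros)+
  ultimately show "open S"
    by (simp only: open_Int open_halfspace_Re_gt closed_Int open_Compl)
  define c where "c = z - of_real \<sigma> * \<i>"
  have c: "Re c = Re z" "\<sigma> * Im c = \<sigma> * Im z - 1" using s by (auto simp: c_def algebra_simps)
  show "starlike S"
    unfolding starlike_def
  proof (intro bexI[of _ c] ballI subsetI)
    show "c \<in> S" using c z by (simp add: S_def)
    fix x w assume x: "x \<in> S" and "w \<in> closed_segment c x"
    then obtain u where u: "0 \<le> u" "u \<le> 1" "w = (1 - u) *\<^sub>R c + u *\<^sub>R x" by (auto simp: closed_segment_def)
    have "Re w = (1 - u) * Re c + u * Re x" unfolding u(3) by simp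
    then have Re: "Re w = Re z + u * (Re x - Re z)" unfolding c(1) by (simp add: algebra_simps)
    have Re1: "Re w > 1"
    proof -
      have "Re w = (1 - u) * Re z + u * Re x" using Re by (simp add: algebra_simps)
      moreover have "(1 - u) * 1 + u * 1 < (1 - u) * Re z + u * Re x"
      proof (cases "u = 0")
        case False
        then have "u * 1 < u * Re x" using u x by (intro mult_strict_left_mono) (auto simp: S_def)
        moreover have "(1 - u) * 1 \<le> (1 - u) * Re z" using u z by (intro mult_left_mono) auto
        ultimately show ?thesis by linarith
      qed (use z in simp)
      ultimately show ?thesis by simp
    qed
    have "\<sigma> * Im w < \<sigma> * Im z" if eq: "Re w = Re z"
    proof -
      have I: "\<sigma> * Im w = (1 - u) * (\<sigma> * Im z - 1) + u * (\<sigma> * Im x)"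
      proof -
        have I0: "Im w = (1 - u) * Im c + u * Im x" unfolding u(3) by simp
        show ?thesis unfolding c(2)[symmetric] I0 by (simp add: algebra_simps)
      qed
      have "u = 0 \<or> Re x = Re z" using Re eq by simp
      then show ?thesis
      proof
        assume "u = 0" then show ?thesis using I by simp
      next
        assume "Re x = Re z"
        then have x': "\<sigma> * Im x < \<sigma> * Im z" using x by (auto simp: S_def)
        show ?thesis
        proof (cases "u = 1")
          case True then show ?thesis unfolding I using x' by simp
        next
          case False
          then have "(1 - u) * (\<sigma> * Im z - 1) < (1 - u) * (\<sigma> * Im z)" using u by (intro mult_strict_left_mono) auto
          moreover have "u * (\<sigma> * Im x) \<le> u * (\<sigma> * Im z)" by (rule mult_left_mono[OF less_imp_le[OF x'] u(1)])
          ultimately have "\<sigma> * Im w < (1 - u) * (\<sigma> * Im z) + u * (\<sigma> * Im z)" using I by linarith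
          then show ?thesis by (simp add: algebra_simps)
        qed
      qed
    qed
    then show "w \<in> S" using Re1 by (auto simp: S_def)
  qed
qed

text \<open>The hypotheses put \<open>z\<close> outside both domains, so the vertical ray from
  \<open>z\<close> away from the real axis meets neither contour and can serve as slit. For
  \<open>Re z \<le> 1\<close> the half plane already avoids \<open>z\<close>.\<close>

lemma J_indep:
  assumes a: "adm \<theta>1 R1" "adm \<theta>2 R2"
    and o1: "Re z < R1 \<or> \<theta>1 * h (Re z) < \<bar>Im z\<bar>" and o2: "Re z < R2 \<or> \<theta>2 * h (Re z) < \<bar>Im z\<bar>"
  shows "J \<theta>1 R1 z = J \<theta>2 R2 z"
proof (cases "Re z > 1")
  case True
  define \<sigma> :: real where "\<sigma> = (if Im z \<ge> 0 then 1 else -1)"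
  have s: "\<sigma> = 1 \<or> \<sigma> = -1" "\<sigma> * Im z = \<bar>Im z\<bar>" by (auto simp: \<sigma>_def)
  have si: "\<sigma> * y \<le> \<bar>y\<bar>" for y by (auto simp: \<sigma>_def)
  define S where "S = {w. Re w > 1} - {w. Re w = Re z \<and> \<sigma> * Im w \<ge> \<sigma> * Im z}"
  have inS: "\<gamma> \<theta> R t \<in> S" if a: "adm \<theta> R" and o: "Re z < R \<or> \<theta> * h (Re z) < \<bar>Im z\<bar>" for \<theta> R t
  proof -
    have "Re (\<gamma> \<theta> R t) > 1" using Re_\<gamma>_ge[of R \<theta> t] adm[OF a] by linarith
    moreover have "\<sigma> * Im (\<gamma> \<theta> R t) < \<sigma> * Im z" if "Re (\<gamma> \<theta> R t) = Re z"
      using o si[of "Im (\<gamma> \<theta> R t)"] Im_\<gamma>_le[OF a, of t] Re_\<gamma>_ge[of R \<theta> t] that s by auto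
    ultimately show ?thesis by (auto simp: S_def)
  qed
  show ?thesis
  proof (rule J_eq_starlike[OF a, of S])
    show "open S" "starlike S" using slit_halfplane[OF True s(1)] by (auto simp: S_def)
  qed (use inS[OF a(1) o1] inS[OF a(2) o2] in \<open>auto simp: S_def\<close>)
next
  case False
  show ?thesis
  proof (rule J_eq_starlike[OF a, of "{w. Re w > 1}"])
    show "open {w. Re w > 1}" by (rule open_halfspace_Re_gt)
    show "starlike {w. Re w > 1}"
      by (intro convex_imp_starlike convex_halfspace_Re_gt) (auto intro: exI[of _ 2])
    show "\<gamma> \<theta>1 R1 t \<in> {w. Re w > 1}" "\<gamma> \<theta>2 R2 t \<in> {w. Re w > 1}" for t
      using Re_\<gamma>_ge[of R1 \<theta>1 t] Re_\<gamma>_ge[of R2 \<theta>2 t] adm[OF a(1)] adm[OF a(2)] by auto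
  qed (use False in auto)
qed

section \<open>The entire function and its decomposition\<close>

text \<open>With the vertical side of the contour to the right of \<open>z\<close>, the integral
  gives a value at every \<open>z\<close> at once. By \<open>J_indep\<close> a single
  \<open>J 1 R\<close> represents \<open>E\<close> on \<open>Re z < R\<close> for each
  \<open>R \<ge> 3\<close>, hence holomorphy.\<close>

definition E :: "complex \<Rightarrow> complex" where "E z = J 1 (max 3 (Re z + 1)) z"

lemma E_eq_J:
  assumes "adm \<theta> R" "Re z < R \<or> \<theta> * h (Re z) < \<bar>Im z\<bar>"
  shows "E z = J \<theta> R z"
  unfolding E_def using assms by (intro J_indep) (auto simp: adm_def)

lemma J_holomorphic_near:
  assumes a: "adm \<theta> R" and d: "d > 0" "\<And>t. d \<le> norm (\<gamma> \<theta> R t - z)"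
  shows "J \<theta> R field_differentiable (at z)"
proof -
  interpret L1_curve "\<psi> \<theta> R" "\<gamma> \<theta> R" by (rule L1_curve[OF a])
  have "(\<lambda>z. 1 / (2 * of_real pi * \<i>) * transform z) field_differentiable (at z)"
    using has_field_derivative_transform[OF d] field_differentiable_def
    by (intro field_differentiable_mult field_differentiable_const) blast+
  moreover have "J \<theta> R = (\<lambda>z. 1 / (2 * of_real pi * \<i>) * transform z)"
    using J_transform[OF a] by auto
  ultimately show ?thesis by simp
qed

lemma norm_\<gamma>_minus_ge: "R - Re z \<le> norm (\<gamma> \<theta> R t - z)"
  using Re_\<gamma>_ge[of R \<theta> t] complex_Re_le_cmod[of "\<gamma> \<theta> R t - z"] by simp

lemma E_holomorphic: "E holomorphic_on UNIV"
proof -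
  have "E field_differentiable (at z)" for z
  proof -
    define R where "R = max 3 (Re z + 2)"
    have a: "adm 1 R" by (simp add: adm_def R_def)
    have "J 1 R field_differentiable (at z)"
      by (rule J_holomorphic_near[OF a, of 2], simp, rule order_trans[OF _ norm_\<gamma>_minus_ge]) (simp add: R_def)
    then obtain D where D: "(J 1 R has_field_derivative D) (at z)" by (auto simp: field_differentiable_def)
    have "(E has_field_derivative D) (at z)"
    proof (rule has_field_derivative_transform_within_open[OF D])
      show "open {w. Re w < Re z + 2}" by (rule open_halfspace_Re_lt)
      fix w assume "w \<in> {w. Re w < Re z + 2}"
      then have "Re w < R" by (simp add: R_def)
      then show "J 1 R w = E w" using E_eq_J[OF a, of w] by simp
    qed auto
    then show ?thesis by (auto simp: field_differentiable_def)
  qed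
  then show ?thesis by (simp add: holomorphic_on_def)
qed

lemma E_eq_cauchy: "z \<notin> closure (stallard_G p) \<Longrightarrow> E z = stallard_cauchy p z"
  unfolding stallard_cauchy_eq_J closure_stallard_G[OF p_pos]
  by (intro E_eq_J) (auto simp: adm_def)

text \<open>Uniqueness comes from the identity theorem on \<open>Re w < 3\<close>, which lies
  outside the closure of \<open>stallard_G p\<close>.\<close>

lemma stallard_E_eq: "stallard_E p = E"
  unfolding stallard_E_def
proof (rule the_equality)
  show "E holomorphic_on UNIV \<and> (\<forall>z. z \<notin> closure (stallard_G p) \<longrightarrow> E z = stallard_cauchy p z)"
    using E_holomorphic E_eq_cauchy by blast
  fix E' assume E': "E' holomorphic_on UNIV \<and> (\<forall>z. z \<notin> closure (stallard_G p) \<longrightarrow> E' z = stallard_cauchy p z)"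
  show "E' = E"
  proof
    fix z
    show "E' z = E z"
    proof (rule analytic_continuation_open[of "{w. Re w < 3}" UNIV E' E z])
      show "{w. Re w < 3} \<noteq> {}" by (auto intro: exI[of _ 0])
      show "E' w = E w" if "w \<in> {w. Re w < 3}" for w
      proof -
        have "w \<notin> closure (stallard_G p)" using that by (auto simp: closure_stallard_G[OF p_pos])
        then show ?thesis using E' E_eq_cauchy by simp
      qed
    qed (use E' E_holomorphic open_halfspace_Re_lt in auto)
  qed
qed

text \<open>Moving the vertical side across \<open>w\<close> picks up the residue. The quotient
  \<open>F\<close> has no pole and has a primitive \<open>P\<close>; adding \<open>f w\<close> times
  a logarithm gives primitives of the Cauchy integrand. The cut points to the right of
  \<open>w\<close> for the contour \<open>\<gamma> 1 3\<close> and to the left for the moved one. At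
  the two ends the branches differ by \<open>\<i> * pi\<close> with opposite signs, in total
  \<open>2 * pi * \<i> * f w\<close>.\<close>

lemma E_inside:
  assumes w: "Re w > X0" "\<bar>Im w\<bar> < h (Re w)"
  shows "E w = f w + J 1 3 w"
proof -
  define R where "R = Re w + 1"
  have a: "adm 1 3" "adm 1 R" using w X0(1) by (auto simp: adm_def R_def)
  have w1: "Re w > 1" using w X0(1) by simp
  define S where "S = {w::complex. Re w > 1}"
  have S: "open S" "w \<in> S" using w1 by (auto simp: S_def open_halfspace_Re_gt)
  have fS: "f field_differentiable (at u)" if "u \<in> S" for u
    using has_field_derivative_f that by (auto simp: S_def field_differentiable_def)
  define F where "F u = (if u = w then deriv f w else (f u - f w) / (u - w))" for u
  have Fd: "F field_differentiable (at u)" if u: "u \<in> S" "u \<noteq> w" for u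
  proof -
    have "(\<lambda>u. (f u - f w) / (u - w)) field_differentiable (at u)"
      using u by (intro field_differentiable_divide field_differentiable_diff fS field_differentiable_const field_differentiable_ident) auto
    then obtain D where D: "((\<lambda>u. (f u - f w) / (u - w)) has_field_derivative D) (at u)" by (auto simp: field_differentiable_def)
    have "(F has_field_derivative D) (at u)"
      by (rule has_field_derivative_transform_within_open[OF D, of "-{w}"]) (use u in \<open>auto simp: F_def\<close>)
    then show ?thesis by (auto simp: field_differentiable_def)
  qed
  have "isCont F u" if u: "u \<in> S" for u
  proof (cases "u = w")
    case True
    have "(f has_field_derivative deriv f w) (at w)" using fS[OF S(2)] by (simp add: DERIV_deriv_iff_field_differentiable)
    then have "((\<lambda>u. (f u - f w) / (u - w)) \<longlongrightarrow> deriv f w) (at w)" by (simp add: has_field_derivative_iff)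
    then have "(F \<longlongrightarrow> deriv f w) (at w)"
      by (rule Lim_transform_eventually) (auto simp: F_def eventually_at_filter)
    then show ?thesis using True by (simp add: isCont_def F_def)
  qed (use Fd[OF u] field_differentiable_imp_continuous_at in auto)
  then have cF: "continuous_on S F" by (intro continuous_at_imp_continuous_on) auto
  have "starlike S" unfolding S_def
    by (intro convex_imp_starlike convex_halfspace_Re_gt) (auto intro: exI[of _ 2])
  then obtain P where P: "\<And>u. u \<in> S \<Longrightarrow> (P has_field_derivative F u) (at u)"
    using holomorphic_starlike_primitive[OF cF _ S(1), of "{w}"] Fd by blast
  define PA where "PA u = P u + f w * Ln (w - u)" for u
  define PB where "PB u = P u + f w * Ln (u - w)" for u
  have dA: "(PA has_field_derivative f u / (u - w)) (at u)" if u: "u \<in> S" "w - u \<notin> \<real>\<^sub>\<le>\<^sub>0" for u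
  proof -
    have ne: "u \<noteq> w" "w - u \<noteq> 0" "u - w \<noteq> 0" using u(2) by auto
    have "(PA has_field_derivative F u + f w * (inverse (w - u) * (0 - 1))) (at u)"
      unfolding PA_def
      by (intro DERIV_add P[OF u(1)] DERIV_cmult DERIV_chain2[where g = "\<lambda>u. w - u", OF has_field_derivative_Ln[OF u(2)]] DERIV_diff DERIV_const DERIV_ident)
    also have "F u + f w * (inverse (w - u) * (0 - 1)) = f u / (u - w)"
      using ne by (simp add: F_def divide_simps) (simp add: algebra_simps)
    finally show ?thesis .
  qed
  have dB: "(PB has_field_derivative f u / (u - w)) (at u)" if u: "u \<in> S" "u - w \<notin> \<real>\<^sub>\<le>\<^sub>0" for u
  proof -
    have ne: "u \<noteq> w" "u - w \<noteq> 0" using u(2) by auto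
    have "(PB has_field_derivative F u + f w * (inverse (u - w) * (1 - 0))) (at u)"
      unfolding PB_def
      by (intro DERIV_add P[OF u(1)] DERIV_cmult DERIV_chain2[where g = "\<lambda>u. u - w", OF has_field_derivative_Ln[OF u(2)]] DERIV_diff DERIV_const DERIV_ident)
    also have "F u + f w * (inverse (u - w) * (1 - 0)) = f u / (u - w)"
      using ne by (simp add: F_def divide_simps)
    finally show ?thesis .
  qed
  \<comment> \<open>Beyond \<open>X0\<close> the domain does not narrow to the right, so the
    horizontal ray from \<open>w\<close> to the right never reaches its boundary.\<close>
  have gA: "w - \<gamma> 1 3 t \<notin> \<real>\<^sub>\<le>\<^sub>0" for t
  proof
    assume "w - \<gamma> 1 3 t \<in> \<real>\<^sub>\<le>\<^sub>0"
    then have g: "Im (\<gamma> 1 3 t) = Im w" "Re (\<gamma> 1 3 t) \<ge> Re w" by (auto simp: complex_nonpos_Reals_iff)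
    then have "\<bar>Im (\<gamma> 1 3 t)\<bar> = 1 * h (Re (\<gamma> 1 3 t))" using X0(1) w by (intro Im_\<gamma>_eq a) auto
    moreover have "h (Re w) \<le> h (Re (\<gamma> 1 3 t))" using g w X0 by (intro h_mono) auto
    ultimately show False using g w by simp
  qed
  have gB: "\<gamma> 1 R t - w \<notin> \<real>\<^sub>\<le>\<^sub>0" for t
    using Re_\<gamma>_ge[of R 1 t] by (intro nonpos_Reals_Re_pos) (simp add: R_def)
  have gS: "\<gamma> 1 3 t \<in> S" "\<gamma> 1 R t \<in> S" for t
    using Re_\<gamma>_ge[of 3 1 t] Re_\<gamma>_ge[of R 1 t] w1 by (auto simp: S_def R_def)
  have "\<gamma> 1 3 t \<noteq> w" for t using gA[of t] by auto
  then obtain d where d: "d > 0" "\<And>t. d \<le> norm (\<gamma> 1 3 t - w)" using \<gamma>_dist_bound[OF a(1)] by blast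
  have d1: "1 \<le> norm (\<gamma> 1 R t - w)" for t using norm_\<gamma>_minus_ge[of R w 1 t] by (simp add: R_def)
  have "J 1 R w - J 1 3 w = f w"
  proof (rule J_diff[OF a(2,1), of "min 1 d" w PB PA])
    have "eventually (\<lambda>N. (PB (\<gamma> 1 R N) - PB (\<gamma> 1 R (-N))) - (PA (\<gamma> 1 3 N) - PA (\<gamma> 1 3 (-N))) = 2 * of_real pi * \<i> * f w) at_top"
      using eventually_ge_at_top[of "max R (X0 + Re w)"]
    proof eventually_elim
      case (elim N)
      define x where "x = 2 + N"
      have N: "N \<ge> R" "N > 0" "x \<ge> Re w" using elim w X0(1) by (auto simp: R_def x_def)
      have hx: "h x \<ge> h (Re w)" using w X0 N by (intro h_mono) auto
      define b where "b = Complex x (h x)"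
      define c where "c = Complex x (- h x)"
      have g: "\<gamma> 1 R N = b" "\<gamma> 1 3 N = b" "\<gamma> 1 R (-N) = c" "\<gamma> 1 3 (-N) = c"
        using N adm[OF a(2)] by (auto simp: \<gamma>_tail b_def c_def x_def)
      have I: "Im (b - w) > 0" "Im (c - w) < 0" using hx w by (auto simp: b_def c_def)
      have ne: "b - w \<noteq> 0" "c - w \<noteq> 0"
        using I by (metis less_irrefl zero_complex.simps(2))+
      have "Ln (- (b - w)) = Ln (b - w) - \<i> * of_real pi" using Ln_minus[OF ne(1)] I(1) by simp
      moreover have "Ln (- (c - w)) = Ln (c - w) + \<i> * of_real pi" using Ln_minus[OF ne(2)] I(2) by simp
      ultimately have L: "Ln (w - b) = Ln (b - w) - \<i> * of_real pi" "Ln (w - c) = Ln (c - w) + \<i> * of_real pi" by simp_all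
      show ?case unfolding g PA_def PB_def L by (simp add: algebra_simps)
    qed
    then show "((\<lambda>N. (PB (\<gamma> 1 R N) - PB (\<gamma> 1 R (-N))) - (PA (\<gamma> 1 3 N) - PA (\<gamma> 1 3 (-N)))) \<longlongrightarrow> 2 * of_real pi * \<i> * f w) at_top"
      by (rule tendsto_eventually)
  qed (use d d1 dA dB gA gB gS in \<open>auto intro: min.coboundedI1 min.coboundedI2\<close>)
  moreover have "E w = J 1 R w" by (rule E_eq_J[OF a(2)]) (simp add: R_def)
  ultimately show ?thesis by (simp add: algebra_simps)
qed

text \<open>The factor lies strictly between the 3/4 and the 1 of two admissible contours: points of
  the tract keep away from the one with \<open>\<theta> = 1\<close>, points above or below it from
  the one with \<open>\<theta> = 3/4\<close>.\<close>

definition tract :: "real \<Rightarrow> complex set" where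
  "tract R = {w. Re w > R \<and> \<bar>Im w\<bar> < 7/8 * h (Re w)}"

lemma E_structure:
  obtains M R where "M \<ge> 1" "R \<ge> X0 + 1"
    "\<And>w. w \<in> tract R \<Longrightarrow> E w = f w + J 1 3 w"
    "\<And>w. w \<in> tract R \<Longrightarrow> norm (J 1 3 w) \<le> M"
    "\<And>w w'. w \<in> tract R \<Longrightarrow> w' \<in> tract R \<Longrightarrow> norm (J 1 3 w - J 1 3 w') \<le> M * norm (w - w')"
    "\<And>w. w \<in> tract R \<Longrightarrow> J 1 3 field_differentiable (at w)"
    "\<And>w. w \<notin> tract R \<Longrightarrow> norm (E w) \<le> M"
proof -
  \<comment> \<open>At the same abscissa the heights differ by at least \<open>50 / 8\<close>. Over
    a horizontal distance below 1 the height \<open>h\<close> changes by less than 4, so a distance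
    of at least 1 to the contours remains.\<close>
  have "eventually (\<lambda>x. h x \<ge> 50) at_top"
    using h_at_top by (simp add: filterlim_at_top)
  then obtain R0 where R0: "\<And>x. x \<ge> R0 \<Longrightarrow> h x \<ge> 50" by (auto simp: eventually_at_top_linorder)
  define R where "R = max R0 (X0 + 1)"
  have R: "R \<ge> X0 + 1" "R \<ge> 4" "\<And>x. x \<ge> R \<Longrightarrow> h x \<ge> 50" using R0 X0(1) by (auto simp: R_def)
  have a: "adm 1 3" "adm (3/4) 3" "adm 1 (R + 1)" using R by (auto simp: adm_def)
  define m where "m \<theta> r = L1_curve.mass (\<psi> \<theta> r)" for \<theta> r
  have m0: "m \<theta> r \<ge> 0" if "adm \<theta> r" for \<theta> r
    using L1_curve.mass_nonneg[OF L1_curve[OF that]] by (simp add: m_def)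
  have c1: "norm (1 / (2 * of_real pi * \<i>) :: complex) \<le> 1" using pi_gt3 by (simp add: norm_divide norm_mult)
  have Jb: "norm (J \<theta> r z) \<le> m \<theta> r" if "adm \<theta> r" "\<And>t. 1 \<le> norm (\<gamma> \<theta> r t - z)" for \<theta> r z
  proof -
    have "norm (J \<theta> r z) \<le> 1 * (m \<theta> r / 1)"
      unfolding J_transform[OF that(1)] norm_mult m_def
      by (intro mult_mono c1 L1_curve.norm_transform_le[OF L1_curve[OF that(1)]]) (use that in auto)
    then show ?thesis by simp
  qed
  define M where "M = Max {1, m 1 3, m (3/4) 3, m 1 (R + 1)}"
  have M: "1 \<le> M" "m 1 3 \<le> M" "m (3/4) 3 \<le> M" "m 1 (R + 1) \<le> M"
    unfolding M_def by (intro Max_ge; simp)+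
  have in1: "1 \<le> norm (\<gamma> 1 3 t - w)" if w: "w \<in> tract R" for w t
  proof (rule ccontr)
    assume "\<not> ?thesis"
    then have n: "norm (\<gamma> 1 3 t - w) < 1" by simp
    then have n': "\<bar>Re (\<gamma> 1 3 t) - Re w\<bar> < 1" "\<bar>Im (\<gamma> 1 3 t) - Im w\<bar> < 1"
      using abs_Re_le_cmod[of "\<gamma> 1 3 t - w"] abs_Im_le_cmod[of "\<gamma> 1 3 t - w"] by auto
    have w': "Re w > R" "\<bar>Im w\<bar> < 7/8 * h (Re w)" using w by (auto simp: tract_def)
    have g3: "Re (\<gamma> 1 3 t) > 3" using n' w' R(2) by linarith
    then have "\<bar>Im (\<gamma> 1 3 t)\<bar> = h (Re (\<gamma> 1 3 t))" using Im_\<gamma>_eq[OF a(1)] by simp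
    moreover have "\<bar>h (Re (\<gamma> 1 3 t)) - h (Re w)\<bar> \<le> pi * \<bar>Re (\<gamma> 1 3 t) - Re w\<bar>"
      using g3 w' R by (intro h_lipschitz) auto
    moreover have "pi * \<bar>Re (\<gamma> 1 3 t) - Re w\<bar> \<le> 4 * 1" using n' pi_less_4 by (intro mult_mono) auto
    ultimately show False using n' w' R(3)[of "Re w"] by linarith
  qed
  have tr: "E w = f w + J 1 3 w" if w: "w \<in> tract R" for w
    using w R X0(1) h_pos[of "Re w"] by (intro E_inside) (auto simp: tract_def)
  have Jl: "norm (J 1 3 w - J 1 3 w') \<le> M * norm (w - w')" if w: "w \<in> tract R" "w' \<in> tract R" for w w'
  proof -
    have "norm (J 1 3 w - J 1 3 w') = norm (1 / (2 * of_real pi * \<i>) :: complex) *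
        norm (L1_curve.transform (\<psi> 1 3) (\<gamma> 1 3) w - L1_curve.transform (\<psi> 1 3) (\<gamma> 1 3) w')"
      unfolding J_transform[OF a(1)] by (simp only: norm_mult[symmetric] right_diff_distrib)
    also have "\<dots> \<le> 1 * (m 1 3 / (1 * 1) * norm (w - w'))"
      unfolding m_def
      by (intro mult_mono c1 L1_curve.transform_lipschitz[OF L1_curve[OF a(1)]] in1 w) auto
    also have "\<dots> \<le> M * norm (w - w')" using M by (simp add: mult_right_mono)
    finally show ?thesis .
  qed
  have out: "norm (E w) \<le> M" if w: "w \<notin> tract R" for w
  proof (cases "Re w \<le> R")
    case True
    have "E w = J 1 (R + 1) w" using True by (intro E_eq_J a) auto
    moreover have "norm (J 1 (R + 1) w) \<le> m 1 (R + 1)"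
      by (rule Jb[OF a(3)], rule order_trans[OF _ norm_\<gamma>_minus_ge]) (use True in simp)
    ultimately show ?thesis using M by simp
  next
    case False
    then have w': "Re w > R" "\<bar>Im w\<bar> \<ge> 7/8 * h (Re w)" using w by (auto simp: tract_def)
    have h50: "h (Re w) \<ge> 50" using R(3) w' by simp
    have "E w = J (3/4) 3 w" using w' h50 by (intro E_eq_J a disjI2) linarith
    moreover have "norm (J (3/4) 3 w) \<le> m (3/4) 3"
    proof (rule Jb[OF a(2)], rule ccontr)
      fix t assume "\<not> 1 \<le> norm (\<gamma> (3/4) 3 t - w)"
      then have n: "norm (\<gamma> (3/4) 3 t - w) < 1" by simp
      let ?g = "\<gamma> (3/4) 3 t"
      have n': "\<bar>Re ?g - Re w\<bar> < 1" "\<bar>Im ?g - Im w\<bar> < 1"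
        using n abs_Re_le_cmod[of "?g - w"] abs_Im_le_cmod[of "?g - w"] by auto
      have "\<bar>Im ?g\<bar> \<le> 3/4 * h (Re ?g)" by (rule Im_\<gamma>_le[OF a(2)])
      moreover have "\<bar>h (Re ?g) - h (Re w)\<bar> \<le> pi * \<bar>Re ?g - Re w\<bar>"
        using Re_\<gamma>_ge[of 3 "3/4" t] w' R by (intro h_lipschitz) auto
      moreover have "pi * \<bar>Re ?g - Re w\<bar> \<le> 4 * 1" using n' pi_less_4 by (intro mult_mono) auto
      ultimately show False using n' w' h50 by linarith
    qed
    ultimately show ?thesis using M by simp
  qed
  show ?thesis
    by (rule that[OF M(1) R(1) tr _ Jl _ out])
       (use Jb[OF a(1) in1] M J_holomorphic_near[OF a(1) zero_less_one in1] in \<open>auto intro: order_trans\<close>)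
qed

end

section \<open>Hyperbolic sets\<close>

lemma holomorphic_funpow:
  fixes g :: "complex \<Rightarrow> complex"
  assumes "g holomorphic_on UNIV"
  shows "(g ^^ n) holomorphic_on UNIV"
proof (induction n)
  case (Suc n)
  have "(g \<circ> (g ^^ n)) holomorphic_on UNIV"
    by (rule holomorphic_on_compose[OF Suc]) (use assms in \<open>auto intro: holomorphic_on_subset\<close>)
  then show ?case by (simp add: o_def)
qed (simp add: id_def)

lemma deriv_funpow_Suc:
  fixes g :: "complex \<Rightarrow> complex"
  assumes "g holomorphic_on UNIV"
  shows "deriv (g ^^ Suc n) z = deriv g ((g ^^ n) z) * deriv (g ^^ n) z"
proof -
  have d: "k field_differentiable at u" if "k holomorphic_on UNIV" for k :: "complex \<Rightarrow> complex" and u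
    using holomorphic_on_imp_differentiable_at[OF that] by simp
  show ?thesis
    unfolding funpow.simps by (rule deriv_chain[OF d[OF holomorphic_funpow[OF assms]] d[OF assms]])
qed

lemma norm_Ln_diff_le:
  assumes r: "r > 0" and z: "Re z \<ge> r" "Re w \<ge> r"
  shows "norm (Ln z - Ln w) \<le> norm (z - w) / r"
proof -
  have "norm (Ln z - Ln w) \<le> (1/r) * norm (z - w)"
  proof (rule field_differentiable_bound[where S = "{z. Re z \<ge> r}"])
    fix u assume "u \<in> {z. Re z \<ge> r}"
    then have u: "Re u \<ge> r" by simp
    have "u \<notin> \<real>\<^sub>\<le>\<^sub>0" using u r by (auto simp: complex_nonpos_Reals_iff)
    then show "(Ln has_field_derivative inverse u) (at u within {z. Re z \<ge> r})"
      by (rule has_field_derivative_at_within[OF has_field_derivative_Ln])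
    have "norm u \<ge> r" using u complex_Re_le_cmod[of u] by linarith
    then show "norm (inverse u) \<le> 1/r" using r by (simp add: norm_divide inverse_eq_divide frac_le)
  qed (use z convex_halfspace_Re_ge in auto)
  then show ?thesis by simp
qed

text \<open>Cauchy's estimate on circles of radius \<open>M\<close> gives
  \<open>norm (deriv g y) \<le> 1\<close> on the disc of radius \<open>M\<close>, and orbits
  starting in that disc stay there. So the derivatives of the iterates stay bounded by 1, against
  the growth of \<open>c * \<kappa> ^ n\<close>.\<close>

lemma hyperbolic_set_avoids_contraction:
  assumes X: "hyperbolic_set g X" and g: "g holomorphic_on UNIV" and z: "z \<in> X" "norm z \<le> M"
    and b: "\<And>y. norm y \<le> 2 * M \<Longrightarrow> norm (g y) \<le> M" and M: "M > 0"
  shows False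
proof -
  obtain c \<kappa> where c: "c > 0" "\<kappa> > 1" and ex: "\<And>n. n \<ge> 1 \<Longrightarrow> norm (deriv (g ^^ n) z) \<ge> c * \<kappa> ^ n"
    using X z(1) unfolding hyperbolic_set_def by blast
  have it: "norm ((g ^^ n) z) \<le> M" for n
    by (induction n) (use z b M in \<open>auto intro: order_trans\<close>)
  have d: "norm (deriv g y) \<le> 1" if y: "norm y \<le> M" for y
  proof -
    have "norm ((deriv ^^ 1) g y) \<le> fact 1 * M / M ^ 1"
    proof (rule Cauchy_inequality)
      show "g holomorphic_on ball y M" "continuous_on (cball y M) g"
        using g by (auto intro: holomorphic_on_subset holomorphic_on_imp_continuous_on continuous_on_subset)
      fix x assume "norm (y - x) = M"
      then have "norm x \<le> 2 * M" using norm_triangle_sub[of x y] y by (simp add: norm_minus_commute)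
      then show "norm (g x) \<le> M" by (rule b)
    qed (rule M)
    then show ?thesis using M by simp
  qed
  have le1: "norm (deriv (g ^^ n) z) \<le> 1" for n
  proof (induction n)
    case (Suc n)
    show ?case
      unfolding deriv_funpow_Suc[OF g] norm_mult using Suc d[OF it[of n]] by (intro mult_le_one) auto
  qed (simp add: id_def)
  obtain n where n: "1 / c < \<kappa> ^ n" using real_arch_pow[OF c(2)] by blast
  have "\<kappa> ^ n \<le> \<kappa> ^ Suc n" using c by (intro power_increasing) auto
  then have "1 / c < \<kappa> ^ Suc n" using n by linarith
  then have "1 < c * \<kappa> ^ Suc n" using c by (simp add: field_simps)
  also have "\<dots> \<le> norm (deriv (g ^^ Suc n) z)" by (rule ex) simp
  also have "\<dots> \<le> 1" by (rule le1)
  finally show False by simp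
qed

context stallard
begin

lemma E_shift_holomorphic: "(\<lambda>z. E (z - c)) holomorphic_on UNIV"
proof -
  have "(E \<circ> (\<lambda>z. z - c)) holomorphic_on UNIV"
    by (rule holomorphic_on_compose)
       (auto intro!: holomorphic_intros intro: holomorphic_on_subset[OF E_holomorphic])
  then show ?thesis by (simp add: o_def)
qed

section \<open>The upper bound on the dimension\<close>

text \<open>In the tract \<open>|Im (logpow w)|\<close> is at most \<open>7/8 * pi + 1/5\<close>,
  still below \<open>pi\<close>, so both branch conditions of \<open>\<Psi>_\<Phi>\<close>
  hold.\<close>

lemma \<Psi>_\<Phi>_tract:
  assumes w: "w \<in> tract R" and R: "R \<ge> X0"
  shows "\<Psi> (\<Phi> w) = w"
proof -
  have x: "Re w \<ge> X0" "Re w > 1" using w R X0(1) by (auto simp: tract_def)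
  have hp: "h (Re w) > 0" using x X0(1) by (intro h_pos) auto
  define \<theta> where "\<theta> = Im w / h (Re w)"
  have "\<bar>Im w\<bar> \<le> 7/8 * h (Re w)" using w by (simp add: tract_def)
  then have \<theta>: "\<bar>\<theta>\<bar> \<le> 7/8" using hp by (simp add: \<theta>_def field_simps)
  have wC: "Complex (Re w) (\<theta> * h (Re w)) = w" using hp by (simp add: \<theta>_def complex_eq_iff)
  have "\<bar>Im (logpow w) - pi * \<theta>\<bar> \<le> 1/5" using logpow_bounds(1)[OF x(1), of \<theta>] \<theta> wC by simp
  moreover have "\<bar>pi * \<theta>\<bar> \<le> pi * (7/8)" using \<theta> by (simp add: abs_mult)
  ultimately have "\<bar>Im (logpow w)\<bar> < pi" using pi_gt3 by linarith
  moreover have "(1 + p) * \<bar>Im (Ln (Ln w))\<bar> < pi" using X0(4)[OF x(1), of \<theta>] \<theta> wC by simp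
  ultimately show ?thesis using x(2) by (intro \<Psi>_\<Phi>)
qed

lemma norm_\<Psi>_diff_le:
  assumes "convex S" "\<And>v. v \<in> S \<Longrightarrow> Re v > 0 \<and> norm v \<ge> 3 \<and>
      norm (\<Psi> v * (of_real q * Ln v powr of_real (q - 1) / v)) \<le> B" "v \<in> S" "v' \<in> S"
  shows "norm (\<Psi> v - \<Psi> v') \<le> B * norm (v - v')"
  by (rule field_differentiable_bound[OF assms(1) has_field_derivative_at_within[OF has_field_derivative_\<Psi>]])
     (use assms in auto)

text \<open>The integer separating \<open>v\<close> from the principal logarithm is coded by
  \<open>int_decode\<close>, because \<open>hausdorff_dim_le_contracting\<close> indexes its pieces
  by \<open>nat\<close>.\<close>

lemma exists_branch:
  assumes "Re (exp v) > 0"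
  shows "\<exists>k::nat. v = Ln (exp v) + of_real (2 * pi * of_int (int_decode k)) * \<i>" "\<bar>Im (Ln (exp v))\<bar> < pi / 2"
proof -
  have "exp v = exp (Ln (exp v))" by simp
  then obtain n :: int where "v = Ln (exp v) + of_real (of_int (2 * n) * pi) * \<i>" using exp_eq[of v "Ln (exp v)"] by blast
  then show "\<exists>k::nat. v = Ln (exp v) + of_real (2 * pi * of_int (int_decode k)) * \<i>"
    by (intro exI[of _ "int_encode n"]) (simp add: mult.commute mult.left_commute)
  show "\<bar>Im (Ln (exp v))\<bar> < pi / 2" using assms by (subst Re_Ln_pos_lt) auto
qed

text \<open>With \<open>j = int_decode k\<close> the coding gives \<open>k \<le> 2 * |j|\<close>,
  while \<open>|Im v|\<close> is at least \<open>6 * |j| - 2\<close>; the bound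
  \<open>norm v \<ge> 3\<close> settles \<open>j = 0\<close>.\<close>

lemma band_norm_ge:
  assumes "\<bar>Im v - 2 * pi * of_int (int_decode k)\<bar> \<le> pi / 2" "norm v \<ge> 3"
  shows "norm v \<ge> (real k + 1) / 2"
proof -
  define j where "j = int_decode k"
  have kj: "real k \<le> 2 * \<bar>real_of_int j\<bar>"
  proof -
    have "k = int_encode j" by (simp add: j_def)
    then show ?thesis by (auto simp: int_encode_def sum_encode_def)
  qed
  have "2 * pi * \<bar>real_of_int j\<bar> - pi/2 \<le> \<bar>Im v\<bar>" using assms(1) unfolding j_def[symmetric]
    by (auto simp: abs_if split: if_splits)
  moreover have "6 * \<bar>real_of_int j\<bar> \<le> 2 * pi * \<bar>real_of_int j\<bar>" using pi_gt3 by (intro mult_right_mono) auto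
  ultimately have "6 * \<bar>real_of_int j\<bar> - 2 \<le> norm v" using abs_Im_le_cmod[of v] pi_less_4 by linarith
  then show ?thesis using kj assms(2) by (cases "j = 0") auto
qed

text \<open>The pieces are the branches of the logarithm. Between two points of piece
  \<open>k\<close>, \<open>\<Psi>\<close> contributes the factor \<open>b k\<close> and
  \<open>Ln\<close> the factor \<open>2 / l\<close>; absorbing the bounded part of \<open>E\<close>
  doubles the product, which gives \<open>c k\<close>.\<close>

lemma hausdorff_dim_hyperbolic_le:
  assumes s: "s > 1"
  shows "\<exists>L. \<forall>l\<ge>L. \<forall>X. hyperbolic_set (\<lambda>z. E (z - of_real l)) X \<longrightarrow> hausdorff_dim X \<le> ennreal s"
proof -
  obtain M R where M: "M \<ge> 1" and R: "R \<ge> X0 + 1"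
    and Ein: "\<And>w. w \<in> tract R \<Longrightarrow> E w = f w + J 1 3 w"
    and JM: "\<And>w. w \<in> tract R \<Longrightarrow> norm (J 1 3 w) \<le> M"
    and Jl: "\<And>w w'. w \<in> tract R \<Longrightarrow> w' \<in> tract R \<Longrightarrow> norm (J 1 3 w - J 1 3 w') \<le> M * norm (w - w')"
    and Eout: "\<And>w. w \<notin> tract R \<Longrightarrow> norm (E w) \<le> M"
    using E_structure by metis
  \<comment> \<open>This makes \<open>(\<epsilon> - 1) * s\<close> equal to
    \<open>- (s + 1) / 2\<close>, below -1 because \<open>s > 1\<close>, so the series of
    \<open>b k powr s\<close> converges.\<close>
  define \<epsilon> where "\<epsilon> = (s - 1) / (2 * s)"
  have \<epsilon>: "\<epsilon> > 0" "\<epsilon> < 1" "(\<epsilon> - 1) * s < -1" using s by (auto simp: \<epsilon>_def field_simps)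
  obtain V where V: "V \<ge> 3" and V': "\<And>v. Re v > 0 \<Longrightarrow> norm v \<ge> V \<Longrightarrow>
      norm (\<Psi> v * (of_real q * Ln v powr of_real (q - 1) / v)) \<le> norm v powr (\<epsilon> - 1)"
    using norm_deriv_\<Psi>_le[OF \<epsilon>(1)] by blast
  define b where "b k = ((real k + 1) / 2) powr (\<epsilon> - 1)" for k :: nat
  have b: "b k \<ge> 0" "b k \<le> 2" for k
  proof -
    have "b k \<le> (1/2) powr (\<epsilon> - 1)" unfolding b_def using \<epsilon> by (intro powr_mono2') auto
    also have "\<dots> \<le> (1/2) powr (-1)" using \<epsilon> by (intro powr_mono') auto
    finally show "b k \<le> 2" by (simp add: powr_minus)
  qed (simp add: b_def)
  have sumb: "summable (\<lambda>k. b k powr s)"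
  proof -
    have "summable (\<lambda>k. real (Suc k) powr ((\<epsilon> - 1) * s))"
      using \<epsilon> summable_real_powr_iff[of "(\<epsilon> - 1) * s"] summable_Suc_iff[of "\<lambda>k. real k powr ((\<epsilon> - 1) * s)"] by simp
    then have "summable (\<lambda>k. (1/2) powr ((\<epsilon> - 1) * s) * real (Suc k) powr ((\<epsilon> - 1) * s))" by (rule summable_mult)
    also have "(\<lambda>k. (1/2) powr ((\<epsilon> - 1) * s) * real (Suc k) powr ((\<epsilon> - 1) * s)) = (\<lambda>k. b k powr s)"
      by (simp add: b_def powr_powr fun_eq_iff powr_mult[symmetric] add.commute)
    finally show ?thesis .
  qed
  define \<Sigma> where "\<Sigma> = (\<Sum>k. b k powr s)"
  have \<Sigma>: "\<Sigma> \<ge> 0" unfolding \<Sigma>_def by (intro suminf_nonneg sumb) auto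
  \<comment> \<open>\<open>2 * exp V\<close> brings \<open>v\<close> into the range where
    \<open>\<Psi>'\<close> is controlled; \<open>16 * M\<close> absorbs the bounded part of
    \<open>E\<close> and gives \<open>l \<ge> 16\<close>, needed for \<open>c k \<le> 1/2\<close>;
    \<open>8 * \<Sigma>\<close> makes the sum of the \<open>c k powr s\<close> at most 1/2.\<close>
  define L where "L = max (max (2 * exp V) (16 * M)) (8 * \<Sigma>)"
  show ?thesis
  proof (intro exI[of _ L] allI impI)
    fix l X assume l: "l \<ge> L" and X: "hyperbolic_set (\<lambda>z. E (z - of_real l)) X"
    have l1: "l \<ge> 2 * exp V" "l \<ge> 16 * M" "l \<ge> 8 * \<Sigma>" "l \<ge> 16" using l M by (auto simp: L_def)
    define g where "g z = E (z - of_real l)" for z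
    have gX: "g ` X \<subseteq> X" "compact X" using X by (auto simp: hyperbolic_set_def g_def)
    have gh: "g holomorphic_on UNIV" unfolding g_def by (rule E_shift_holomorphic)
    \<comment> \<open>A point outside the translated tract lands in the disc of radius
      \<open>M\<close>. This disc, even doubled, is to the left of the translated tract, so it is
      mapped into itself, and \<open>hyperbolic_set_avoids_contraction\<close> applies.\<close>
    have tr: "z - of_real l \<in> tract R" if z: "z \<in> X" for z
    proof (rule ccontr)
      assume "z - of_real l \<notin> tract R"
      then have "norm (g z) \<le> M" using Eout by (simp add: g_def)
      moreover have "g z \<in> X" using gX z by blast
      moreover have "norm (g y) \<le> M" if "norm y \<le> 2 * M" for y
      proof -
        have "Re y \<le> 2 * M" using that complex_Re_le_cmod[of y] by linarith
        then have "y - of_real l \<notin> tract R" using l1 M R X0(1) by (auto simp: tract_def)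
        then show ?thesis using Eout by (simp add: g_def)
      qed
      ultimately show False
        using hyperbolic_set_avoids_contraction[of g X "g z" M] X gh M by (auto simp: g_def[abs_def])
    qed
    define v where "v z = \<Phi> (z - of_real l)" for z
    have ev: "exp (v z) = g z - J 1 3 (z - of_real l)" if "z \<in> X" for z
      using Ein[OF tr[OF that]] by (simp add: g_def v_def f_eq)
    \<comment> \<open>The image \<open>g z\<close> is again in \<open>X\<close>, hence to the right
      of \<open>l\<close>. Here the size of \<open>l\<close> enters the contraction.\<close>
    have Reev: "Re (exp (v z)) \<ge> l / 2" if z: "z \<in> X" for z
    proof -
      have "g z \<in> X" using gX z by blast
      then have "Re (g z) > l + R" using tr[of "g z"] by (auto simp: tract_def)
      moreover have "\<bar>Re (J 1 3 (z - of_real l))\<bar> \<le> M"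
        using JM[OF tr[OF z]] abs_Re_le_cmod order_trans by blast
      ultimately show ?thesis unfolding ev[OF z] using l1 R X0(1) M by simp
    qed
    have Rev: "Re (v z) \<ge> V" if z: "z \<in> X" for z
    proof -
      have "exp (Re (v z)) \<ge> l / 2"
        using Reev[OF z] complex_Re_le_cmod[of "exp (v z)"] by simp
      then have "exp V \<le> exp (Re (v z))" using l1 by linarith
      then show ?thesis by simp
    qed
    have \<Psi>v: "\<Psi> (v z) = z - of_real l" if "z \<in> X" for z
      unfolding v_def using R by (intro \<Psi>_\<Phi>_tract[OF tr[OF that]]) auto
    define Y where "Y k = {z. v z = Ln (exp (v z)) + of_real (2 * pi * of_int (int_decode k)) * \<i>}" for k
    have cov: "X \<subseteq> (\<Union>k. Y k)"
    proof
      fix z assume z: "z \<in> X"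
      have "Re (exp (v z)) > 0" using Reev[OF z] l1 by linarith
      then show "z \<in> (\<Union>k. Y k)" using exists_branch(1)[of "v z"] unfolding Y_def by blast
    qed
    define c where "c k = 4 / l * b k" for k
    have lip: "norm (x - y) \<le> c k * norm (g x - g y)" if x: "x \<in> X \<inter> Y k" and y: "y \<in> X \<inter> Y k" for k x y
    proof -
      have xX: "x \<in> X" "y \<in> X" using x y by auto
      define B where "B = {u. V \<le> Re u \<and> \<bar>Im u - 2 * pi * of_int (int_decode k)\<bar> \<le> pi / 2}"
      have "B = {u. Re u \<ge> V} \<inter> ({u. Im u \<le> pi/2 + 2 * pi * of_int (int_decode k)} \<inter> {u. Im u \<ge> 2 * pi * of_int (int_decode k) - pi/2})"
        by (rule set_eqI, simp only: B_def mem_Collect_eq Int_iff abs_le_iff, arith)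
      then have cB: "convex B" by (simp only: convex_Int convex_halfspace_Re_ge convex_halfspace_Im_ge convex_halfspace_Im_le)
      have inB: "v z \<in> B" if z: "z \<in> X" "z \<in> Y k" for z
      proof -
        have "Re (exp (v z)) > 0" using Reev[OF z(1)] l1 by linarith
        then have I: "\<bar>Im (Ln (exp (v z)))\<bar> < pi/2" by (rule exists_branch(2))
        have "v z = Ln (exp (v z)) + of_real (2 * pi * of_int (int_decode k)) * \<i>" using z by (simp add: Y_def)
        then have "Im (v z) = Im (Ln (exp (v z)) + of_real (2 * pi * of_int (int_decode k)) * \<i>)" by (rule arg_cong)
        then have "Im (v z) - 2 * pi * of_int (int_decode k) = Im (Ln (exp (v z)))" by simp
        then show ?thesis using Rev[OF z(1)] I by (simp add: B_def)
      qed
      have Bb: "Re u > 0 \<and> norm u \<ge> 3 \<and> norm (\<Psi> u * (of_real q * Ln u powr of_real (q - 1) / u)) \<le> b k" if u: "u \<in> B" for u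
      proof -
        have u': "Re u \<ge> V" "\<bar>Im u - 2 * pi * of_int (int_decode k)\<bar> \<le> pi / 2" using u by (auto simp: B_def)
        then have u3: "Re u > 0" "norm u \<ge> V" "norm u \<ge> 3" using V complex_Re_le_cmod[of u] by auto
        have "norm u powr (\<epsilon> - 1) \<le> b k"
          unfolding b_def using \<epsilon> band_norm_ge[OF u'(2) u3(3)] by (intro powr_mono2') auto
        then show ?thesis using V'[OF u3(1,2)] u3 by auto
      qed
      have "norm (x - y) = norm (\<Psi> (v x) - \<Psi> (v y))" using \<Psi>v xX by simp
      also have "\<dots> \<le> b k * norm (v x - v y)"
        using x y by (intro norm_\<Psi>_diff_le[OF cB Bb] inB) auto
      also have "v x - v y = Ln (exp (v x)) - Ln (exp (v y))" 
      proof -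
        have "v x = Ln (exp (v x)) + of_real (2 * pi * of_int (int_decode k)) * \<i>"
          "v y = Ln (exp (v y)) + of_real (2 * pi * of_int (int_decode k)) * \<i>" using x y by (auto simp: Y_def)
        then show ?thesis by (metis add_diff_cancel_right)
      qed
      also have "norm \<dots> \<le> norm (exp (v x) - exp (v y)) / (l / 2)"
        using l1 by (intro norm_Ln_diff_le Reev xX) auto
      also have "exp (v x) - exp (v y) = (g x - g y) - (J 1 3 (x - of_real l) - J 1 3 (y - of_real l))"
        using ev xX by simp
      also have "norm \<dots> \<le> norm (g x - g y) + M * norm (x - y)"
        using Jl[OF tr[OF xX(1)] tr[OF xX(2)]] norm_triangle_ineq4[of "g x - g y" "J 1 3 (x - of_real l) - J 1 3 (y - of_real l)"] by simp
      finally have 1: "norm (x - y) \<le> b k * ((norm (g x - g y) + M * norm (x - y)) / (l / 2))"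
        using b l1 by (auto simp: mult_left_mono divide_right_mono)
      \<comment> \<open>\<open>norm (x - y)\<close> occurs on both sides of the previous estimate.
        Its coefficient on the right is at most \<open>l / 4\<close>, half of the
        \<open>l / 2\<close> on the left.\<close>
      have "b k * (M * norm (x - y)) \<le> 2 * (M * norm (x - y))" using b M by (intro mult_right_mono) auto
      also have "\<dots> \<le> l / 4 * norm (x - y)" using mult_right_mono[OF l1(2), of "norm (x - y)"] M
        by (simp add: mult.assoc) (smt (verit) mult_nonneg_nonneg norm_ge_zero)
      finally have 2: "b k * (M * norm (x - y)) \<le> l / 4 * norm (x - y)" .
      have "l / 2 * norm (x - y) \<le> b k * norm (g x - g y) + b k * (M * norm (x - y))"
        using 1 l1 by (simp add: field_simps)
      then have "l / 4 * norm (x - y) \<le> b k * norm (g x - g y)" using 2 by (simp add: field_simps)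
      then show ?thesis using l1 by (simp add: c_def field_simps)
    qed
    have c: "0 \<le> c k" "c k \<le> 1/2" for k
    proof -
      show "0 \<le> c k" using b l1 by (simp add: c_def)
      have "4 / l * b k \<le> 4 / l * 2" using b l1 by (intro mult_left_mono) auto
      also have "\<dots> \<le> 1/2" using l1 by (simp add: field_simps)
      finally show "c k \<le> 1/2" by (simp add: c_def)
    qed
    have cs: "(\<lambda>k. c k powr s) = (\<lambda>k. (4 / l) powr s * b k powr s)"
    proof
      fix k show "c k powr s = (4 / l) powr s * b k powr s"
        unfolding c_def by (rule powr_mult)
    qed
    have sm: "summable (\<lambda>k. c k powr s)" unfolding cs by (rule summable_mult[OF sumb])
    have "(4 / l) powr s \<le> (4 / l) powr 1" using s l1 by (intro powr_mono') auto
    then have "(4 / l) powr s * \<Sigma> \<le> 4 / l * \<Sigma>" using \<Sigma> l1 by (intro mult_right_mono) auto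
    also have "\<dots> \<le> 1/2" using l1 by (simp add: field_simps)
    finally have sm2: "(\<Sum>k. c k powr s) \<le> 1/2" unfolding cs \<Sigma>_def by (subst suminf_mult[OF sumb])
    show "hausdorff_dim X \<le> ennreal s"
      using hausdorff_dim_le_contracting[OF compact_imp_bounded[OF gX(2)] _ gX(1) cov lip c sm sm2] s by simp
  qed
qed

section \<open>The lower bound on the dimension\<close>

lemma open_tract: "R \<ge> 3 \<Longrightarrow> open (tract R)"
proof -
  assume R: "R \<ge> 3"
  have "tract R = {z. R < Re z} \<inter> {z. \<bar>Im z\<bar> < 7/8 * h (max 3 (Re z))}"
    using R by (auto simp: tract_def max_def)
  moreover have "continuous_on UNIV (\<lambda>z. h (max 3 (Re z)))"
    by (rule continuous_on_compose2[OF continuous_stallard_height_max[OF p_pos]])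
       (auto intro!: continuous_intros)
  ultimately show ?thesis
    by (auto intro!: open_Int open_Collect_less continuous_intros)
qed

text \<open>The upper bound serves for the Lipschitz constant of the translated map, the lower one
  for its expansion. The 4 exceeds \<open>pi\<close>, which bounds \<open>|Im (Ln w)|\<close>; from
  below, \<open>(1 + p) * norm (Ln w) powr p\<close> is at least 1.\<close>

lemma norm_deriv_\<Phi>_bounds:
  assumes w: "Re w > 1" "norm w \<ge> 3" "norm w \<le> r"
  shows "norm (\<Phi> w * (of_real (1 + p) * Ln w powr of_real p / w))
      \<le> exp ((ln r + 4) powr (1 + p)) * ((1 + p) * (ln r + 4) powr p)"
    and "norm (\<Phi> w * (of_real (1 + p) * Ln w powr of_real p / w)) \<ge> norm (\<Phi> w) / r"
proof -
  have w0: "w \<noteq> 0" using w by auto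
  have "0 < norm w" "0 < r" using w w0 by auto
  then have l: "ln (norm w) \<ge> 1" "ln (norm w) \<le> ln r" using ln_ge_1[OF w(2)] w(3) ln_le_cancel_iff by blast+
  have "\<bar>Im (Ln w)\<bar> \<le> pi" using Im_Ln_le_pi[OF w0] mpi_less_Im_Ln[OF w0] by linarith
  then have n: "norm (Ln w) \<le> ln r + 4" "norm (Ln w) \<ge> 1"
    using cmod_le[of "Ln w"] l w0 complex_Re_le_cmod[of "Ln w"] pi_less_4 by auto
  have np: "norm (Ln w powr of_real p) = norm (Ln w) powr p"
    "norm (logpow w) = norm (Ln w) powr (1 + p)"
    unfolding logpow_def by (subst norm_powr_real_powr'; simp)+
  have "norm (\<Phi> w) \<le> exp (norm (logpow w))" unfolding \<Phi>_def by (rule norm_exp)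
  also have "norm (logpow w) \<le> (ln r + 4) powr (1 + p)"
    unfolding np using n p_pos by (intro powr_mono2) auto
  finally have 1: "norm (\<Phi> w) \<le> exp ((ln r + 4) powr (1 + p))" by simp
  have 2: "norm (Ln w) powr p \<le> (ln r + 4) powr p" using n p_pos by (intro powr_mono2) auto
  have "norm (of_real (1 + p) * Ln w powr of_real p / w) = (1 + p) * norm (Ln w) powr p / norm w"
    using p_pos by (simp add: norm_divide norm_mult np(1) del: of_real_add)
  also have "\<dots> \<le> (1 + p) * (ln r + 4) powr p / 1"
    using 2 p_pos w by (intro frac_le mult_left_mono) auto
  finally have 3: "norm (of_real (1 + p) * Ln w powr of_real p / w) \<le> (1 + p) * (ln r + 4) powr p" by simp
  show "norm (\<Phi> w * (of_real (1 + p) * Ln w powr of_real p / w))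
      \<le> exp ((ln r + 4) powr (1 + p)) * ((1 + p) * (ln r + 4) powr p)"
    unfolding norm_mult[of "\<Phi> w"] by (intro mult_mono 1 3) auto
  have "1 powr p \<le> norm (Ln w) powr p" using n p_pos by (intro powr_mono2) auto
  then have "1 * 1 \<le> (1 + p) * norm (Ln w) powr p" using p_pos by (intro mult_mono) auto
  then have "1 / r \<le> (1 + p) * norm (Ln w) powr p / norm w"
    using w w0 by (intro frac_le) auto
  also have "\<dots> = norm (of_real (1 + p) * Ln w powr of_real p / w)"
    using p_pos by (simp add: norm_divide norm_mult np(1) del: of_real_add)
  finally have "norm (\<Phi> w) * (1 / r) \<le> norm (\<Phi> w) * norm (of_real (1 + p) * Ln w powr of_real p / w)"
    by (intro mult_left_mono) auto
  then show "norm (\<Phi> w * (of_real (1 + p) * Ln w powr of_real p / w)) \<ge> norm (\<Phi> w) / r"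
    unfolding norm_mult[of "\<Phi> w"] by simp
qed

lemma norm_exp_minus_1_le: "norm z \<le> 1/4 \<Longrightarrow> norm (exp z - 1 :: complex) \<le> 1/2"
proof -
  assume z: "norm z \<le> 1/4"
  have "norm (exp z - exp 0) \<le> 2 * norm (z - 0)"
  proof (rule field_differentiable_bound[where S = "cball 0 (1/4)"])
    fix u :: complex assume u: "u \<in> cball 0 (1/4)"
    show "(exp has_field_derivative exp u) (at u within cball 0 (1/4))"
      by (rule has_field_derivative_at_within[OF DERIV_exp])
    have "norm (exp u) \<le> exp (norm u)" by (rule norm_exp)
    also have "exp (norm u) \<le> exp (1/4)" using u by simp
    also have "exp (1/4) \<le> (2::real)" using exp_bound[of "1/4::real"] by (simp add: power2_eq_square)
    finally show "norm (exp u) \<le> 2" .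
  qed (use z in auto)
  then show ?thesis using z by simp
qed

text \<open>\<open>Ln v\<close> is within 6 of \<open>ln N\<close>: at most 4 from
  \<open>ln 16\<close>, at most 2 from the argument. The powers \<open>q\<close> then differ by at
  most 1/4, a relative change of at most 1/2 after \<open>exp\<close>. So all branches used later
  land in one disc.\<close>

lemma \<Psi>_near:
  assumes N: "N > 0" and s: "ln N \<ge> 1" "q * ln N powr (q - 1) * 6 \<le> 1/4" and v: "Re v > 0" "N \<le> norm v" "norm v \<le> 16 * N"
  shows "norm (\<Psi> v - of_real (exp (ln N powr q))) \<le> exp (ln N powr q) / 2"
proof -
  have v0: "v \<noteq> 0" using v by auto
  have R: "Re (Ln v) \<ge> ln N" "Re (Ln v) \<le> ln 16 + ln N"
    using v v0 N by (auto simp flip: ln_mult_pos)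
  have "ln (16::real) = 4 * ln 2" using ln_realpow[of 2 4] by simp
  then have "ln (16::real) \<le> 4" using ln_2_less_1 by linarith
  moreover have "\<bar>Im (Ln v)\<bar> \<le> 2"
    using v(1) v0 Re_Ln_pos_lt[OF v0] pi_less_4 by linarith
  ultimately have d: "norm (Ln v - of_real (ln N)) \<le> 6" using cmod_le[of "Ln v - of_real (ln N)"] R by simp
  have "norm (Ln v powr of_real q - of_real (ln N) powr of_real q) \<le> q * ln N powr (q - 1) * norm (Ln v - of_real (ln N))"
    using s R by (intro powr_q_diff_le) auto
  also have "\<dots> \<le> q * ln N powr (q - 1) * 6" using d q by (intro mult_left_mono) auto
  also note s(2)
  finally have n: "norm (Ln v powr of_real q - of_real (ln N powr q)) \<le> 1/4"
    using powr_q_real[OF s(1)] by simp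
  let ?Q = "exp (ln N powr q)"
  have "\<Psi> v = of_real ?Q * exp (Ln v powr of_real q - of_real (ln N powr q))"
    unfolding \<Psi>_def by (simp only: exp_of_real[symmetric] exp_add[symmetric]) simp
  then have "\<Psi> v - of_real ?Q = of_real ?Q * (exp (Ln v powr of_real q - of_real (ln N powr q)) - 1)"
    by (simp add: algebra_simps)
  then have "norm (\<Psi> v - of_real ?Q) = ?Q * norm (exp (Ln v powr of_real q - of_real (ln N powr q)) - 1)"
    by (simp add: norm_mult)
  also have "\<dots> \<le> ?Q * (1/2)" by (intro mult_left_mono norm_exp_minus_1_le n) auto
  finally show ?thesis by simp
qed

text \<open>For \<open>\<Lambda> = ln N powr q\<close> the right side is \<open>N powr r\<close>,
  and the left side will bound the Lipschitz constant of the map on each piece. The shift by 5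
  enlarges the leading exponent by a factor \<open>1 + r'\<close> at most; everything else fits into
  another \<open>r'\<close>.\<close>

lemma lower_bound_asymptotics:
  assumes "r > 1" "a > 0" "M > 0"
  shows "eventually (\<lambda>\<Lambda>::real. (a + 2 * exp \<Lambda>) * (exp ((\<Lambda> + 5) powr (1 + p)) * ((1 + p) * (\<Lambda> + 5) powr p)) + M
    \<le> exp (r * \<Lambda> powr (1 + p))) at_top"
proof -
  define r' where "r' = (r - 1) / 2"
  have r': "r' > 0" "r = 1 + 2 * r'" using assms by (auto simp: r'_def field_simps)
  have "eventually (\<lambda>\<Lambda>::real. (\<Lambda> + 5) powr (1 + p) \<le> (1 + r') * \<Lambda> powr (1 + p)) at_top"
  proof -
    have "((\<lambda>\<Lambda>::real. ((\<Lambda> + 5) / \<Lambda>) powr (1 + p)) \<longlongrightarrow> 1) at_top"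
    proof -
      have "((\<lambda>\<Lambda>::real. (\<Lambda> + 5) / \<Lambda>) \<longlongrightarrow> 1) at_top" by real_asymp
      then have "((\<lambda>\<Lambda>::real. ((\<Lambda> + 5) / \<Lambda>) powr (1 + p)) \<longlongrightarrow> 1 powr (1 + p)) at_top"
        by (intro tendsto_powr tendsto_const) auto
      then show ?thesis by simp
    qed
    then have "eventually (\<lambda>\<Lambda>::real. ((\<Lambda> + 5) / \<Lambda>) powr (1 + p) < 1 + r') at_top"
      using r' by (intro order_tendstoD) auto
    then show ?thesis using eventually_gt_at_top[of "0::real"]
    proof eventually_elim
      case (elim x)
      then show ?case by (simp add: powr_divide field_simps)
    qed
  qed
  moreover have "eventually (\<lambda>\<Lambda>::real. (a + 2 * exp \<Lambda>) * ((1 + p) * (\<Lambda> + 5) powr p) + M \<le> exp (r' * \<Lambda> powr (1 + p))) at_top"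
    using assms p_pos r' by real_asymp
  ultimately show ?thesis
  proof eventually_elim
    case (elim x)
    let ?A = "(a + 2 * exp x) * ((1 + p) * (x + 5) powr p)" and ?B = "exp ((1 + r') * x powr (1 + p))"
    have A: "?A \<ge> 0" using assms p_pos by simp
    have B: "?B \<ge> 1" using r' by simp
    have "exp ((x + 5) powr (1 + p)) \<le> ?B" using elim(1) by simp
    then have "?A * exp ((x + 5) powr (1 + p)) \<le> ?A * ?B" using A by (rule mult_left_mono)
    moreover have "M * 1 \<le> M * ?B" using assms B by (intro mult_left_mono) auto
    moreover have "(?A + M) * ?B \<le> exp (r' * x powr (1 + p)) * ?B" using elim(2) by (intro mult_right_mono) auto
    moreover have "exp (r' * x powr (1 + p)) * ?B = exp (r * x powr (1 + p))"
      by (simp add: r'(2) algebra_simps flip: exp_add)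
    ultimately show ?case by (simp add: algebra_simps)
  qed
qed

text \<open>\<open>l\<close> is arbitrary and only \<open>N\<close> is taken large. The disc
  \<open>K\<close> contains all the pieces \<open>Y k\<close>, and each of them covers
  \<open>K\<close>, so \<open>expanding_full_shift_dim\<close> applies with \<open>n\<close>
  symbols.\<close>

lemma hausdorff_dim_hyperbolic_ge:
  assumes t: "0 < t" "t < 1" and l: "l \<ge> 0"
  shows "\<exists>X. hyperbolic_set (\<lambda>z. E (z - of_real l)) X \<and> ennreal t \<le> hausdorff_dim X"
proof -
  obtain M R where M: "M \<ge> 1" and R: "R \<ge> X0 + 1"
    and Ein: "\<And>w. w \<in> tract R \<Longrightarrow> E w = f w + J 1 3 w"
    and JM: "\<And>w. w \<in> tract R \<Longrightarrow> norm (J 1 3 w) \<le> M"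
    and Jl: "\<And>w w'. w \<in> tract R \<Longrightarrow> w' \<in> tract R \<Longrightarrow> norm (J 1 3 w - J 1 3 w') \<le> M * norm (w - w')"
    and Jd: "\<And>w. w \<in> tract R \<Longrightarrow> J 1 3 field_differentiable (at w)"
    using E_structure by metis
  obtain V1 where V1: "\<And>v. Re v > 0 \<Longrightarrow> norm v \<ge> V1 \<Longrightarrow>
      norm (\<Psi> v * (of_real q * Ln v powr of_real (q - 1) / v)) \<le> norm v powr (1/2 - 1)"
    using norm_deriv_\<Psi>_le[of "1/2"] by auto
  obtain V2 where V2: "\<And>v. Re v > 0 \<Longrightarrow> norm v \<ge> V2 \<Longrightarrow> Re (\<Psi> v) \<ge> R + 1 \<and> \<bar>Im (\<Psi> v)\<bar> < 3/4 * h (Re (\<Psi> v))"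
    using \<Psi>_region[of "R + 1"] by blast
  have "eventually (\<lambda>x::real. x \<ge> max 3 (max V1 V2)) at_top" by (rule eventually_ge_at_top)
  moreover have "eventually (\<lambda>x::real. q * ln x powr (q - 1) * 6 \<le> 1/4) at_top" using q by real_asymp
  \<comment> \<open>With \<open>Q\<close> for the exponential this leaves
    \<open>Q / 2 - M \<ge> 3\<close>: after removal of the bounded part, points of \<open>K\<close>
    have real part at least 3, where \<open>Ln\<close> contracts by 1/3.\<close>
  moreover have "eventually (\<lambda>x::real. exp (ln x powr q) \<ge> 2 * M + 6) at_top" using q by real_asymp
  \<comment> \<open>This keeps the logarithms of the values over \<open>K\<close> left of
    \<open>Re v = N\<close>, the right edge of the rectangles \<open>S k\<close>.\<close>
  moreover have "eventually (\<lambda>x::real. l + 2 * exp (ln x powr q) + M \<le> exp x) at_top"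
  proof -
    have "eventually (\<lambda>x::real. l + 2 * x + M \<le> exp x) at_top" by real_asymp
    then show ?thesis using eventually_ge_at_top[of "3::real"]
    proof eventually_elim
      case (elim x)
      have "exp (ln x powr q) \<le> exp (ln x powr 1)"
        using ln_ge_1[OF elim(2)] q by (intro iffD2[OF exp_le_cancel_iff] powr_mono) auto
      also have "\<dots> = x" using elim ln_ge_1[OF elim(2)] by simp
      finally show ?case using elim by linarith
    qed
  qed
  moreover have "eventually (\<lambda>x::real. M * x powr (-1/2) \<le> 1) at_top" by real_asymp
  moreover have "eventually (\<lambda>x::real. (l + M + 1 + 2 * exp (ln x powr q)) *
      (exp ((ln x powr q + 5) powr (1 + p)) * ((1 + p) * (ln x powr q + 5) powr p)) + M
      \<le> exp (1/t * (ln x powr q) powr (1 + p))) at_top"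
  proof -
    have "filterlim (\<lambda>x::real. ln x powr q) at_top at_top" using q by real_asymp
    then show ?thesis
      using t l M by (intro eventually_compose_filterlim[OF lower_bound_asymptotics]) auto
  qed
  moreover have "eventually (\<lambda>x::real. (M + 2) * (2 * exp (ln x powr q)) \<le> x) at_top"
    using q M by real_asymp
  ultimately have "eventually (\<lambda>x::real. x \<ge> max 3 (max V1 V2) \<and> q * ln x powr (q - 1) * 6 \<le> 1/4 \<and>
    exp (ln x powr q) \<ge> 2 * M + 6 \<and> l + 2 * exp (ln x powr q) + M \<le> exp x \<and> M * x powr (-1/2) \<le> 1 \<and>
    (l + M + 1 + 2 * exp (ln x powr q)) *
      (exp ((ln x powr q + 5) powr (1 + p)) * ((1 + p) * (ln x powr q + 5) powr p)) + M
      \<le> exp (1/t * (ln x powr q) powr (1 + p)) \<and> (M + 2) * (2 * exp (ln x powr q)) \<le> x) at_top"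
    by eventually_elim blast
  then obtain x0 where x0: "\<And>x::real. x \<ge> x0 \<Longrightarrow> x \<ge> max 3 (max V1 V2) \<and> q * ln x powr (q - 1) * 6 \<le> 1/4 \<and>
    exp (ln x powr q) \<ge> 2 * M + 6 \<and> l + 2 * exp (ln x powr q) + M \<le> exp x \<and> M * x powr (-1/2) \<le> 1 \<and>
    (l + M + 1 + 2 * exp (ln x powr q)) *
      (exp ((ln x powr q + 5) powr (1 + p)) * ((1 + p) * (ln x powr q + 5) powr p)) + M
      \<le> exp (1/t * (ln x powr q) powr (1 + p)) \<and> (M + 2) * (2 * exp (ln x powr q)) \<le> x"
    unfolding eventually_at_top_linorder by blast
  obtain n :: nat where n: "real n \<ge> x0" using real_arch_simple by blast
  define N where "N = real n"
  define \<Lambda> where "\<Lambda> = ln N powr q"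
  define Q where "Q = exp \<Lambda>"
  define B where "B = (l + M + 1 + 2 * Q) * (exp ((\<Lambda> + 5) powr (1 + p)) * ((1 + p) * (\<Lambda> + 5) powr p)) + M"
  have N: "N \<ge> 3" "N \<ge> V1" "N \<ge> V2" "q * ln N powr (q - 1) * 6 \<le> 1/4" "Q \<ge> 2 * M + 6"
    "l + 2 * Q + M \<le> exp N" "M * N powr (-1/2) \<le> 1" "B \<le> exp (1/t * \<Lambda> powr (1 + p))" "(M + 2) * (2 * Q) \<le> N"
    using x0[of N] n by (auto simp: N_def Q_def \<Lambda>_def B_def)
  have lnN: "ln N \<ge> 1" by (rule ln_ge_1[OF N(1)])
  have \<Lambda>N: "\<Lambda> powr (1 + p) = ln N" using lnN q by (simp add: \<Lambda>_def powr_powr)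
  have \<Lambda>0: "\<Lambda> \<ge> 0" by (simp add: \<Lambda>_def)
  have Q0: "Q \<ge> 8" using N M by linarith
  define g where "g z = E (z - of_real l)" for z
  define K where "K = cball (of_real (Q + l) :: complex) (Q / 2)"
  \<comment> \<open>The rectangle has room for the \<open>k\<close>-th logarithm of every point
    needed: for real part at least 3 and modulus at most \<open>exp N\<close>, the principal
    logarithm has real part between 1 and \<open>N\<close> and imaginary part below
    \<open>pi / 2 < 2\<close> in modulus.\<close>
  define S where "S k = {v. 1 \<le> Re v \<and> Re v \<le> N \<and> \<bar>Im v - 2 * pi * real k\<bar> \<le> 2}" for k :: nat
  \<comment> \<open>There are \<open>n\<close> branches, all at heights comparable to
    \<open>N\<close>, so that \<open>norm v\<close> stays between \<open>N\<close> and
    \<open>16 * N\<close> and \<open>\<Psi>_near\<close> applies.\<close>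
  define I where "I = {n..<2 * n}"
  have Sb: "Re v > 0" "N \<le> norm v" "norm v \<le> 16 * N" "norm v \<ge> 3" if k: "k \<in> I" and v: "v \<in> S k" for k v
  proof -
    show "Re v > 0" using v by (simp add: S_def)
    have k': "N \<le> real k" "real k \<le> 2 * N" using k by (auto simp: I_def N_def)
    have Im: "\<bar>Im v - 2 * pi * real k\<bar> \<le> 2" "\<bar>Re v\<bar> \<le> N" using v by (auto simp: S_def)
    have "6 * N \<le> 2 * pi * real k" using k' pi_gt3 N by (intro mult_mono) auto
    then have "N \<le> \<bar>Im v\<bar>" using Im N(1) by linarith
    then show nN: "N \<le> norm v" using abs_Im_le_cmod[of v] by linarith
    then show "norm v \<ge> 3" using N by linarith
    have "2 * pi * real k \<le> 2 * 3.5 * (2 * N)" using k' N pi_less_4 pi_approx by (intro mult_mono) auto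
    then have "\<bar>Im v\<bar> \<le> 15 * N" using Im \<open>6 * N \<le> 2 * pi * real k\<close> N(1) by linarith
    then show "norm v \<le> 16 * N" using cmod_le[of v] Im by linarith
  qed
  have tr: "\<Psi> v \<in> tract R" if "k \<in> I" "v \<in> S k" for k v
  proof -
    have r: "Re (\<Psi> v) \<ge> R + 1" "\<bar>Im (\<Psi> v)\<bar> < 3/4 * h (Re (\<Psi> v))" using V2[of v] Sb[OF that] N by auto
    have "h (Re (\<Psi> v)) > 0" using r R X0(1) by (intro h_pos) auto
    then show ?thesis using r by (auto simp: tract_def)
  qed
  have near: "norm (\<Psi> v - of_real Q) \<le> Q / 2" if "k \<in> I" "v \<in> S k" for k v
    unfolding Q_def \<Lambda>_def using Sb[OF that] by (intro \<Psi>_near lnN N) auto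
  have \<Phi>\<Psi>: "\<Phi> (\<Psi> v) = v" if "k \<in> I" "v \<in> S k" for k v using Sb[OF that] by (intro \<Phi>_\<Psi>)
  have EC: "exp v = E (\<Psi> v) - J 1 3 (\<Psi> v)" if "k \<in> I" "v \<in> S k" for k v
    using Ein[OF tr[OF that]] \<Phi>\<Psi>[OF that] by (simp add: f_eq)
  have convS: "convex (S k)" for k
  proof -
    have "S k = {v. Re v \<ge> 1} \<inter> ({v. Re v \<le> N} \<inter> ({v. Im v \<le> 2 + 2 * pi * real k} \<inter> {v. Im v \<ge> 2 * pi * real k - 2}))"
      by (auto simp: S_def abs_le_iff)
    then show ?thesis
      by (simp only: convex_Int convex_halfspace_Re_ge convex_halfspace_Re_le convex_halfspace_Im_ge convex_halfspace_Im_le)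
  qed
  have clS: "closed (S k)" for k
    unfolding S_def by (intro closed_Collect_conj closed_Collect_le continuous_intros)
  have cpS: "compact (S k)" if "k \<in> I" for k
    unfolding compact_eq_bounded_closed
    using Sb(3)[OF that] by (intro conjI clS boundedI)
  have \<Psi>l: "norm (\<Psi> v - \<Psi> v') \<le> N powr (-1/2) * norm (v - v')" if "k \<in> I" "v \<in> S k" "v' \<in> S k" for k v v'
  proof (rule norm_\<Psi>_diff_le[OF convS _ that(2,3)])
    fix u assume u: "u \<in> S k"
    have "norm (\<Psi> u * (of_real q * Ln u powr of_real (q - 1) / u)) \<le> norm u powr (1/2 - 1)"
      using Sb[OF that(1) u] N by (intro V1) auto
    also have "\<dots> \<le> N powr (1/2 - 1)" using Sb[OF that(1) u] N by (intro powr_mono2') auto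
    finally show "Re u > 0 \<and> norm u \<ge> 3 \<and> norm (\<Psi> u * (of_real q * Ln u powr of_real (q - 1) / u)) \<le> N powr (-1/2)"
      using Sb[OF that(1) u] by simp
  qed
  have c\<Psi>: "continuous_on (S k) \<Psi>" if "k \<in> I" for k
    using Sb[OF that] by (intro DERIV_continuous_on[OF has_field_derivative_at_within[OF has_field_derivative_\<Psi>]]) auto
  have gh: "g holomorphic_on UNIV" unfolding g_def by (rule E_shift_holomorphic)
  then have gc: "continuous_on UNIV g" by (rule holomorphic_on_imp_continuous_on)
  have Kb: "Re u \<ge> Q / 2" "norm u \<le> l + 2 * Q" if "u \<in> K" for u
  proof -
    have n: "norm (u - of_real (Q + l)) \<le> Q / 2" using that by (simp add: K_def dist_norm norm_minus_commute)
    have "\<bar>Re (u - of_real (Q + l))\<bar> \<le> Q / 2" using abs_Re_le_cmod n order_trans by blast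
    then have "\<bar>Re u - (Q + l)\<bar> \<le> Q / 2" by simp
    then show "Re u \<ge> Q / 2" using l by linarith
    have "norm u \<le> norm (u - of_real (Q + l)) + norm (of_real (Q + l) :: complex)"
      using norm_triangle_ineq[of "u - of_real (Q + l)" "of_real (Q + l)"] by simp
    also have "norm (of_real (Q + l) :: complex) = Q + l" using l Q0 by (simp only: norm_of_real)
    finally show "norm u \<le> l + 2 * Q" using n Q0 by simp
  qed
  \<comment> \<open>Cutting out the preimage of \<open>K\<close> makes the pieces compact by
    continuity; that nothing of \<open>K\<close> is missed is proved separately in
    \<open>onto\<close>.\<close>
  define D where "D k = {v \<in> S k. E (\<Psi> v) \<in> K}" for k
  define Y where "Y k = (\<lambda>v. of_real l + \<Psi> v) ` D k" for k
  have DS: "v \<in> S k" if "v \<in> D k" for v k using that by (simp add: D_def)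
  have eD: "norm (exp v) \<le> l + 2 * Q + M" "Re (exp v) \<ge> 3" if k: "k \<in> I" and v: "v \<in> D k" for k v
  proof -
    have e: "exp v = E (\<Psi> v) - J 1 3 (\<Psi> v)" "norm (J 1 3 (\<Psi> v)) \<le> M" "E (\<Psi> v) \<in> K"
      using EC[OF k DS[OF v]] JM[OF tr[OF k DS[OF v]]] v by (auto simp: D_def)
    show "norm (exp v) \<le> l + 2 * Q + M"
      unfolding e(1) using norm_triangle_ineq4[of "E (\<Psi> v)" "J 1 3 (\<Psi> v)"] Kb[OF e(3)] e(2) by linarith
    show "Re (exp v) \<ge> 3"
      unfolding e(1) using Kb[OF e(3)] e(2) abs_Re_le_cmod[of "J 1 3 (\<Psi> v)"] N(5) by simp
  qed
  have cY: "compact (Y k)" if k: "k \<in> I" for k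
  proof -
    have "continuous_on (S k) (\<lambda>v. E (\<Psi> v))"
      using holomorphic_on_imp_continuous_on[OF E_holomorphic] c\<Psi>[OF k]
      by (rule continuous_on_compose2) simp
    then have "closed (S k \<inter> (\<lambda>v. E (\<Psi> v)) -` K)"
      by (rule continuous_closed_preimage[OF _ clS]) (simp add: K_def)
    moreover have "D k = S k \<inter> (\<lambda>v. E (\<Psi> v)) -` K" unfolding D_def by blast
    ultimately have "closed (D k)" by (simp only:)
    then have "compact (S k \<inter> D k)" using cpS[OF k] by (rule compact_Int_closed[rotated])
    moreover have "S k \<inter> D k = D k" by (auto simp: D_def)
    ultimately have "compact (D k)" by simp
    then show ?thesis unfolding Y_def
      using continuous_on_subset[OF c\<Psi>[OF k]] DS
      by (intro compact_continuous_image continuous_intros) blast+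
  qed
  have YK: "Y k \<subseteq> K" if k: "k \<in> I" for k
  proof
    fix z assume "z \<in> Y k"
    then obtain v where v: "v \<in> D k" "z = of_real l + \<Psi> v" by (auto simp: Y_def)
    have "of_real (Q + l) - z = - (\<Psi> v - of_real Q)" using v by simp
    then show "z \<in> K" using near[OF k DS[OF v(1)]] by (simp add: K_def dist_norm norm_minus_commute del: of_real_add)
  qed
  have disj: "Y j \<inter> Y k = {}" if jk: "j \<in> I" "k \<in> I" "j \<noteq> k" for j k
  proof (rule ccontr)
    assume "Y j \<inter> Y k \<noteq> {}"
    then obtain v v' where v: "v \<in> D j" "v' \<in> D k" "\<Psi> v = \<Psi> v'" by (auto simp: Y_def)
    have "v = \<Phi> (\<Psi> v)" by (rule \<Phi>\<Psi>[OF jk(1) DS[OF v(1)], symmetric])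
    also have "\<dots> = \<Phi> (\<Psi> v')" by (simp only: v(3))
    also have "\<dots> = v'" by (rule \<Phi>\<Psi>[OF jk(2) DS[OF v(2)]])
    finally have vv: "v' = v" by (rule sym)
    have *: "\<bar>Im v - 2 * pi * real j\<bar> \<le> 2" "\<bar>Im v - 2 * pi * real k\<bar> \<le> 2"
      using DS[OF v(1)] DS[OF v(2)] unfolding vv by (simp_all add: S_def)
    have "\<bar>2 * pi * real j - 2 * pi * real k\<bar> \<le> 4" using * by linarith
    moreover have "\<bar>2 * pi * real j - 2 * pi * real k\<bar> = 2 * pi * \<bar>real j - real k\<bar>"
      by (simp add: abs_mult flip: right_diff_distrib)
    moreover have "\<bar>real j - real k\<bar> \<ge> 1" using jk(3) by (cases "j < k") auto
    then have "2 * pi * \<bar>real j - real k\<bar> \<ge> 2 * pi * 1" by (intro mult_left_mono) auto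
    ultimately show False using pi_gt3 by linarith
  qed
  have onto: "K \<subseteq> g ` Y k" if k: "k \<in> I" for k
  proof
    fix u assume u: "u \<in> K"
    \<comment> \<open>\<open>E (\<Psi> v) = u\<close> means
      \<open>exp v = u - J 1 3 (\<Psi> v)\<close>, and \<open>T\<close> is the \<open>k\<close>-th
      logarithm of the right side. It contracts by 1/3: \<open>Ln\<close> contributes 1/3,
      \<open>J 1 3\<close> the factor \<open>M\<close>, \<open>\<Psi>\<close> the factor
      \<open>N powr (-1/2)\<close>, and the product of the last two is at most 1.\<close>
    define T where "T v = Ln (u - J 1 3 (\<Psi> v)) + of_real (2 * pi * real k) * \<i>" for v
    have Re3: "Re (u - J 1 3 (\<Psi> v)) \<ge> 3" and nu: "norm (u - J 1 3 (\<Psi> v)) \<le> exp N" if v: "v \<in> S k" for v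
    proof -
      have j: "norm (J 1 3 (\<Psi> v)) \<le> M" by (rule JM[OF tr[OF k v]])
      show "Re (u - J 1 3 (\<Psi> v)) \<ge> 3" using Kb[OF u] j abs_Re_le_cmod[of "J 1 3 (\<Psi> v)"] N(5) by simp
      show "norm (u - J 1 3 (\<Psi> v)) \<le> exp N"
        using norm_triangle_ineq4[of u "J 1 3 (\<Psi> v)"] Kb[OF u] j N(6) by linarith
    qed
    have TS: "T v \<in> S k" if v: "v \<in> S k" for v
    proof -
      let ?y = "u - J 1 3 (\<Psi> v)"
      have y: "norm ?y \<ge> 3" "Re ?y > 0" using Re3[OF v] complex_Re_le_cmod[of ?y] by linarith+
      then have y0: "?y \<noteq> 0" by (metis norm_zero not_numeral_le_zero)
      have "Re (Ln ?y) \<ge> 1" "\<bar>Im (Ln ?y)\<bar> \<le> 2" using Ln_strip[OF y(2,1)] by auto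
      moreover have "Re (Ln ?y) \<le> N"
      proof -
        have "ln (norm ?y) \<le> ln (exp N)" using nu[OF v] y by (subst ln_le_cancel_iff) auto
        then show ?thesis using y0 by simp
      qed
      ultimately show ?thesis by (simp add: S_def T_def)
    qed
    have "\<exists>!v\<in>S k. T v = v"
    proof (rule Banach_fix[where c = "1/3"])
      show "complete (S k)" using clS by (simp add: complete_eq_closed)
      have "Complex 1 (2 * pi * real k) \<in> S k" using N by (simp add: S_def)
      then show "S k \<noteq> {}" by blast
      show "T ` S k \<subseteq> S k" using TS by blast
      fix v v' assume v: "v \<in> S k" "v' \<in> S k"
      have "norm (T v - T v') = norm (Ln (u - J 1 3 (\<Psi> v)) - Ln (u - J 1 3 (\<Psi> v')))" by (simp add: T_def)
      also have "\<dots> \<le> norm ((u - J 1 3 (\<Psi> v)) - (u - J 1 3 (\<Psi> v'))) / 3"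
        using v by (intro norm_Ln_diff_le Re3) auto
      also have "\<dots> = norm (J 1 3 (\<Psi> v) - J 1 3 (\<Psi> v')) / 3" by (simp add: norm_minus_commute)
      also have "\<dots> \<le> M * norm (\<Psi> v - \<Psi> v') / 3"
        using v by (intro divide_right_mono Jl tr[OF k]) auto
      also have "\<dots> \<le> M * (N powr (-1/2) * norm (v - v')) / 3"
        using v M by (intro divide_right_mono mult_left_mono \<Psi>l[OF k]) auto
      also have "\<dots> = (M * N powr (-1/2)) * norm (v - v') / 3" by simp
      also have "\<dots> \<le> 1 * norm (v - v') / 3" by (intro divide_right_mono mult_right_mono N) auto
      finally show "dist (T v) (T v') \<le> 1/3 * dist v v'" by (simp add: dist_norm)
    qed auto
    then obtain v where v: "v \<in> S k" "T v = v" by blast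
    have "u - J 1 3 (\<Psi> v) \<noteq> 0" using Re3[OF v(1)] by auto
    have "exp v = exp (T v)" using v by simp
    also have "\<dots> = exp (Ln (u - J 1 3 (\<Psi> v))) * exp (of_real (2 * pi * real k) * \<i>)"
      unfolding T_def by (rule exp_add)
    also have "exp (of_real (2 * pi * real k) * \<i>) = (1::complex)"
      using exp_integer_2pi[of "of_nat k"] by (simp add: mult.commute mult.left_commute)
    also have "exp (Ln (u - J 1 3 (\<Psi> v))) = u - J 1 3 (\<Psi> v)" by (rule exp_Ln) fact
    finally have Eu: "E (\<Psi> v) = u" using EC[OF k v(1)] by simp
    then have "of_real l + \<Psi> v \<in> Y k" unfolding Y_def using v(1) u by (intro imageI) (simp add: D_def)
    moreover have "u = g (of_real l + \<Psi> v)" using Eu by (simp add: g_def)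
    ultimately show "u \<in> g ` Y k" by (rule rev_image_eqI)
  qed
  have wb: "norm w \<ge> 3" "norm w \<le> 2 * Q" "Re w > 1" if "norm (w - of_real Q) \<le> Q / 2" for w
  proof -
    have "\<bar>Re (w - of_real Q)\<bar> \<le> Q / 2" using abs_Re_le_cmod that order_trans by blast
    then have "\<bar>Re w - Q\<bar> \<le> Q / 2" by simp
    then have "Re w \<ge> Q / 2" by linarith
    then show "norm w \<ge> 3" "Re w > 1" using complex_Re_le_cmod[of w] Q0 by linarith+
    have "norm w \<le> norm (w - of_real Q) + norm (of_real Q :: complex)"
      using norm_triangle_ineq[of "w - of_real Q" "of_real Q"] by simp
    then show "norm w \<le> 2 * Q" using that Q0 by simp
  qed
  have ln2Q: "ln (2 * Q) \<le> \<Lambda> + 1"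
  proof -
    have "ln (2 * Q) = ln 2 + \<Lambda>" by (simp add: Q_def ln_mult)
    then show ?thesis using ln_2_less_1 by simp
  qed
  \<comment> \<open>On the pieces \<open>g\<close> is \<open>exp \<circ> \<Phi>\<close> plus the
    bounded part, up to translation: \<open>exp\<close> contributes \<open>B0\<close>,
    \<open>\<Phi>\<close> on the disc around \<open>Q\<close> contributes \<open>B1\<close>, the
    bounded part \<open>M\<close>.\<close>
  have lip: "norm (g x - g y) \<le> B * norm (x - y)" if k: "k \<in> I" and x: "x \<in> Y k" and y: "y \<in> Y k" for k x y
  proof -
    obtain v v' where v: "v \<in> D k" "x = of_real l + \<Psi> v" and v': "v' \<in> D k" "y = of_real l + \<Psi> v'"
      using x y by (auto simp: Y_def)
    define B0 where "B0 = l + 2 * Q + M"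
    have B0: "B0 > 0" using l M Q0 by (simp add: B0_def)
    have e1: "norm (exp v - exp v') \<le> B0 * norm (v - v')"
    proof (rule field_differentiable_bound[where S = "{u. Re u \<le> ln B0}"])
      fix u assume "u \<in> {u. Re u \<le> ln B0}"
      then have "exp (Re u) \<le> exp (ln B0)" by simp
      then show "norm (exp u) \<le> B0" using B0 by simp
      show "(exp has_field_derivative exp u) (at u within {u. Re u \<le> ln B0})"
        by (rule has_field_derivative_at_within[OF DERIV_exp])
    next
      have "Re u \<le> ln B0" if "u \<in> D k" for u
      proof -
        have "exp (Re u) \<le> B0" using eD(1)[OF k that] by (simp add: B0_def)
        then show ?thesis using B0 by (subst ln_ge_iff) auto
      qed
      then show "v \<in> {u. Re u \<le> ln B0}" "v' \<in> {u. Re u \<le> ln B0}" using v v' by auto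
    qed (rule convex_halfspace_Re_le)
    define B1 where "B1 = exp ((\<Lambda> + 5) powr (1 + p)) * ((1 + p) * (\<Lambda> + 5) powr p)"
    have "norm (\<Phi> (\<Psi> v) - \<Phi> (\<Psi> v')) \<le> B1 * norm (\<Psi> v - \<Psi> v')"
    proof (rule field_differentiable_bound[where S = "cball (of_real Q) (Q/2)"])
      fix w :: complex assume "w \<in> cball (of_real Q) (Q/2)"
      then have w: "norm (w - of_real Q) \<le> Q / 2" by (simp add: dist_norm norm_minus_commute)
      show "(\<Phi> has_field_derivative \<Phi> w * (of_real (1 + p) * Ln w powr of_real p / w)) (at w within cball (of_real Q) (Q/2))"
        by (rule has_field_derivative_at_within[OF has_field_derivative_\<Phi>[OF wb(3)[OF w]]])
      have "norm (\<Phi> w * (of_real (1 + p) * Ln w powr of_real p / w))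
         \<le> exp ((ln (2 * Q) + 4) powr (1 + p)) * ((1 + p) * (ln (2 * Q) + 4) powr p)"
        by (rule norm_deriv_\<Phi>_bounds(1)[OF wb(3,1,2)[OF w]])
      also have "\<dots> \<le> B1" unfolding B1_def
        using ln2Q p_pos Q0 by (intro mult_mono iffD2[OF exp_le_cancel_iff] powr_mono2) auto
      finally show "norm (\<Phi> w * (of_real (1 + p) * Ln w powr of_real p / w)) \<le> B1" .
    qed (use near[OF k DS[OF v(1)]] near[OF k DS[OF v'(1)]] in \<open>auto simp: dist_norm norm_minus_commute\<close>)
    then have e2: "norm (v - v') \<le> B1 * norm (x - y)"
      using \<Phi>\<Psi>[OF k DS[OF v(1)]] \<Phi>\<Psi>[OF k DS[OF v'(1)]] by (simp add: v(2) v'(2))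
    have "g x - g y = (exp v - exp v') + (J 1 3 (\<Psi> v) - J 1 3 (\<Psi> v'))"
      using EC[OF k DS[OF v(1)]] EC[OF k DS[OF v'(1)]] by (simp add: g_def v(2) v'(2))
    then have "norm (g x - g y) \<le> norm (exp v - exp v') + norm (J 1 3 (\<Psi> v) - J 1 3 (\<Psi> v'))"
      by (simp add: norm_triangle_ineq)
    also have "\<dots> \<le> B0 * (B1 * norm (x - y)) + M * norm (x - y)"
      using Jl[OF tr[OF k DS[OF v(1)]] tr[OF k DS[OF v'(1)]]] order_trans[OF e1 mult_left_mono[OF e2]] B0
      by (simp add: v(2) v'(2))
    also have "\<dots> = (B0 * B1 + M) * norm (x - y)" by (simp add: algebra_simps)
    also have "\<dots> \<le> B * norm (x - y)"
    proof (rule mult_right_mono)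
      have "B0 * B1 \<le> (l + M + 1 + 2 * Q) * B1" using p_pos by (intro mult_right_mono) (auto simp: B0_def B1_def)
      then show "B0 * B1 + M \<le> B" by (simp add: B_def B1_def)
    qed simp
    finally show ?thesis .
  qed
  have "0 \<le> (l + M + 1 + 2 * Q) * (exp ((\<Lambda> + 5) powr (1 + p)) * ((1 + p) * (\<Lambda> + 5) powr p))"
    using M l Q0 p_pos by (intro mult_nonneg_nonneg) auto
  then have B1: "B \<ge> 1" unfolding B_def using M by linarith
  have cI: "card I = n" "finite I" by (auto simp: I_def)
  have n2: "n \<ge> 2" using N(1) by (simp add: N_def)
  \<comment> \<open>Since \<open>\<Lambda> powr (1 + p) = ln N\<close>, the constant
    \<open>B\<close> is at most \<open>N powr (1/t)\<close>, so its power \<open>t\<close> does not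
    exceed the number of branches.\<close>
  have "B powr t \<le> exp (1/t * \<Lambda> powr (1 + p)) powr t" using N(8) B1 t by (intro powr_mono2) auto
  also have "\<dots> = N" unfolding \<Lambda>N using t N(1) by (simp add: powr_def)
  finally have Bt: "B powr t \<le> real (card I)" by (simp add: cI N_def)
  have Kne: "K \<noteq> {}" using Q0 by (simp add: K_def)
  have "\<exists>X. compact X \<and> X \<subseteq> (\<Union>k\<in>I. Y k) \<and> g ` X \<subseteq> X \<and> ennreal t \<le> hausdorff_dim X"
  proof (rule expanding_full_shift_dim[where K = K and B = B])
    show "2 \<le> card I" using cI n2 by simp
  qed (fact gc cI(2) t(1) cY YK Kne disj onto B1 Bt lip)+
  then obtain X where X: "compact X" "X \<subseteq> (\<Union>k\<in>I. Y k)" "g ` X \<subseteq> X" "ennreal t \<le> hausdorff_dim X"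
    by blast
  \<comment> \<open>The derivative \<open>f'\<close> has modulus at least \<open>M + 2\<close>:
    \<open>f w\<close> has modulus at least 1, and \<open>\<Phi>\<close> has derivative at least
    \<open>N / (2 * Q)\<close> in modulus. The bounded part can take away at most its Lipschitz
    constant \<open>M\<close>.\<close>
  have exp2: "norm (deriv g z) \<ge> 2" if z: "z \<in> X" for z
  proof -
    obtain k v where k: "k \<in> I" and v: "v \<in> D k" "z = of_real l + \<Psi> v" using z X(2) by (auto simp: Y_def)
    define w where "w = \<Psi> v"
    have wT: "w \<in> tract R" unfolding w_def by (rule tr[OF k DS[OF v(1)]])
    have wn: "norm (w - of_real Q) \<le> Q / 2" unfolding w_def by (rule near[OF k DS[OF v(1)]])
    have oT: "open (tract R)" using R X0(1) by (intro open_tract) auto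
    obtain d where d: "(J 1 3 has_field_derivative d) (at w)" using Jd[OF wT] by (auto simp: field_differentiable_def)
    have dM: "norm d \<le> M"
    proof (rule tendsto_upperbound[of "\<lambda>y. norm ((J 1 3 y - J 1 3 w) / (y - w))" _ "at w"])
      show "((\<lambda>y. norm ((J 1 3 y - J 1 3 w) / (y - w))) \<longlongrightarrow> norm d) (at w)"
        using d unfolding has_field_derivative_iff by (rule tendsto_norm)
      have "eventually (\<lambda>y. y \<in> tract R) (at w)" using eventually_at_in_open'[OF oT wT] .
      moreover have "eventually (\<lambda>y. y \<noteq> w) (at w)" by (simp add: eventually_at_filter)
      ultimately show "eventually (\<lambda>y. norm ((J 1 3 y - J 1 3 w) / (y - w)) \<le> M) (at w)"
      proof eventually_elim
        case (elim y)
        then show ?case using Jl[OF elim(1) wT] by (simp add: norm_divide field_simps)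
      qed
    qed auto
    define f' where "f' = f w * (\<Phi> w * (of_real (1 + p) * Ln w powr of_real p / w))"
    have df: "((\<lambda>w. f w + J 1 3 w) has_field_derivative f' + d) (at w)"
      unfolding f'_def by (intro DERIV_add has_field_derivative_f d wb(3)[OF wn])
    have dE: "(E has_field_derivative f' + d) (at w)"
      by (rule has_field_derivative_transform_within_open[OF df oT wT]) (simp add: Ein)
    have "z - of_real l = w" by (simp add: w_def v(2))
    then have "((\<lambda>z. E (z - of_real l)) has_field_derivative (f' + d) * 1) (at z)"
      using dE by (intro DERIV_chain2[where f = E and g = "\<lambda>z. z - of_real l"]) (auto intro!: derivative_eq_intros)
    then have "deriv g z = f' + d" unfolding g_def by (simp add: DERIV_imp_deriv)
    moreover have "norm f' \<ge> M + 2"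
    proof -
      have fw: "f w = exp v" "\<Phi> w = v" using \<Phi>\<Psi>[OF k DS[OF v(1)]] by (auto simp: w_def f_eq)
      have "1 \<le> norm (f w)" using eD(2)[OF k v(1)] complex_Re_le_cmod[of "exp v"] unfolding fw by linarith
      moreover have "M + 2 \<le> norm (\<Phi> w * (of_real (1 + p) * Ln w powr of_real p / w))"
      proof -
        have "M + 2 \<le> N / (2 * Q)" using N(9) Q0 by (simp add: field_simps)
        also have "\<dots> \<le> norm (\<Phi> w) / (2 * Q)" unfolding fw using Sb(2)[OF k DS[OF v(1)]] Q0 by (intro divide_right_mono) auto
        also have "\<dots> \<le> norm (\<Phi> w * (of_real (1 + p) * Ln w powr of_real p / w))"
          by (rule norm_deriv_\<Phi>_bounds(2)[OF wb(3,1,2)[OF wn]])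
        finally show ?thesis .
      qed
      ultimately have "1 * (M + 2) \<le> norm (f w) * norm (\<Phi> w * (of_real (1 + p) * Ln w powr of_real p / w))"
        using M by (intro mult_mono) auto
      then show ?thesis by (simp only: f'_def norm_mult mult_1)
    qed
    moreover have "norm f' \<le> norm (f' + d) + norm d" using norm_triangle_ineq4[of "f' + d" d] by simp
    ultimately show ?thesis using dM by simp
  qed
  have inX: "(g ^^ m) z \<in> X" if "z \<in> X" for z m
    by (induction m) (use that X(3) in auto)
  have expn: "norm (deriv (g ^^ m) z) \<ge> 2 ^ m" if z: "z \<in> X" for z m
  proof (induction m)
    case (Suc m)
    have "2 * 2 ^ m \<le> norm (deriv g ((g ^^ m) z)) * norm (deriv (g ^^ m) z)"
      by (intro mult_mono exp2[OF inX[OF z]] Suc) auto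
    then show ?case unfolding deriv_funpow_Suc[OF gh] norm_mult by simp
  qed (simp add: id_def)
  have "hyperbolic_set g X"
    unfolding hyperbolic_set_def using X expn
    by (intro conjI exI[of _ 1] exI[of _ 2]) auto
  then show ?thesis using X(4) unfolding g_def[abs_def] by blast
qed

section \<open>The limit\<close>

lemma HypDim_limit: "((\<lambda>l::real. HypDim (\<lambda>z. E (z - of_real l))) \<longlongrightarrow> 1) at_top"
proof (rule order_tendstoI)
  fix a :: ennreal assume "a < 1"
  then obtain b where b: "a < b" "b < 1" using dense by blast
  then obtain t where t: "b = ennreal t" "t \<ge> 0" by (cases b) auto
  have t1: "0 < t" "t < 1"
    using b t by (auto simp: ennreal_less_one_iff zero_less_iff_neq_zero intro: ccontr)
  show "eventually (\<lambda>l::real. a < HypDim (\<lambda>z. E (z - of_real l))) at_top"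
    using eventually_ge_at_top[of "0::real"]
  proof eventually_elim
    case (elim l)
    obtain X where X: "hyperbolic_set (\<lambda>z. E (z - of_real l)) X" "ennreal t \<le> hausdorff_dim X"
      using hausdorff_dim_hyperbolic_ge[OF t1 elim] by blast
    have "hausdorff_dim X \<le> HypDim (\<lambda>z. E (z - of_real l))"
      unfolding HypDim_def using X(1) by (intro SUP_upper) simp
    then show ?case using b(1) t(1) X(2) by order
  qed
next
  fix a :: ennreal assume "1 < a"
  then obtain b where b: "1 < b" "b < a" using dense by blast
  then have "b \<noteq> top" by auto
  then obtain s where s: "b = ennreal s" "s \<ge> 0" by (cases b) auto
  have s1: "s > 1" using b(1) s by (simp add: ennreal_less_iff flip: ennreal_1)
  obtain L where L: "\<And>l X. l \<ge> L \<Longrightarrow> hyperbolic_set (\<lambda>z. E (z - of_real l)) X \<Longrightarrow> hausdorff_dim X \<le> ennreal s"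
    using hausdorff_dim_hyperbolic_le[OF s1] by blast
  show "eventually (\<lambda>l::real. HypDim (\<lambda>z. E (z - of_real l)) < a) at_top"
    using eventually_ge_at_top[of L]
  proof eventually_elim
    case (elim l)
    have "HypDim (\<lambda>z. E (z - of_real l)) \<le> ennreal s"
      unfolding HypDim_def using L[OF elim] by (intro SUP_least) auto
    then show ?case using b s by order
  qed
qed

end

theorem mainTheorem2:
  fixes p :: real
  assumes "p > 0"
  shows "((\<lambda>l::real. HypDim (\<lambda>z. stallard_E p (z - of_real l))) \<longlongrightarrow> 1) at_top"
proof -
  interpret stallard p by unfold_locales (rule assms)
  show ?thesis unfolding stallard_E_eq by (rule HypDim_limit)
qed

end
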